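(* Let $\mathcal{H}$ be a nonzero complex Hilbert space and $n\geq 2$. Let $f\in OM_{1}$ be non-constant. For $\mathbb{A}\in B(\mathcal{H})_{+}^{n}$ and $\omega\in\Delta_{n}$, let $M(\omega;\mathbb{A})$ be either the ALM mean $\mathfrak{G}_{ALM}(\mathbb{A})$ (in which case only $\omega=(\frac1n,\dots,\frac1n)$ is allowed), or the weighted BMP mean $\mathfrak{G}_{BMP}(\omega;\mathbb{A})$, or the log-Euclidean mean $\mathfrak{G}_{E}(\omega;\mathbb{A})$. Then for all $\mathbb{T}=(T_{1},\dots,T_{n})\in B(\mathcal{H})_{sa}^{n}$ and $\omega=(w_{1},\dots,w_{n})\in\Delta_{n}$ (with $\omega=(\frac1n,\dots,\frac1n)$ in the ALM case) the following are equivalent: (1) $\sum_{i=1}^{n}w_{i}T_{i}\leq 0$; (2) $M(\omega;f(\lambda T_{1}+I),\dots,f(\lambda T_{n}+I))\leq I$ for all sufficiently small $\lambda\geq 0$.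
   Context: $B(\mathcal{H})$ is the algebra of bounded linear operators on $\mathcal{H}$, $I$ is the identity, $B(\mathcal{H})_{sa}$ is the set of self-adjoint operators, and $B(\mathcal{H})_{+}$ is the set of positive definite (positive and invertible) operators. For self-adjoint $A,B$, $A\leq B$ means $B-A$ is positive semi-definite. $\Delta_{n}$ is the set of $\omega=(w_1,\dots,w_n)\in(0,1)^n$ with $\sum_k w_k=1$. A real-valued function $f$ on an interval $J$ is operator monotone if $A\leq B$ implies $f(A)\leq f(B)$ for all self-adjoint $A,B$ (on any complex Hilbert space) with spectra in $J$; $OM_{1}$ is the set of operator monotone functions $f:(0,\infty)\to(0,\infty)$ with $f(1)=1$. "For all sufficiently small $\lambda\ge0$" means: there is $\lambda_0>0$ such that for all $\lambda\in[0,\lambda_0]$ the operators $\lambda T_i+I$ have spectra in $(0,\infty)$ and the inequality holds. Weighted geometric mean of two operators: $A\sharp_{w}B=A^{1/2}(A^{-1/2}BA^{-1/2})^{w}A^{1/2}$ for $A,B\in B(\mathcal{H})_+$, $w\in[0,1]$. Limits of operator sequences below are in the Thompson metric $d(A,B)=\max\{\log M(A/B),\log M(B/A)\}$ on $B(\mathcal{H})_+$, where $M(A/B)=\inf\{\alpha>0: B\leq\alpha A\}$. ALM mean: for $n=2$, $\mathfrak{G}_{ALM}(A_1,A_2)=A_1\sharp_{1/2}A_2$. If it is defined for $(n-1)$-tuples, then for $\mathbb{A}=(A_1,\dots,A_n)$ set $A_i^{(0)}=A_i$ and $A_i^{(r+1)}=\mathfrak{G}_{ALM}\big((A_j^{(r)})_{j\neq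 i}\big)$, where $(A_j^{(r)})_{j\ne i}=(A_1^{(r)},\dots,A_{i-1}^{(r)},A_{i+1}^{(r)},\dots,A_n^{(r)})$. It is known that $\lim_{r\to\infty}A_i^{(r)}$ exists and does not depend on $i$; $\mathfrak{G}_{ALM}(\mathbb{A})$ is this limit. BMP mean: for $n=2$ and $\omega=(1-w,w)\in\Delta_2$, $\mathfrak{G}_{BMP}(\omega;A_1,A_2)=A_1\sharp_{w}A_2$. If it is defined on $\Delta_{n-1}\times B(\mathcal{H})_+^{n-1}$, then for $\omega\in\Delta_n$ and $\mathbb{A}\in B(\mathcal{H})_+^n$ set $A_i^{(0)}=A_i$ and $A_i^{(r+1)}=\mathfrak{G}_{BMP}\big(\hat\omega_{\neq i};(A_j^{(r)})_{j\neq i}\big)\sharp_{w_i}A_i^{(r)}$, where $\hat\omega_{\neq i}=\frac{1}{\sum_{j\neq i}w_j}(w_j)_{j\neq i}$. It is known that $\lim_{r\to\infty}A_i^{(r)}$ exists and does not depend on $i$; $\mathfrak{G}_{BMP}(\omega;\mathbb{A})$ is this limit. Log-Euclidean mean: $\mathfrak{G}_{E}(\omega;\mathbb{A})=\exp\left(\sum_{i=1}^{n}w_{i}\log A_{i}\right)$. *)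

theory Defs
  imports "HOL-Analysis.Analysis" "HOL-Computational_Algebra.Polynomial"
begin

section \<open>Complex Hilbert spaces as structures on a carrier set\<close>

text \<open>
  Operator monotonicity quantifies over Hilbert spaces inside a formula, so a Hilbert space is an
  object here: a record with an explicit carrier set. The inner product is linear in its second
  argument.
\<close>

record 'u hspace =
  hcarrier :: "'u set"
  hadd :: "'u \<Rightarrow> 'u \<Rightarrow> 'u"
  hzero :: "'u"
  hscale :: "complex \<Rightarrow> 'u \<Rightarrow> 'u"
  hinner :: "'u \<Rightarrow> 'u \<Rightarrow> complex"

definition hsub :: "'u hspace \<Rightarrow> 'u \<Rightarrow> 'u \<Rightarrow> 'u" where
  "hsub K x y = hadd K x (hscale K (- 1) y)"

definition hnorm :: "'u hspace \<Rightarrow> 'u \<Rightarrow> real" where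
  "hnorm K x = sqrt (Re (hinner K x x))"

locale complex_hilbert_space =
  fixes K :: "'u hspace"
  assumes zero_closed: "hzero K \<in> hcarrier K"
    and add_closed: "x \<in> hcarrier K \<Longrightarrow> y \<in> hcarrier K \<Longrightarrow> hadd K x y \<in> hcarrier K"
    and scale_closed: "x \<in> hcarrier K \<Longrightarrow> hscale K a x \<in> hcarrier K"
    and add_assoc: "x \<in> hcarrier K \<Longrightarrow> y \<in> hcarrier K \<Longrightarrow> z \<in> hcarrier K \<Longrightarrow>
      hadd K (hadd K x y) z = hadd K x (hadd K y z)"
    and add_commute: "x \<in> hcarrier K \<Longrightarrow> y \<in> hcarrier K \<Longrightarrow> hadd K x y = hadd K y x"
    and add_zero: "x \<in> hcarrier K \<Longrightarrow> hadd K x (hzero K) = x"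
    and sub_self: "x \<in> hcarrier K \<Longrightarrow> hsub K x x = hzero K"
    and scale_add_right: "x \<in> hcarrier K \<Longrightarrow> y \<in> hcarrier K \<Longrightarrow>
      hscale K a (hadd K x y) = hadd K (hscale K a x) (hscale K a y)"
    and scale_add_left: "x \<in> hcarrier K \<Longrightarrow>
      hscale K (a + b) x = hadd K (hscale K a x) (hscale K b x)"
    and scale_scale: "x \<in> hcarrier K \<Longrightarrow> hscale K a (hscale K b x) = hscale K (a * b) x"
    and scale_one: "x \<in> hcarrier K \<Longrightarrow> hscale K 1 x = x"
    and inner_commute: "x \<in> hcarrier K \<Longrightarrow> y \<in> hcarrier K \<Longrightarrow> hinner K x y = cnj (hinner K y x)"
    and inner_add_right: "x \<in> hcarrier K \<Longrightarrow> y \<in> hcarrier K \<Longrightarrow> z \<in> hcarrier K \<Longrightarrow>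
      hinner K x (hadd K y z) = hinner K x y + hinner K x z"
    and inner_scale_right: "x \<in> hcarrier K \<Longrightarrow> y \<in> hcarrier K \<Longrightarrow>
      hinner K x (hscale K a y) = a * hinner K x y"
    and inner_pos: "x \<in> hcarrier K \<Longrightarrow> x \<noteq> hzero K \<Longrightarrow> 0 < Re (hinner K x x)"
    and complete: "\<And>X :: nat \<Rightarrow> 'u. (\<And>m. X m \<in> hcarrier K) \<Longrightarrow>
      (\<And>e. 0 < e \<Longrightarrow> \<exists>N. \<forall>i\<ge>N. \<forall>j\<ge>N. hnorm K (hsub K (X i) (X j)) < e) \<Longrightarrow>
      \<exists>x\<in>hcarrier K. (\<lambda>m. hnorm K (hsub K (X m) x)) \<longlonglongrightarrow> 0"

text \<open>Operators are extensional functions, so that they are determined by their values on the carrier.\<close>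

definition bounded_ops :: "'u hspace \<Rightarrow> ('u \<Rightarrow> 'u) set" where
  "bounded_ops K = {A \<in> hcarrier K \<rightarrow>\<^sub>E hcarrier K.
     (\<forall>x\<in>hcarrier K. \<forall>y\<in>hcarrier K. A (hadd K x y) = hadd K (A x) (A y)) \<and>
     (\<forall>a. \<forall>x\<in>hcarrier K. A (hscale K a x) = hscale K a (A x)) \<and>
     (\<exists>C. \<forall>x\<in>hcarrier K. hnorm K (A x) \<le> C * hnorm K x)}"

definition selfadjoint_ops :: "'u hspace \<Rightarrow> ('u \<Rightarrow> 'u) set" where
  "selfadjoint_ops K = {A \<in> bounded_ops K.
     \<forall>x\<in>hcarrier K. \<forall>y\<in>hcarrier K. hinner K (A x) y = hinner K x (A y)}"

definition op_le :: "'u hspace \<Rightarrow> ('u \<Rightarrow> 'u) \<Rightarrow> ('u \<Rightarrow> 'u) \<Rightarrow> bool" where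
  "op_le K A B \<longleftrightarrow> (\<forall>x\<in>hcarrier K. hinner K x (hsub K (B x) (A x)) \<in> \<real>\<^sub>\<ge>\<^sub>0)"

definition spectrum :: "'u hspace \<Rightarrow> ('u \<Rightarrow> 'u) \<Rightarrow> complex set" where
  "spectrum K A = {c. \<not> (\<exists>R\<in>bounded_ops K. \<forall>x\<in>hcarrier K.
     R (hsub K (A x) (hscale K c x)) = x \<and> hsub K (A (R x)) (hscale K c (R x)) = x)}"

text \<open>Horner evaluation of a real polynomial at an operator.\<close>

definition poly_op :: "'u hspace \<Rightarrow> real poly \<Rightarrow> ('u \<Rightarrow> 'u) \<Rightarrow> 'u \<Rightarrow> 'u" where
  "poly_op K p A =
     fold_coeffs (\<lambda>a S x. hadd K (hscale K (of_real a) x) (A (S x))) p (\<lambda>_. hzero K)"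

definition op_tendsto :: "'u hspace \<Rightarrow> (nat \<Rightarrow> 'u \<Rightarrow> 'u) \<Rightarrow> ('u \<Rightarrow> 'u) \<Rightarrow> bool" where
  "op_tendsto K S X \<longleftrightarrow> (\<forall>e>0. \<forall>\<^sub>F m in sequentially.
     \<forall>x\<in>hcarrier K. hnorm K (hsub K (S m x) (X x)) \<le> e * hnorm K x)"

text \<open>
  Continuous functional calculus as a relation: \<open>X\<close> is \<open>f(A)\<close> for self-adjoint \<open>A\<close>. It is
  single-valued, and \<open>f(A)\<close> exists exactly if \<open>f\<close> is continuous on the spectrum of \<open>A\<close>.
\<close>

definition is_fcalc :: "'u hspace \<Rightarrow> (real \<Rightarrow> real) \<Rightarrow> ('u \<Rightarrow> 'u) \<Rightarrow> ('u \<Rightarrow> 'u) \<Rightarrow> bool" where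
  "is_fcalc K f A X \<longleftrightarrow> X \<in> bounded_ops K \<and>
     (\<exists>p :: nat \<Rightarrow> real poly.
        uniform_limit {t. of_real t \<in> spectrum K A} (\<lambda>m. poly (p m)) f sequentially \<and>
        op_tendsto K (\<lambda>m. poly_op K (p m) A) X)"

text \<open>
  The type argument bounds the Hilbert spaces that are considered: all those whose elements form a
  set of elements of type \<open>'u\<close>. Continuity of \<open>f\<close> is not required: if all complex matrices are
  included and \<open>J\<close> is open, it follows from the case of matrices, whose spectra are finite.
\<close>

definition operator_monotone_on :: "'u itself \<Rightarrow> real set \<Rightarrow> (real \<Rightarrow> real) \<Rightarrow> bool" where
  "operator_monotone_on (_ :: 'u itself) J f \<longleftrightarrow>
     (\<forall>(K :: 'u hspace) A B X Y.
        complex_hilbert_space K \<and> A \<in> selfadjoint_ops K \<and> B \<in> selfadjoint_ops K \<and>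
        spectrum K A \<subseteq> of_real ` J \<and> spectrum K B \<subseteq> of_real ` J \<and>
        is_fcalc K f A X \<and> is_fcalc K f B Y \<and> op_le K A B
        \<longrightarrow> op_le K X Y)"

definition OM1 :: "'u itself \<Rightarrow> (real \<Rightarrow> real) set" where
  "OM1 U = {f. operator_monotone_on U {0<..} f \<and> (\<forall>t>0. 0 < f t) \<and> f 1 = 1}"


section \<open>Complex Hilbert spaces as types\<close>

class complex_hilbert = real_inner + complete_space +
  fixes scaleC :: "complex \<Rightarrow> 'a \<Rightarrow> 'a"  (infixr \<open>*\<^sub>C\<close> 75)
    and cinner :: "'a \<Rightarrow> 'a \<Rightarrow> complex"
  assumes scaleC_add_right: "a *\<^sub>C (x + y) = a *\<^sub>C x + a *\<^sub>C y"
    and scaleC_add_left: "(a + b) *\<^sub>C x = a *\<^sub>C x + b *\<^sub>C x"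
    and scaleC_scaleC: "a *\<^sub>C b *\<^sub>C x = (a * b) *\<^sub>C x"
    and scaleC_of_real: "of_real r *\<^sub>C x = r *\<^sub>R x"
    and cinner_commute: "cinner x y = cnj (cinner y x)"
    and cinner_add_right: "cinner x (y + z) = cinner x y + cinner x z"
    and cinner_scaleC_right: "cinner x (a *\<^sub>C y) = a * cinner x y"
    and Re_cinner: "Re (cinner x y) = inner x y"
begin

subclass banach ..

end

instantiation complex :: complex_hilbert
begin

definition scaleC_complex :: "complex \<Rightarrow> complex \<Rightarrow> complex" where
  "scaleC_complex a x = a * x"

definition cinner_complex :: "complex \<Rightarrow> complex \<Rightarrow> complex" where
  "cinner_complex x y = cnj x * y"

instance
  by standard
    (simp_all add: scaleC_complex_def cinner_complex_def algebra_simps inner_complex_def scaleR_conv_of_real)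

end

definition hs :: "'h::complex_hilbert hspace" where
  "hs = \<lparr>hcarrier = UNIV, hadd = (+), hzero = 0, hscale = scaleC, hinner = cinner\<rparr>"

lemma hs_simps [simp]:
  "hcarrier hs = UNIV" "hadd hs = (+)" "hzero hs = 0" "hscale hs = scaleC" "hinner hs = cinner"
  by (simp_all add: hs_def)

lemma hsub_hs [simp]: "hsub hs x y = x - (y :: 'h::complex_hilbert)"
  using scaleC_of_real[of "- 1" y] by (simp add: hsub_def)

lemma hnorm_hs [simp]: "hnorm hs (x :: 'h::complex_hilbert) = norm x"
  by (simp add: hnorm_def Re_cinner norm_eq_sqrt_inner)

lemma complex_hilbert_space_hs: "complex_hilbert_space (hs :: 'h::complex_hilbert hspace)"
proof
  fix X :: "nat \<Rightarrow> 'h"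
  assume "\<And>e. 0 < e \<Longrightarrow> \<exists>N. \<forall>i\<ge>N. \<forall>j\<ge>N. hnorm hs (hsub hs (X i) (X j)) < e"
  then have "Cauchy X"
    by (simp add: Cauchy_def dist_norm)
  then obtain x where "X \<longlonglongrightarrow> x"
    using Cauchy_convergent_iff convergent_def by blast
  then have "(\<lambda>m. norm (X m - x)) \<longlonglongrightarrow> 0"
    using LIM_zero tendsto_norm_zero by blast
  then show "\<exists>x\<in>hcarrier hs. (\<lambda>m. hnorm hs (hsub hs (X m) x)) \<longlonglongrightarrow> 0"
    by auto
next
  fix x :: 'h and a
  show "hscale hs 1 x = x"
    using scaleC_of_real[of 1 x] by simp
next
  fix x y :: 'h
  show "hinner hs x y = cnj (hinner hs y x)"
    using cinner_commute by simp
qed (simp_all add: scaleC_add_right scaleC_add_left scaleC_scaleC add.assoc add.commute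
    cinner_add_right cinner_scaleC_right Re_cinner)

text \<open>
  The library type \<open>'h \<Rightarrow>\<^sub>L 'h\<close> consists of the bounded real-linear operators; \<open>BH\<close> is the algebra of
  bounded complex-linear ones.
\<close>

type_synonym 'h oper = "'h \<Rightarrow>\<^sub>L 'h"

definition BH :: "'h::complex_hilbert oper set" where
  "BH = {A. blinfun_apply A \<in> bounded_ops hs}"

definition BH_sa :: "'h::complex_hilbert oper set" where
  "BH_sa = {A. blinfun_apply A \<in> selfadjoint_ops hs}"

definition ole :: "'h::complex_hilbert oper \<Rightarrow> 'h oper \<Rightarrow> bool"  (infix \<open>\<preceq>\<close> 50) where
  "A \<preceq> B \<longleftrightarrow> op_le hs (blinfun_apply A) (blinfun_apply B)"

definition spec :: "'h::complex_hilbert oper \<Rightarrow> complex set" where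
  "spec A = spectrum hs (blinfun_apply A)"

definition BH_pos :: "'h::complex_hilbert oper set" where
  "BH_pos = {A \<in> BH_sa. 0 \<preceq> A \<and> (\<exists>B\<in>BH. A o\<^sub>L B = id_blinfun \<and> B o\<^sub>L A = id_blinfun)}"

definition fcalc :: "(real \<Rightarrow> real) \<Rightarrow> 'h::complex_hilbert oper \<Rightarrow> 'h oper" where
  "fcalc f A = (THE X. is_fcalc hs f (blinfun_apply A) (blinfun_apply X))"


section \<open>Means\<close>

definition gmean :: "real \<Rightarrow> 'h::complex_hilbert oper \<Rightarrow> 'h oper \<Rightarrow> 'h oper" where
  "gmean w A B =
     (let R = fcalc (\<lambda>t. t powr (1/2)) A; R' = fcalc (\<lambda>t. t powr (- 1/2)) A
      in R o\<^sub>L fcalc (\<lambda>t. t powr w) (R' o\<^sub>L B o\<^sub>L R') o\<^sub>L R)"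

definition Mratio :: "'h::complex_hilbert oper \<Rightarrow> 'h oper \<Rightarrow> real" where
  "Mratio A B = Inf {\<alpha>. 0 < \<alpha> \<and> B \<preceq> \<alpha> *\<^sub>R A}"

definition thompson :: "'h::complex_hilbert oper \<Rightarrow> 'h oper \<Rightarrow> real" where
  "thompson A B = max (ln (Mratio A B)) (ln (Mratio B A))"

text \<open>An \<open>n\<close>-tuple is a function on \<open>nat\<close> whose values at \<open>0, \<dots>, n - 1\<close> are its entries.\<close>

definition weights :: "nat \<Rightarrow> (nat \<Rightarrow> real) set" where
  "weights n = {w. (\<forall>i<n. 0 < w i \<and> w i < 1) \<and> (\<Sum>i<n. w i) = 1}"

definition omit :: "nat \<Rightarrow> (nat \<Rightarrow> 'a) \<Rightarrow> nat \<Rightarrow> 'a" where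
  "omit i A = (\<lambda>j. if j < i then A j else A (Suc j))"

definition omit_weight :: "nat \<Rightarrow> nat \<Rightarrow> (nat \<Rightarrow> real) \<Rightarrow> nat \<Rightarrow> real" where
  "omit_weight n i w = (\<lambda>j. omit i w j / (\<Sum>k\<in>{..<n} - {i}. w k))"

text \<open>The common Thompson limit of the first \<open>n\<close> entries of a sequence of tuples.\<close>

definition common_lim :: "nat \<Rightarrow> (nat \<Rightarrow> nat \<Rightarrow> 'h::complex_hilbert oper) \<Rightarrow> 'h oper" where
  "common_lim n S = (THE L. L \<in> BH_pos \<and> (\<forall>i<n. (\<lambda>r. thompson (S r i) L) \<longlonglongrightarrow> 0))"

text \<open>Both recursions start at \<open>n = 2\<close>; the values for \<open>n < 2\<close> are irrelevant.\<close>

fun alm :: "nat \<Rightarrow> (nat \<Rightarrow> 'h::complex_hilbert oper) \<Rightarrow> 'h oper" where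
  "alm (Suc (Suc 0)) A = gmean (1/2) (A 0) (A 1)"
| "alm (Suc (Suc (Suc m))) A =
     common_lim (Suc (Suc (Suc m)))
       (\<lambda>r. ((\<lambda>S i. alm (Suc (Suc m)) (omit i S)) ^^ r) A)"

fun bmp :: "nat \<Rightarrow> (nat \<Rightarrow> real) \<Rightarrow> (nat \<Rightarrow> 'h::complex_hilbert oper) \<Rightarrow> 'h oper" where
  "bmp (Suc (Suc 0)) w A = gmean (w 1) (A 0) (A 1)"
| "bmp (Suc (Suc (Suc m))) w A =
     common_lim (Suc (Suc (Suc m)))
       (\<lambda>r. ((\<lambda>S i. gmean (w i)
                (bmp (Suc (Suc m)) (omit_weight (Suc (Suc (Suc m))) i w) (omit i S))
                (S i)) ^^ r) A)"

definition log_euclid :: "nat \<Rightarrow> (nat \<Rightarrow> real) \<Rightarrow> (nat \<Rightarrow> 'h::complex_hilbert oper) \<Rightarrow> 'h oper" where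
  "log_euclid n w A = fcalc exp (\<Sum>i<n. w i *\<^sub>R fcalc ln (A i))"

end

theory Submission
  imports Defs "HOL-Computational_Algebra.Fundamental_Theorem_Algebra"
begin

text \<open>
  Compare \<open>diag (A 0, \<dots>)\<close> on \<open>H\<^sup>n\<close> with \<open>y P + \<mu> (1 - P)\<close>, where \<open>P\<close> is the projection onto the range of
  the isometry \<open>V v = (sqrt (w i) v)\<^sub>i\<close>: if \<open>\<Sum>w i A i \<le> t\<close>, then for every \<open>y > t\<close> the diagonal operator is
  dominated for large \<open>\<mu>\<close>, and applying \<open>f\<close> and compressing by \<open>V\<close> gives \<open>\<Sum>w i f (A i) \<le> f y\<close>. Hence
  \<open>\<Sum>w i T i \<le> 0\<close> implies \<open>\<Sum>w i f (\<lambda> T i + 1) \<le> 1\<close>. The same comparison for scalars \<open>A i\<close> and \<open>n = 2\<close>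
  shows that \<open>f\<close> is continuous and concave, that its Loewner determinants are nonnegative, which
  excludes a kink at \<open>1\<close>, and that \<open>f' 1 > 0\<close>.

  Each of the means \<open>G\<close> satisfies: \<open>\<Sum>w i A i \<le> 1\<close> implies \<open>G \<le> 1\<close>, and \<open>G \<le> 1\<close> implies
  \<open>1 \<le> \<Sum>w i (A i)\<inverse>\<close>. For the log-Euclidean mean this is \<open>1 - 1/t \<le> ln t \<le> t - 1\<close>. The ALM and BMP
  means lie between the weighted harmonic and arithmetic means; this, and the convergence of the
  iterations defining them, follows from the tangent bounds
  \<open>A #\<^sub>w B \<le> (1 - w) e\<^sup>x A + w e\<^sup>y B\<close> for \<open>(1 - w) x + w y = 0\<close>, applied to \<open>A, B\<close> and to their inverses,
  because these bounds make the Thompson distance to a fixed operator convex along \<open>A #\<^sub>w B\<close>. The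
  bound \<open>1 \<le> \<Sum>w i (f (\<lambda> T i + 1))\<inverse>\<close>, expanded at \<open>\<lambda> = 0\<close>, gives the converse direction.
\<close>

section \<open>Self-adjoint operators on a real Hilbert space\<close>

text \<open>The analysis lives in the real Hilbert space whose inner product is the real part of
  \<open>cinner\<close>: order, inverses, norm and functional calculus of a self-adjoint operator
  are the same there.

  The hypothesis on \<open>f\<close> concerns only spaces with elements in
  \<open>nat \<Rightarrow> 'h\<close> and does not include continuity, so at the outset
  \<open>f\<close> can be applied only to operators with finite spectrum. Continuity and the slope
  at 1 are therefore drawn from operators with at most two spectral points, where \<open>f\<close>
  acts as an interpolating polynomial.

  The bound y > t has to be strict: if the compression of the diagonal operator equals t while its
  off-diagonal block is nonzero, no finite \<mu> gives domination. Continuity at 1 closes the gap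
  afterwards.

  A kink at 1 is the real obstacle to the converse. With different slopes on the two sides, the
  first-order term of the harmonic bound would not be linear in the T i, and \<Sum>w i T i would not
  appear.

  Convexity of the Thompson distance is part of the induction because each level of ALM and BMP
  iterates means that are themselves limits; of these means it is all that the contraction estimate
  uses.\<close>

definition sadj :: "('a::real_inner \<Rightarrow>\<^sub>L 'a) \<Rightarrow> bool" where
  "sadj A \<longleftrightarrow> (\<forall>x y. inner (A x) y = inner x (A y))"

text \<open>A real quadratic form sees only the symmetric part of an operator. Hence this is a
  preorder on all operators and antisymmetric only on the \<open>sadj\<close> ones
  (\<open>qle_antisym\<close>).\<close>

definition qle :: "('a::real_inner \<Rightarrow>\<^sub>L 'a) \<Rightarrow> ('a \<Rightarrow>\<^sub>L 'a) \<Rightarrow> bool" where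
  "qle A B \<longleftrightarrow> (\<forall>x. inner x (A x) \<le> inner x (B x))"

definition inverts :: "('a::real_normed_vector \<Rightarrow>\<^sub>L 'a) \<Rightarrow> ('a \<Rightarrow>\<^sub>L 'a) \<Rightarrow> bool" where
  "inverts A B \<longleftrightarrow> A o\<^sub>L B = id_blinfun \<and> B o\<^sub>L A = id_blinfun"

definition rspec :: "('a::real_normed_vector \<Rightarrow>\<^sub>L 'a) \<Rightarrow> real set" where
  "rspec A = {t. \<not> (\<exists>B. inverts (A - t *\<^sub>R id_blinfun) B)}"

lemma invertsI:
  fixes A B :: "'a::real_normed_vector \<Rightarrow>\<^sub>L 'a"
  assumes "\<And>x. A (B x) = x" "\<And>x. B (A x) = x"
  shows "inverts A B"
  unfolding inverts_def by (auto intro!: blinfun_eqI simp: assms)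

lemma inverts_apply:
  fixes A B :: "'a::real_normed_vector \<Rightarrow>\<^sub>L 'a"
  assumes "inverts A B"
  shows "A (B x) = x" "B (A x) = x"
  using assms unfolding inverts_def
  by (metis blinfun_apply_blinfun_compose blinfun_apply_id_blinfun id_apply)+

lemma inverts_sym: "inverts A B \<Longrightarrow> inverts B A"
  unfolding inverts_def by auto

lemma inverts_unique:
  assumes "inverts A B" "inverts A C"
  shows "B = C"
  using inverts_apply[OF assms(1)] inverts_apply[OF assms(2)]
  by (intro blinfun_eqI) metis

lemma inverts_compose:
  assumes "inverts A B" "inverts C D"
  shows "inverts (A o\<^sub>L C) (D o\<^sub>L B)"
  by (rule invertsI) (simp_all add: inverts_apply[OF assms(1)] inverts_apply[OF assms(2)])

lemma sadjD: "sadj A \<Longrightarrow> inner (A x) y = inner x (A y)"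
  by (auto simp: sadj_def)

lemma sadj_add: "sadj A \<Longrightarrow> sadj B \<Longrightarrow> sadj (A + B)"
  by (simp add: sadj_def blinfun.bilinear_simps inner_simps)

lemma sadj_diff: "sadj A \<Longrightarrow> sadj B \<Longrightarrow> sadj (A - B)"
  by (simp add: sadj_def blinfun.bilinear_simps inner_simps)

lemma sadj_scaleR: "sadj A \<Longrightarrow> sadj (c *\<^sub>R A)"
  by (simp add: sadj_def blinfun.bilinear_simps)

lemma sadj_id: "sadj id_blinfun"
  by (simp add: sadj_def)

lemma sadj_0: "sadj 0"
  by (simp add: sadj_def)

lemma sadj_sum: "(\<And>i. i \<in> I \<Longrightarrow> sadj (A i)) \<Longrightarrow> sadj (sum A I)"
  by (induction I rule: infinite_finite_induct) (auto simp: sadj_0 sadj_add)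

lemma sadj_compose_commute: "sadj A \<Longrightarrow> sadj B \<Longrightarrow> A o\<^sub>L B = B o\<^sub>L A \<Longrightarrow> sadj (A o\<^sub>L B)"
  unfolding sadj_def by (metis blinfun_apply_blinfun_compose)

lemma sadj_conj: "sadj R \<Longrightarrow> sadj A \<Longrightarrow> sadj (R o\<^sub>L A o\<^sub>L R)"
  unfolding sadj_def by simp

lemma sadj_inverse:
  assumes "sadj A" "inverts A B"
  shows "sadj B"
  unfolding sadj_def using inverts_apply[OF assms(2)] sadjD[OF assms(1)] by metis

lemma sadj_limit:
  assumes "\<And>m. sadj (S m)" "S \<longlonglongrightarrow> X"
  shows "sadj X"
  unfolding sadj_def
proof (intro allI)
  fix x y
  have "(\<lambda>m. inner (S m x) y) \<longlonglongrightarrow> inner (X x) y" "(\<lambda>m. inner x (S m y)) \<longlonglongrightarrow> inner x (X y)"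
    using assms(2) by (auto intro!: tendsto_intros)
  then show "inner (X x) y = inner x (X y)"
    using assms(1) LIMSEQ_unique by (simp add: sadj_def)
qed

lemma qle_refl: "qle A A"
  by (simp add: qle_def)

lemma qle_trans: "qle A B \<Longrightarrow> qle B C \<Longrightarrow> qle A C"
  unfolding qle_def by (meson order_trans)

lemma qle_add: "qle A B \<Longrightarrow> qle C D \<Longrightarrow> qle (A + C) (B + D)"
  unfolding qle_def by (simp add: blinfun.bilinear_simps inner_simps add_mono)

lemma qle_scaleR: "0 \<le> c \<Longrightarrow> qle A B \<Longrightarrow> qle (c *\<^sub>R A) (c *\<^sub>R B)"
  unfolding qle_def by (simp add: blinfun.bilinear_simps mult_left_mono)

lemma qle_sum: "(\<And>i. i \<in> I \<Longrightarrow> qle (A i) (B i)) \<Longrightarrow> qle (sum A I) (sum B I)"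
  by (induction I rule: infinite_finite_induct) (auto simp: qle_refl qle_add)

lemma qle_conj: "sadj R \<Longrightarrow> qle A B \<Longrightarrow> qle (R o\<^sub>L A o\<^sub>L R) (R o\<^sub>L B o\<^sub>L R)"
  unfolding qle_def sadj_def by (metis blinfun_apply_blinfun_compose)

lemma qle_limit:
  assumes "\<And>m. qle (S m) (R m)" "S \<longlonglongrightarrow> X" "R \<longlonglongrightarrow> Y"
  shows "qle X Y"
  unfolding qle_def
proof
  fix x
  have "(\<lambda>m. inner x (S m x)) \<longlonglongrightarrow> inner x (X x)" "(\<lambda>m. inner x (R m x)) \<longlonglongrightarrow> inner x (Y x)"
    using assms(2,3) by (auto intro!: tendsto_intros)
  then show "inner x (X x) \<le> inner x (Y x)"
    using assms(1) by (intro LIMSEQ_le) (auto simp: qle_def)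
qed

section \<open>Norm, numerical range and invertibility\<close>

lemma qle_norm: "qle A (norm A *\<^sub>R id_blinfun)" "qle (- norm A *\<^sub>R id_blinfun) A"
proof -
  have "\<bar>inner x (A x)\<bar> \<le> norm A * inner x x" for x
  proof -
    have "\<bar>inner x (A x)\<bar> \<le> norm x * (norm A * norm x)"
      by (meson Cauchy_Schwarz_ineq2 mult_left_mono norm_blinfun norm_ge_zero order_trans)
    then show ?thesis by (simp add: power2_norm_eq_inner[symmetric] power2_eq_square algebra_simps)
  qed
  then show "qle A (norm A *\<^sub>R id_blinfun)" "qle (- norm A *\<^sub>R id_blinfun) A"
    unfolding qle_def by (auto simp: blinfun.bilinear_simps abs_le_iff minus_le_iff)
qed

lemma sadj_norm_le:
  assumes A: "sadj A" and c: "0 \<le> c" and le: "qle A (c *\<^sub>R id_blinfun)" "qle (- c *\<^sub>R id_blinfun) A"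
  shows "norm A \<le> c"
proof (rule norm_blinfun_bound[OF c])
  fix x
  show "norm (A x) \<le> c * norm x"
  proof (cases "A x = 0")
    case False
    have q: "\<bar>inner z (A z)\<bar> \<le> c * inner z z" for z
      using le[unfolded qle_def, rule_format, of z] by (simp add: blinfun.bilinear_simps abs_le_iff)
    \<comment> \<open>\<open>A x\<close> rescaled to the norm of \<open>x\<close>, so that
      polarization bounds \<open>norm x * norm (A x)\<close> by values of the quadratic
      form.\<close>
    define y where "y = (norm x / norm (A x)) *\<^sub>R A x"
    have ny: "inner y y = inner x x"
      using False by (simp add: y_def power2_norm_eq_inner[symmetric] power2_eq_square)
    have "4 * inner y (A x) = inner (x + y) (A (x + y)) - inner (x - y) (A (x - y))"
      using sadjD[OF A, of x y]
      by (simp add: blinfun.bilinear_simps inner_simps inner_commute)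
    also have "\<dots> \<le> c * inner (x + y) (x + y) + c * inner (x - y) (x - y)"
      using q[of "x + y"] q[of "x - y"] by linarith
    also have "\<dots> = 4 * c * inner x x"
      by (simp add: inner_simps ny algebra_simps)
    finally have "inner y (A x) \<le> c * inner x x" by simp
    moreover have "inner y (A x) = norm x * norm (A x)"
      using False by (simp add: y_def power2_norm_eq_inner[symmetric] power2_eq_square)
    ultimately have "norm x * norm (A x) \<le> norm x * (c * norm x)"
      by (simp add: power2_norm_eq_inner[symmetric] power2_eq_square algebra_simps)
    moreover have "norm x > 0" using False by auto
    ultimately show ?thesis by simp
  qed (use c in simp)
qed

lemma qle_antisym:
  assumes "sadj A" "sadj B" "qle A B" "qle B A"
  shows "A = B"
proof -
  have "norm (A - B) \<le> 0"
    using assms by (intro sadj_norm_le sadj_diff) (auto simp: qle_def blinfun.bilinear_simps inner_simps)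
  then show ?thesis by simp
qed

text \<open>A Lax-Milgram argument: for suitable \<open>k\<close> the map
  \<open>x - k *\<^sub>R (A x - y)\<close> is a contraction, and its fixed point solves
  \<open>A x = y\<close>.\<close>

lemma coercive_invertible:
  fixes A :: "'a::{real_inner, banach} \<Rightarrow>\<^sub>L 'a"
  assumes c: "0 < c" and co: "qle (c *\<^sub>R id_blinfun) A"
  shows "\<exists>B. inverts A B"
proof -
  have co': "c * inner x x \<le> inner x (A x)" for x
    using co by (simp add: qle_def blinfun.bilinear_simps)
  define N where "N = norm A + c"
  have N: "N > 0" "norm A \<le> N" "c \<le> N" using c by (auto simp: N_def add_nonneg_pos)
  \<comment> \<open>The minimizer of \<open>1 - 2 * k * c + k\<^sup>2 * N\<^sup>2\<close>, which
    bounds the squared contraction factor; the minimum is \<open>1 - (c/N)\<^sup>2\<close>.\<close>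
  define k where "k = c / N\<^sup>2"
  define q where "q = sqrt (1 - (c/N)\<^sup>2)"
  have k: "k > 0" using c N by (simp add: k_def)
  have cN: "0 < c/N" "c/N \<le> 1" using c N by auto
  then have cN2: "0 < (c/N)\<^sup>2" "(c/N)\<^sup>2 \<le> 1" by (auto simp: power_le_one)
  have q: "0 \<le> q" "q < 1" using cN2 by (auto simp: q_def)
  have contr: "norm (x - k *\<^sub>R A x) \<le> q * norm x" for x
  proof -
    have "(norm (A x))\<^sup>2 \<le> (N * norm x)\<^sup>2"
      using mult_right_mono[OF N(2) norm_ge_zero[of x]] norm_blinfun[of A x] by (intro power_mono) auto
    then have 1: "inner (A x) (A x) \<le> N\<^sup>2 * inner x x"
      by (simp add: power2_norm_eq_inner[symmetric] power_mult_distrib)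
    have "(norm (x - k *\<^sub>R A x))\<^sup>2 = inner x x - 2 * k * inner x (A x) + k\<^sup>2 * inner (A x) (A x)"
      unfolding power2_norm_eq_inner by (simp add: inner_simps inner_commute power2_eq_square algebra_simps)
    also have "\<dots> \<le> inner x x - 2 * k * (c * inner x x) + k\<^sup>2 * (N\<^sup>2 * inner x x)"
      using k co'[of x] 1 by (intro add_mono diff_mono mult_left_mono) auto
    also have "\<dots> = (1 - (c/N)\<^sup>2) * inner x x"
      using N by (simp add: k_def power2_eq_square field_simps)
    also have "\<dots> = (q * norm x)\<^sup>2"
      using cN2 by (simp add: q_def power_mult_distrib power2_norm_eq_inner)
    finally show ?thesis using q by (meson mult_nonneg_nonneg norm_ge_zero power2_le_imp_le)
  qed
  have ex: "\<exists>!x. A x = y" for y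
  proof -
    have "\<exists>!x. x - k *\<^sub>R (A x - y) = x"
    proof (rule banach_fix_type[OF q], intro allI)
      fix u v
      have "(u - k *\<^sub>R (A u - y)) - (v - k *\<^sub>R (A v - y)) = (u - v) - k *\<^sub>R A (u - v)"
        by (simp add: blinfun.bilinear_simps algebra_simps)
      then show "dist (u - k *\<^sub>R (A u - y)) (v - k *\<^sub>R (A v - y)) \<le> q * dist u v"
        using contr[of "u - v"] unfolding dist_norm by metis
    qed
    then show ?thesis using k by simp
  qed
  define B where "B y = (THE x. A x = y)" for y
  have AB: "A (B y) = y" for y unfolding B_def by (rule theI'[OF ex])
  have BA: "B (A x) = x" for x using ex[of "A x"] AB by blast
  have "bounded_linear B"
  proof (rule bounded_linear_intro[where K = "1/c"])
    show "B (x + y) = B x + B y" for x y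
      by (metis AB BA blinfun.add_right)
    show "B (r *\<^sub>R x) = r *\<^sub>R B x" for r x
      by (metis AB BA blinfun.scaleR_right)
    show "norm (B x) \<le> norm x * (1/c)" for x
    proof -
      have "c * (norm (B x))\<^sup>2 \<le> norm (B x) * norm x"
        using co'[of "B x"] norm_cauchy_schwarz[of "B x" x] by (simp add: AB power2_norm_eq_inner)
      then have "norm (B x) * (c * norm (B x)) \<le> norm (B x) * norm x"
        by (simp add: power2_eq_square algebra_simps)
      then have "c * norm (B x) \<le> norm x \<or> norm (B x) = 0"
        by (metis mult_le_cancel_left_pos norm_ge_zero order_le_less)
      then show ?thesis using c by (auto simp: field_simps)
    qed
  qed
  then have "inverts A (Blinfun B)"
    by (intro invertsI) (simp_all add: bounded_linear_Blinfun_apply AB BA)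
  then show ?thesis ..
qed

text \<open>Nonnegativity of the form at \<open>x - (1/s) *\<^sub>R A x\<close> gives this without a
  square root of \<open>A\<close>.\<close>

lemma psd_norm_apply_le:
  assumes A: "sadj A" and psd: "qle 0 A" and s: "norm A \<le> s" "0 < s"
  shows "(norm (A x))\<^sup>2 \<le> s * inner x (A x)"
proof -
  have ax: "inner (A x) (A (A x)) \<le> s * inner (A x) (A x)"
  proof -
    have "inner (A x) (A (A x)) \<le> norm A * inner (A x) (A x)"
      using qle_norm(1)[of A] by (simp add: qle_def blinfun.bilinear_simps)
    then show ?thesis using s(1) by (meson inner_ge_zero mult_right_mono order_trans)
  qed
  define y where "y = x - (1/s) *\<^sub>R A x"
  have "0 \<le> inner y (A y)" using psd by (simp add: qle_def)
  also have "inner y (A y) = inner x (A x) - 2 / s * inner (A x) (A x) + (1/s)\<^sup>2 * inner (A x) (A (A x))"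
    using sadjD[OF A, of x "A x"]
    unfolding y_def blinfun.bilinear_simps inner_simps
    by (simp add: inner_commute power2_eq_square algebra_simps add_divide_distrib diff_divide_distrib)
  also have "\<dots> \<le> inner x (A x) - 2 / s * inner (A x) (A x) + (1/s)\<^sup>2 * (s * inner (A x) (A x))"
    using ax by (intro add_mono mult_left_mono) auto
  also have "\<dots> = inner x (A x) - inner (A x) (A x) / s"
    using s by (simp add: power2_eq_square field_simps)
  finally show ?thesis using s by (simp add: power2_norm_eq_inner field_simps)
qed

text \<open>The inverse bounds \<open>A x\<close> from below, and \<open>psd_norm_apply_le\<close>
  passes the bound on to the quadratic form. Invertibility of a positive operator becomes an order
  statement.\<close>

lemma psd_invertible_coercive:
  assumes A: "sadj A" "qle 0 A" "inverts A B"
  obtains c where "0 < c" "qle (c *\<^sub>R id_blinfun) A"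
proof -
  define s b where "s = norm A + 1" and "b = norm B + 1"
  have sb: "s > 0" "b > 0" "norm A \<le> s" "norm B \<le> b" by (auto simp: s_def b_def add_nonneg_pos)
  have "1 / (b\<^sup>2 * s) * inner x x \<le> inner x (A x)" for x
  proof -
    have "norm x \<le> b * norm (A x)"
      using norm_blinfun[of B "A x"] inverts_apply[OF A(3), of x] sb
      by (metis mult_right_mono norm_ge_zero order_trans)
    then have "(norm x)\<^sup>2 \<le> b\<^sup>2 * (norm (A x))\<^sup>2"
      by (metis norm_ge_zero power_mono power_mult_distrib)
    also have "\<dots> \<le> b\<^sup>2 * (s * inner x (A x))"
      by (intro mult_left_mono psd_norm_apply_le A sb) auto
    finally show ?thesis using sb by (simp add: power2_norm_eq_inner field_simps)
  qed
  then have "qle ((1 / (b\<^sup>2 * s)) *\<^sub>R id_blinfun) A"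
    by (simp add: qle_def blinfun.bilinear_simps)
  moreover have "0 < 1 / (b\<^sup>2 * s)" using sb by simp
  ultimately show ?thesis using that by blast
qed

text \<open>Expand the form of \<open>A\<close> at \<open>A' x - B' x\<close> and replace
  \<open>A\<close> by \<open>B\<close> in the last term; no square roots are involved.\<close>

lemma qle_inverse:
  assumes "sadj A" "sadj B" "qle 0 A" "qle A B" "inverts A A'" "inverts B B'"
  shows "qle B' A'"
  unfolding qle_def
proof
  fix x
  note inv = inverts_apply[OF assms(5)] inverts_apply[OF assms(6)]
  have sB: "inner (B' y) z = inner y (B' z)" for y z
    using sadj_inverse[OF assms(2,6)] by (rule sadjD)
  define z where "z = A' x - B' x"
  have "0 \<le> inner z (A z)" using assms(3) by (simp add: qle_def)
  also have "inner z (A z) = inner x (A' x) - 2 * inner x (B' x) + inner (B' x) (A (B' x))"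
    using sadjD[OF assms(1), of "A' x" "B' x"]
    by (simp add: z_def blinfun.bilinear_simps inner_simps inv inner_commute)
  also have "\<dots> \<le> inner x (A' x) - 2 * inner x (B' x) + inner (B' x) (B (B' x))"
    using assms(4) by (simp add: qle_def)
  also have "\<dots> = inner x (A' x) - inner x (B' x)" by (simp add: inv inner_commute)
  finally show "inner x (B' x) \<le> inner x (A' x)" by simp
qed

subsection \<open>Polynomials in an operator\<close>

text \<open>The Horner scheme of \<open>poly_op\<close>, carried out in the algebra of bounded
  operators, so that \<open>poly_op_hs\<close> is an induction on the polynomial.\<close>

definition bpoly :: "real poly \<Rightarrow> ('a::real_normed_vector \<Rightarrow>\<^sub>L 'a) \<Rightarrow> 'a \<Rightarrow>\<^sub>L 'a" where
  "bpoly p A = fold_coeffs (\<lambda>a S. a *\<^sub>R id_blinfun + (A o\<^sub>L S)) p 0"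

lemma bpoly_0 [simp]: "bpoly 0 A = 0"
  by (simp add: bpoly_def)

lemma bpoly_pCons [simp]: "bpoly (pCons a p) A = a *\<^sub>R id_blinfun + (A o\<^sub>L bpoly p A)"
  by (cases "a = 0 \<and> p = 0") (auto simp: bpoly_def)

lemma bpoly_add: "bpoly (p + q) A = bpoly p A + bpoly q A"
  by (induction p q rule: poly_induct2) (auto intro!: blinfun_eqI simp: blinfun.bilinear_simps algebra_simps)

lemma bpoly_smult: "bpoly (smult c p) A = c *\<^sub>R bpoly p A"
  by (induction p) (auto intro!: blinfun_eqI simp: blinfun.bilinear_simps algebra_simps)

lemma bpoly_diff: "bpoly (p - q) A = bpoly p A - bpoly q A"
  using bpoly_add[of p "smult (-1) q" A] bpoly_smult[of "-1" q A] by simp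

lemma bpoly_mult: "bpoly (p * q) A = bpoly p A o\<^sub>L bpoly q A"
  by (induction p) (auto intro!: blinfun_eqI simp: blinfun.bilinear_simps bpoly_add bpoly_smult)

lemma bpoly_commute: "A o\<^sub>L bpoly p A = bpoly p A o\<^sub>L A"
proof -
  have "bpoly ([:0, 1:] * p) A = bpoly (p * [:0, 1:]) A" by (simp add: mult.commute)
  then have "(A o\<^sub>L bpoly p A) x = (bpoly p A o\<^sub>L A) x" for x
    unfolding bpoly_mult by (auto simp: blinfun.bilinear_simps dest!: arg_cong[where f = "\<lambda>X. blinfun_apply X x"])
  then show ?thesis by (intro blinfun_eqI)
qed

lemma sadj_bpoly: "sadj A \<Longrightarrow> sadj (bpoly p A)"
  by (induction p) (auto simp: sadj_0 intro!: sadj_add sadj_scaleR sadj_id sadj_compose_commute bpoly_commute)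

text \<open>The remainder \<open>a + b x\<close> modulo the real quadratic with roots
  \<open>z\<close> and \<open>cnj z\<close> vanishes at \<open>z\<close>; since \<open>a\<close> and
  \<open>b\<close> are real and \<open>z\<close> is not, both are 0.\<close>

lemma real_poly_complex_root_dvd:
  fixes p :: "real poly" and z :: complex
  assumes root: "poly (map_poly of_real p) z = 0" and nr: "Im z \<noteq> 0"
  shows "[:(Re z)\<^sup>2 + (Im z)\<^sup>2, - 2 * Re z, 1:] dvd p"
proof -
  define ev where "ev r = poly (map_poly complex_of_real r) z" for r
  have ev0: "ev 0 = 0" by (simp add: ev_def)
  have ev_pCons: "ev (pCons a r) = of_real a + z * ev r" for a r
    by (simp add: ev_def map_poly_pCons)
  have ev_add: "ev (r + s) = ev r + ev s" for r s
    by (induction r s rule: poly_induct2) (auto simp: ev0 ev_pCons algebra_simps)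
  have ev_smult: "ev (smult c r) = of_real c * ev r" for c r
    by (induction r) (auto simp: ev0 ev_pCons algebra_simps)
  have ev_mult: "ev (r * s) = ev r * ev s" for r s
    by (induction r) (auto simp: ev0 ev_pCons ev_add ev_smult algebra_simps)
  define d where "d = [:(Re z)\<^sup>2 + (Im z)\<^sup>2, - 2 * Re z, 1:]"
  have "ev d = 0"
    by (simp add: d_def ev0 ev_pCons complex_eq_iff power2_eq_square algebra_simps)
  moreover have "p = p div d * d + p mod d" by simp
  ultimately have evr: "ev (p mod d) = 0"
    using root ev_add[of "p div d * d" "p mod d"] ev_mult[of "p div d" d]
    by (simp add: ev_def)
  have "p mod d = 0 \<or> degree (p mod d) < 2"
    using degree_mod_less[of d p] by (simp add: d_def numeral_2_eq_2)
  then have "degree (p mod d) \<le> 1" by auto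
  then obtain a b where r: "p mod d = [:a, b:]"
  proof -
    obtain a r' where ar: "p mod d = pCons a r'" by (cases "p mod d") auto
    moreover obtain b where "r' = [:b:]"
      using \<open>degree (p mod d) \<le> 1\<close> ar degree_eq_zeroE[of r'] by (cases "r' = 0") auto
    ultimately show ?thesis using that by blast
  qed
  have "a = 0 \<and> b = 0" using evr nr by (auto simp: r ev0 ev_pCons complex_eq_iff)
  then show ?thesis using r unfolding d_def[symmetric] by (simp add: mod_eq_0_iff_dvd)
qed

text \<open>One inclusion of the spectral mapping theorem. Factors invertible at \<open>A\<close>
  are split off by induction on the degree: linear ones for real roots outside
  \<open>rspec A\<close>, and quadratic ones for non-real roots, which are a square plus
  \<open>(Im z)\<^sup>2\<close> at \<open>A\<close> and hence coercive. A real root in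
  \<open>rspec A\<close> ends the induction.\<close>

lemma bpoly_singular_root:
  fixes A :: "'a::{real_inner, banach} \<Rightarrow>\<^sub>L 'a"
  assumes A: "sadj A" and p: "p \<noteq> 0" and ni: "\<not> (\<exists>B. inverts (bpoly p A) B)"
  shows "\<exists>t\<in>rspec A. poly p t = 0"
  using p ni
proof (induction "degree p" arbitrary: p rule: less_induct)
  case less
  have step: ?case if pq: "p = d * q" and dd: "degree d > 0" and inv: "\<exists>B. inverts (bpoly d A) B" for d q
  proof -
    have q: "q \<noteq> 0" "d \<noteq> 0" using pq less.prems by auto
    then have "degree q < degree p" using pq dd by (simp add: degree_mult_eq)
    moreover have "\<not> (\<exists>B. inverts (bpoly q A) B)"
      using less.prems(2) inv by (auto simp: pq bpoly_mult intro: inverts_compose)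
    ultimately show ?thesis using less.hyps q pq by fastforce
  qed
  show ?case
  proof (cases "degree p = 0")
    case True
    then obtain c where c: "p = [:c:]" by (meson degree_0_id degree_eq_zeroE)
    have "inverts (bpoly p A) ((1/c) *\<^sub>R id_blinfun)"
      using c less.prems(1) by (intro invertsI) (auto simp: blinfun.bilinear_simps)
    then show ?thesis using less.prems by blast
  next
    case False
    have "degree (map_poly complex_of_real p) = degree p" by (intro degree_map_poly) auto
    then have "\<not> constant (poly (map_poly complex_of_real p))"
      using False by (simp add: constant_degree)
    then obtain z where z: "poly (map_poly complex_of_real p) z = 0"
      using fundamental_theorem_of_algebra by blast
    show ?thesis
    proof (cases "Im z = 0")
      case True
      then have zr: "z = of_real (Re z)" by (simp add: complex_eq_iff)
      have "of_real (poly p (Re z)) = poly (map_poly complex_of_real p) (of_real (Re z))"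
        by (induction p) (auto simp: map_poly_pCons)
      then have pz: "poly p (Re z) = 0" using z zr by simp
      show ?thesis
      proof (cases "Re z \<in> rspec A")
        case False
        have "bpoly [:- Re z, 1:] A = A - Re z *\<^sub>R id_blinfun"
          by (auto intro!: blinfun_eqI simp: blinfun.bilinear_simps)
        then have "\<exists>B. inverts (bpoly [:- Re z, 1:] A) B" using False by (simp add: rspec_def)
        moreover obtain q where "p = [:- Re z, 1:] * q" using pz by (metis poly_eq_0_iff_dvd dvdE)
        ultimately show ?thesis using step[of "[:- Re z, 1:]" q] by (simp del: bpoly_pCons)
      qed (use pz in auto)
    next
      case False
      define d where "d = [:(Re z)\<^sup>2 + (Im z)\<^sup>2, - 2 * Re z, 1:]"
      have "inner x (bpoly d A x) = (Im z)\<^sup>2 * inner x x + (norm (A x - Re z *\<^sub>R x))\<^sup>2" for x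
        using sadjD[OF A, of x "A x"] sadjD[OF A, of x x]
        unfolding power2_norm_eq_inner
        by (simp add: d_def blinfun.bilinear_simps inner_simps inner_commute power2_eq_square algebra_simps)
      then have "qle ((Im z)\<^sup>2 *\<^sub>R id_blinfun) (bpoly d A)"
        by (simp add: qle_def blinfun.bilinear_simps)
      then have "\<exists>B. inverts (bpoly d A) B"
        using False coercive_invertible[of "(Im z)\<^sup>2"] by simp
      moreover obtain q where "p = d * q"
        using real_poly_complex_root_dvd[OF z False] unfolding d_def by (elim dvdE)
      ultimately show ?thesis using step[of d q] by (simp add: d_def del: bpoly_pCons)
    qed
  qed
qed

text \<open>Take the infimum of the numerical range. If \<open>A - m\<close> were invertible, it
  would be coercive by \<open>psd_invertible_coercive\<close>, and the infimum would exceed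
  \<open>m\<close>.\<close>

lemma numeric_inf_singular:
  fixes A :: "'a::{real_inner, banach} \<Rightarrow>\<^sub>L 'a"
  assumes A: "sadj A" and nz: "\<exists>x::'a. x \<noteq> 0"
  obtains m where "qle (m *\<^sub>R id_blinfun) A" "\<not> (\<exists>B. inverts (A - m *\<^sub>R id_blinfun) B)"
proof -
  define S where "S = (\<lambda>x. inner x (A x)) ` {x. inner x x = 1}"
  define m where "m = Inf S"
  obtain x0 :: 'a where "x0 \<noteq> 0" using nz by blast
  then have "inner (x0 /\<^sub>R norm x0) (x0 /\<^sub>R norm x0) = 1"
    by (simp add: power2_norm_eq_inner[symmetric] power2_eq_square)
  then have ne: "S \<noteq> {}" unfolding S_def by blast
  have bdd: "bdd_below S"
    using qle_norm(2)[of A]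
    by (auto simp: S_def qle_def blinfun.bilinear_simps intro!: bdd_belowI[of _ "- norm A"])
      (metis mult.right_neutral)
  have scale: "k * inner x x \<le> inner x (A x)" if "\<And>y. inner y y = 1 \<Longrightarrow> k \<le> inner y (A y)" for k x
  proof (cases "x = 0")
    case False
    have "k \<le> inner (x /\<^sub>R norm x) (A (x /\<^sub>R norm x))"
      using False by (intro that) (simp add: power2_norm_eq_inner[symmetric] power2_eq_square)
    then show ?thesis using False
      by (simp add: blinfun.bilinear_simps power2_norm_eq_inner[symmetric] power2_eq_square field_simps)
  qed simp
  have "m \<le> inner y (A y)" if "inner y y = 1" for y
    unfolding m_def using that bdd by (intro cInf_lower) (auto simp: S_def)
  then have mle: "qle (m *\<^sub>R id_blinfun) A"
    using scale by (simp add: qle_def blinfun.bilinear_simps)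
  moreover have "\<not> (\<exists>B. inverts (A - m *\<^sub>R id_blinfun) B)"
  proof
    assume "\<exists>B. inverts (A - m *\<^sub>R id_blinfun) B"
    then obtain B where "inverts (A - m *\<^sub>R id_blinfun) B" ..
    moreover have "sadj (A - m *\<^sub>R id_blinfun)" by (intro sadj_diff A sadj_scaleR sadj_id)
    moreover have "qle 0 (A - m *\<^sub>R id_blinfun)"
      using mle by (simp add: qle_def blinfun.bilinear_simps inner_simps)
    ultimately obtain c where c: "0 < c" "qle (c *\<^sub>R id_blinfun) (A - m *\<^sub>R id_blinfun)"
      using psd_invertible_coercive by metis
    have "m + c \<le> s" if "s \<in> S" for s
    proof -
      obtain x where x: "inner x x = 1" "s = inner x (A x)" using \<open>s \<in> S\<close> by (auto simp: S_def)
      have "inner x ((c *\<^sub>R id_blinfun) x) \<le> inner x ((A - m *\<^sub>R id_blinfun) x)"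
        using c(2) unfolding qle_def by blast
      then show ?thesis using x by (simp add: blinfun.bilinear_simps inner_simps)
    qed
    then have "m + c \<le> m" unfolding m_def using ne by (intro cInf_greatest) auto
    then show False using c by simp
  qed
  ultimately show ?thesis using that by blast
qed

lemma rspec_nonempty:
  fixes A :: "'a::{real_inner, banach} \<Rightarrow>\<^sub>L 'a"
  assumes "sadj A" "\<exists>x::'a. x \<noteq> 0"
  shows "rspec A \<noteq> {}"
  using numeric_inf_singular[OF assms] unfolding rspec_def by blast

text \<open>The infimum \<open>m\<close> of the numerical range of \<open>bpoly p A\<close> makes
  \<open>p - m\<close> singular at \<open>A\<close>, so \<open>m\<close> is a value of
  \<open>p\<close> on the spectrum.\<close>

lemma bpoly_nonneg:
  fixes A :: "'a::{real_inner, banach} \<Rightarrow>\<^sub>L 'a"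
  assumes A: "sadj A" and p: "\<And>t. t \<in> rspec A \<Longrightarrow> 0 \<le> poly p t"
  shows "qle 0 (bpoly p A)"
proof (cases "\<exists>x::'a. x \<noteq> 0")
  case True
  obtain m where m: "qle (m *\<^sub>R id_blinfun) (bpoly p A)"
    "\<not> (\<exists>B. inverts (bpoly p A - m *\<^sub>R id_blinfun) B)"
    using numeric_inf_singular[OF sadj_bpoly[OF A] True] by blast
  have eq: "bpoly (p - [:m:]) A = bpoly p A - m *\<^sub>R id_blinfun" by (simp add: bpoly_diff)
  have "\<exists>t\<in>rspec A. poly p t = m"
  proof (cases "p - [:m:] = 0")
    case True
    then have "p = [:m:]" by simp
    then show ?thesis using rspec_nonempty[OF A \<open>\<exists>x. x \<noteq> 0\<close>] by auto
  next
    case False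
    then show ?thesis using bpoly_singular_root[OF A False] m(2) eq by auto
  qed
  then have "0 \<le> m" using p by auto
  then have "qle 0 (m *\<^sub>R (id_blinfun :: 'a \<Rightarrow>\<^sub>L 'a))" by (simp add: qle_def blinfun.bilinear_simps)
  then show ?thesis using m(1) qle_trans by blast
next
  case False
  then have "x = 0" for x :: 'a by blast
  then show ?thesis unfolding qle_def by (metis inner_zero_left order_refl)
qed

lemma bpoly_mono:
  fixes A :: "'a::{real_inner, banach} \<Rightarrow>\<^sub>L 'a"
  assumes "sadj A" "\<And>t. t \<in> rspec A \<Longrightarrow> poly p t \<le> poly q t"
  shows "qle (bpoly p A) (bpoly q A)"
  using bpoly_nonneg[OF assms(1), of "q - p"] assms(2)
  by (auto simp: bpoly_diff qle_def blinfun.bilinear_simps inner_simps)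

text \<open>By this bound uniform convergence on the spectrum forces norm convergence of the
  operators, which extends the calculus to continuous functions.\<close>

lemma norm_bpoly_le:
  fixes A :: "'a::{real_inner, banach} \<Rightarrow>\<^sub>L 'a"
  assumes A: "sadj A" and e: "0 \<le> e" and p: "\<And>t. t \<in> rspec A \<Longrightarrow> \<bar>poly p t\<bar> \<le> e"
  shows "norm (bpoly p A) \<le> e"
proof (rule sadj_norm_le[OF sadj_bpoly[OF A] e])
  show "qle (bpoly p A) (e *\<^sub>R id_blinfun)"
    using bpoly_mono[OF A, of p "[:e:]"] p by (force simp: abs_le_iff)
  show "qle (- e *\<^sub>R id_blinfun) (bpoly p A)"
    using bpoly_mono[OF A, of "[:- e:]" p] p by (force simp: abs_le_iff)
qed

lemma rspec_bounds:
  fixes A :: "'a::{real_inner, banach} \<Rightarrow>\<^sub>L 'a"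
  assumes A: "sadj A" and le: "qle (a *\<^sub>R id_blinfun) A" "qle A (b *\<^sub>R id_blinfun)"
  shows "rspec A \<subseteq> {a..b}"
proof
  fix t assume t: "t \<in> rspec A"
  have "a \<le> t"
  proof (rule ccontr)
    assume "\<not> a \<le> t"
    moreover have "qle ((a - t) *\<^sub>R id_blinfun) (A - t *\<^sub>R id_blinfun)"
      using le(1) by (simp add: qle_def blinfun.bilinear_simps inner_simps algebra_simps)
    ultimately show False
      using coercive_invertible[of "a - t" "A - t *\<^sub>R id_blinfun"] t by (auto simp: rspec_def)
  qed
  moreover have "t \<le> b"
  proof (rule ccontr)
    assume "\<not> t \<le> b"
    moreover have "qle ((t - b) *\<^sub>R id_blinfun) (t *\<^sub>R id_blinfun - A)"
      using le(2) by (simp add: qle_def blinfun.bilinear_simps inner_simps algebra_simps)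
    ultimately obtain B where B: "inverts (t *\<^sub>R id_blinfun - A) B"
      using coercive_invertible[of "t - b" "t *\<^sub>R id_blinfun - A"] by auto
    have "inverts (A - t *\<^sub>R id_blinfun) (- B)"
      using inverts_apply[OF B]
      by (intro invertsI) (auto simp: blinfun.bilinear_simps algebra_simps)
    then show False using t by (auto simp: rspec_def)
  qed
  ultimately show "t \<in> {a..b}" by simp
qed

subsection \<open>Continuous functional calculus\<close>

text \<open>\<open>is_fcalc\<close> in terms of the real spectrum and norm convergence;
  \<open>is_fcalc_hs\<close> identifies the two.\<close>

definition fc :: "(real \<Rightarrow> real) \<Rightarrow> ('a::real_normed_vector \<Rightarrow>\<^sub>L 'a) \<Rightarrow> ('a \<Rightarrow>\<^sub>L 'a) \<Rightarrow> bool" where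
  "fc f A X \<longleftrightarrow> (\<exists>p :: nat \<Rightarrow> real poly.
     uniform_limit (rspec A) (\<lambda>m. poly (p m)) f sequentially \<and> (\<lambda>m. bpoly (p m) A) \<longlonglongrightarrow> X)"

lemma fc_poly: "fc (poly p) A (bpoly p A)"
  unfolding fc_def by (intro exI[of _ "\<lambda>_. p"]) (auto simp: uniform_limit_iff)

lemma fc_cong: "fc f A X \<Longrightarrow> (\<And>t. t \<in> rspec A \<Longrightarrow> f t = g t) \<Longrightarrow> fc g A X"
  unfolding fc_def using uniform_limit_cong'[OF refl, of "rspec A" f g] by blast

lemma fc_polyI: "(\<And>t. t \<in> rspec A \<Longrightarrow> f t = poly p t) \<Longrightarrow> bpoly p A = X \<Longrightarrow> fc f A X"
  using fc_cong[OF fc_poly] by metis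

lemma fc_sadj: "sadj A \<Longrightarrow> fc f A X \<Longrightarrow> sadj X"
  unfolding fc_def by (auto intro: sadj_limit sadj_bpoly)

text \<open>Once both approximations are within \<open>e\<close> on the spectrum, adding the
  constant \<open>2 * e\<close> to the larger side restores the order between the polynomials.
  Uniqueness of f(A) is the case of equal functions.\<close>

lemma fc_mono:
  fixes A :: "'a::{real_inner, banach} \<Rightarrow>\<^sub>L 'a"
  assumes A: "sadj A" and f: "fc f A X" and g: "fc g A Y" and le: "\<And>t. t \<in> rspec A \<Longrightarrow> f t \<le> g t"
  shows "qle X Y"
proof -
  obtain p q where p: "uniform_limit (rspec A) (\<lambda>m. poly (p m)) f sequentially" "(\<lambda>m. bpoly (p m) A) \<longlonglongrightarrow> X"
    and q: "uniform_limit (rspec A) (\<lambda>m. poly (q m)) g sequentially" "(\<lambda>m. bpoly (q m) A) \<longlonglongrightarrow> Y"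
    using f g unfolding fc_def by blast
  have *: "inner x (X x) \<le> inner x (Y x) + 2 * e * inner x x" if e: "e > 0" for x e
  proof (rule tendsto_le[OF trivial_limit_sequentially])
    show "(\<lambda>m. inner x (bpoly (p m) A x)) \<longlonglongrightarrow> inner x (X x)"
      using p(2) by (intro tendsto_intros)
    show "(\<lambda>m. inner x (bpoly (q m) A x) + 2 * e * inner x x) \<longlonglongrightarrow> inner x (Y x) + 2 * e * inner x x"
      using q(2) by (intro tendsto_intros)
    show "\<forall>\<^sub>F m in sequentially. inner x (bpoly (p m) A x) \<le> inner x (bpoly (q m) A x) + 2 * e * inner x x"
      using uniform_limitD[OF p(1) e] uniform_limitD[OF q(1) e]
    proof eventually_elim
      case (elim m)
      have "poly (p m) t \<le> poly (q m + [:2 * e:]) t" if "t \<in> rspec A" for t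
        using elim(1)[rule_format, OF that] elim(2)[rule_format, OF that] le[OF that]
        by (simp add: dist_real_def)
      then have "qle (bpoly (p m) A) (bpoly (q m + [:2 * e:]) A)" by (intro bpoly_mono A)
      then show ?case by (simp add: bpoly_add qle_def blinfun.bilinear_simps inner_simps)
    qed
  qed
  have "inner x (X x) \<le> inner x (Y x)" for x
  proof (rule field_le_epsilon)
    fix e :: real assume e: "e > 0"
    define d where "d = e / (2 * (inner x x + 1))"
    have pos: "inner x x + 1 > 0" by (simp add: add_nonneg_pos)
    then have "d > 0" using e by (simp add: d_def)
    moreover have "2 * d * inner x x \<le> e"
      using pos e by (simp add: d_def field_simps)
    ultimately show "inner x (X x) \<le> inner x (Y x) + e" using *[of d x] by linarith
  qed
  then show ?thesis by (simp add: qle_def)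
qed

lemma fc_unique:
  fixes A :: "'a::{real_inner, banach} \<Rightarrow>\<^sub>L 'a"
  assumes "sadj A" "fc f A X" "fc f A Y"
  shows "X = Y"
  using assms by (intro qle_antisym) (auto intro: fc_sadj fc_mono)

lemma Weierstrass_poly:
  fixes f :: "real \<Rightarrow> real"
  assumes "continuous_on {a..b} f"
  obtains p :: "nat \<Rightarrow> real poly" where "uniform_limit {a..b} (\<lambda>m. poly (p m)) f sequentially"
proof -
  have "\<exists>p. \<forall>t\<in>{a..b}. \<bar>f t - poly p t\<bar> < 1 / real (Suc m)" for m
  proof -
    obtain g where g: "real_polynomial_function g" "\<And>t. t \<in> {a..b} \<Longrightarrow> \<bar>f t - g t\<bar> < 1 / real (Suc m)"
      using Stone_Weierstrass_real_polynomial_function[OF compact_Icc assms, of "1 / real (Suc m)"] by auto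
    obtain c n where "g = (\<lambda>x. \<Sum>i\<le>n. c i * x ^ i)"
      using g(1) unfolding real_polynomial_function_iff_sum by blast
    then have "g = poly (\<Sum>i\<le>n. monom (c i) i)" by (simp add: fun_eq_iff poly_sum poly_monom)
    then show ?thesis using g(2) by metis
  qed
  then obtain p where p: "\<And>m t. t \<in> {a..b} \<Longrightarrow> \<bar>f t - poly (p m) t\<bar> < 1 / real (Suc m)" by metis
  have "uniform_limit {a..b} (\<lambda>m. poly (p m)) f sequentially"
  proof (rule uniform_limitI)
    fix e :: real assume "e > 0"
    then obtain N where N: "1 / real (Suc N) < e" using nat_approx_posE by blast
    show "\<forall>\<^sub>F m in sequentially. \<forall>t\<in>{a..b}. dist (poly (p m) t) (f t) < e"
      using eventually_ge_at_top[of N]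
    proof eventually_elim
      case (elim m)
      then have "1 / real (Suc m) \<le> 1 / real (Suc N)" by (simp add: field_simps)
      then show ?case using p[of _ m] N by (fastforce simp: dist_real_def abs_minus_commute)
    qed
  qed
  then show ?thesis using that by blast
qed

lemma bpoly_convergent:
  fixes A :: "'a::{real_inner, banach} \<Rightarrow>\<^sub>L 'a"
  assumes A: "sadj A" and ul: "uniform_limit (rspec A) (\<lambda>m. poly (p m)) f sequentially"
  obtains X where "(\<lambda>m. bpoly (p m) A) \<longlonglongrightarrow> X" "fc f A X"
proof -
  have "Cauchy (\<lambda>m. bpoly (p m) A)"
    unfolding Cauchy_def
  proof (intro allI impI)
    fix e :: real assume e: "e > 0"
    then obtain N where N: "\<And>m t. m \<ge> N \<Longrightarrow> t \<in> rspec A \<Longrightarrow> \<bar>poly (p m) t - f t\<bar> < e / 4"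
      using uniform_limitD[OF ul, of "e/4"] by (auto simp: eventually_sequentially dist_real_def)
    have "dist (bpoly (p i) A) (bpoly (p j) A) < e" if "i \<ge> N" "j \<ge> N" for i j
    proof -
      have "norm (bpoly (p i - p j) A) \<le> e / 2"
      proof (intro norm_bpoly_le A)
        show "\<bar>poly (p i - p j) t\<bar> \<le> e / 2" if t: "t \<in> rspec A" for t
          using N[OF \<open>i \<ge> N\<close> t] N[OF \<open>j \<ge> N\<close> t] unfolding poly_diff by linarith
      qed (use e in simp)
      then show ?thesis using e by (simp add: dist_norm bpoly_diff)
    qed
    then show "\<exists>N. \<forall>i\<ge>N. \<forall>j\<ge>N. dist (bpoly (p i) A) (bpoly (p j) A) < e" by blast
  qed
  then show ?thesis using that ul Cauchy_convergent_iff convergent_def unfolding fc_def by metis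
qed

lemma fc_exists:
  fixes A :: "'a::{real_inner, banach} \<Rightarrow>\<^sub>L 'a"
  assumes "sadj A" "rspec A \<subseteq> {a..b}" "continuous_on {a..b} f"
  shows "\<exists>X. fc f A X"
  using Weierstrass_poly[OF assms(3)] bpoly_convergent[OF assms(1)] uniform_limit_on_subset[OF _ assms(2)]
  by metis

lemma fc_mult:
  assumes f: "fc f A X" "bounded (f ` rspec A)" and g: "fc g A Y" "bounded (g ` rspec A)"
  shows "fc (\<lambda>t. f t * g t) A (X o\<^sub>L Y)"
proof -
  obtain p q where p: "uniform_limit (rspec A) (\<lambda>m. poly (p m)) f sequentially" "(\<lambda>m. bpoly (p m) A) \<longlonglongrightarrow> X"
    and q: "uniform_limit (rspec A) (\<lambda>m. poly (q m)) g sequentially" "(\<lambda>m. bpoly (q m) A) \<longlonglongrightarrow> Y"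
    using f g unfolding fc_def by blast
  have "uniform_limit (rspec A) (\<lambda>m t. poly (p m) t * poly (q m) t) (\<lambda>t. f t * g t) sequentially"
    by (rule uniform_lim_mult[OF p(1) q(1) f(2) g(2)])
  moreover have "(\<lambda>m. (bpoly (p m) A o\<^sub>L bpoly (q m) A)) \<longlonglongrightarrow> (X o\<^sub>L Y)"
    by (rule bounded_bilinear.tendsto[OF bounded_bilinear_blinfun_compose p(2) q(2)])
  ultimately show ?thesis unfolding fc_def
    by (intro exI[of _ "\<lambda>m. p m * q m"]) (simp add: bpoly_mult poly_mult[abs_def])
qed

section \<open>The operator algebra of a complex Hilbert space\<close>

lemma Im_cinner: "Im (cinner x y) = - inner x (\<i> *\<^sub>C y)"
  by (simp add: Re_cinner[symmetric] cinner_scaleC_right)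

lemma norm_scaleC: "norm (a *\<^sub>C x) = cmod a * norm (x :: 'h::complex_hilbert)"
proof -
  have "cinner (a *\<^sub>C x) (a *\<^sub>C x) = a * cnj (cinner x (a *\<^sub>C x))"
    by (subst cinner_scaleC_right, subst cinner_commute) (rule refl)
  also have "\<dots> = of_real ((cmod a)\<^sup>2) * cnj (cinner x x)"
    by (simp add: cinner_scaleC_right complex_norm_square del: of_real_power)
  finally have "inner (a *\<^sub>C x) (a *\<^sub>C x) = (cmod a)\<^sup>2 * inner x x"
    by (simp add: Re_cinner[symmetric])
  then have "(norm (a *\<^sub>C x))\<^sup>2 = (cmod a * norm x)\<^sup>2"
    by (simp add: power2_norm_eq_inner power_mult_distrib)
  then show ?thesis by simp
qed

lemma bounded_linear_scaleC: "bounded_linear (\<lambda>x. a *\<^sub>C (x :: 'h::complex_hilbert))"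
proof (rule bounded_linear_intro[where K = "cmod a"])
  show "a *\<^sub>C (r *\<^sub>R x) = r *\<^sub>R (a *\<^sub>C x)" for r and x :: 'h
    by (simp add: scaleC_of_real[symmetric] scaleC_scaleC mult.commute)
qed (simp_all add: scaleC_add_right norm_scaleC mult.commute)

lemmas scaleC_simps =
  linear_diff[OF bounded_linear.linear[OF bounded_linear_scaleC]]
  linear_0[OF bounded_linear.linear[OF bounded_linear_scaleC]]
  linear_neg[OF bounded_linear.linear[OF bounded_linear_scaleC]]
  linear_scale[OF bounded_linear.linear[OF bounded_linear_scaleC]]

lemma scaleC_minus_left: "(- a) *\<^sub>C x = - (a *\<^sub>C (x :: 'h::complex_hilbert))"
  using scaleC_scaleC[of "-1" a x] scaleC_of_real[of "-1" "a *\<^sub>C x"] by simp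

lemma BH_iff: "A \<in> BH \<longleftrightarrow> (\<forall>a x. A (a *\<^sub>C x) = a *\<^sub>C A x)"
  by (auto simp: BH_def bounded_ops_def blinfun.bilinear_simps intro: norm_blinfun)

lemma bounded_ops_blinfun:
  fixes R :: "'h::complex_hilbert \<Rightarrow> 'h"
  assumes "R \<in> bounded_ops hs"
  obtains B where "B \<in> BH" "blinfun_apply B = R"
proof -
  obtain C where "\<And>x. norm (R x) \<le> C * norm x"
    using assms by (auto simp: bounded_ops_def)
  moreover have "R (r *\<^sub>R x) = r *\<^sub>R R x" for r x
    using assms by (simp add: bounded_ops_def scaleC_of_real[symmetric])
  ultimately have "bounded_linear R"
    using assms by (intro bounded_linear_intro[where K = C]) (auto simp: bounded_ops_def mult.commute)
  then have "blinfun_apply (Blinfun R) = R" by (rule bounded_linear_Blinfun_apply)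
  then show ?thesis using assms that[of "Blinfun R"] by (simp add: BH_def)
qed

text \<open>Up to sign, the imaginary part of \<open>cinner\<close> is the real inner product with
  \<open>\<i> *\<^sub>C y\<close>. Hence symmetry in the real sense is full self-adjointness for
  complex-linear operators.\<close>

lemma BH_sa_iff: "A \<in> BH_sa \<longleftrightarrow> A \<in> BH \<and> sadj A"
proof
  assume "A \<in> BH_sa"
  then have "A \<in> BH" and c: "\<And>x y. cinner (A x) y = cinner x (A y)"
    by (auto simp: BH_sa_def BH_def selfadjoint_ops_def)
  then show "A \<in> BH \<and> sadj A"
    by (simp add: sadj_def Re_cinner[symmetric])
next
  assume A: "A \<in> BH \<and> sadj A"
  have "cinner (A x) y = cinner x (A y)" for x y
  proof (rule complex_eqI)
    show "Re (cinner (A x) y) = Re (cinner x (A y))"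
      using A by (simp add: Re_cinner sadjD)
    have "inner (A x) (\<i> *\<^sub>C y) = inner x (A (\<i> *\<^sub>C y))" using A sadjD by blast
    then show "Im (cinner (A x) y) = Im (cinner x (A y))"
      using A by (simp add: Im_cinner BH_iff)
  qed
  then show "A \<in> BH_sa" using A by (auto simp: BH_sa_def BH_def selfadjoint_ops_def)
qed

lemma ole_iff:
  assumes "A \<in> BH_sa" "B \<in> BH_sa"
  shows "A \<preceq> B \<longleftrightarrow> qle A B"
proof -
  have c: "cinner (A x) x = cinner x (A x)" "cinner (B x) x = cinner x (B x)" for x
    using assms by (auto simp: BH_sa_def selfadjoint_ops_def)
  have diff: "cinner x (B x - A x) = cinner x (B x) - cinner x (A x)" for x
    using cinner_add_right[of x "B x - A x" "A x"] by simp
  have "Im (cinner x (A x)) = 0" "Im (cinner x (B x)) = 0" for x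
    using c cinner_commute[of x "A x"] cinner_commute[of x "B x"] by (simp_all add: complex_eq_iff)
  then show ?thesis
    by (simp add: ole_def op_le_def qle_def complex_nonneg_Reals_iff diff Re_cinner)
qed

lemma BH_0: "0 \<in> BH" and BH_id: "id_blinfun \<in> BH"
  by (simp_all add: BH_iff scaleC_simps)

lemma BH_add: "A \<in> BH \<Longrightarrow> B \<in> BH \<Longrightarrow> A + B \<in> BH"
  by (simp add: BH_iff blinfun.bilinear_simps scaleC_add_right)

lemma BH_diff: "A \<in> BH \<Longrightarrow> B \<in> BH \<Longrightarrow> A - B \<in> BH"
  by (simp add: BH_iff blinfun.bilinear_simps scaleC_simps)

lemma BH_scaleR: "A \<in> BH \<Longrightarrow> c *\<^sub>R A \<in> BH"
  by (simp add: BH_iff blinfun.bilinear_simps scaleC_simps)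

lemma BH_compose: "A \<in> BH \<Longrightarrow> B \<in> BH \<Longrightarrow> A o\<^sub>L B \<in> BH"
  by (simp add: BH_iff)

lemma BH_sum: "(\<And>i. i \<in> I \<Longrightarrow> A i \<in> BH) \<Longrightarrow> sum A I \<in> BH"
  by (induction I rule: infinite_finite_induct) (auto simp: BH_0 BH_add)

lemma BH_bpoly: "A \<in> BH \<Longrightarrow> bpoly p A \<in> BH"
  by (induction p) (auto simp: BH_0 BH_id intro!: BH_add BH_scaleR BH_compose)

lemma BH_limit:
  assumes "\<And>m. S m \<in> BH" "S \<longlonglongrightarrow> X"
  shows "X \<in> BH"
  unfolding BH_iff
proof (intro allI)
  fix a x
  have "(\<lambda>m. S m (a *\<^sub>C x)) \<longlonglongrightarrow> X (a *\<^sub>C x)" "(\<lambda>m. a *\<^sub>C S m x) \<longlonglongrightarrow> a *\<^sub>C X x"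
    using assms(2) by (auto intro!: tendsto_intros bounded_linear.tendsto[OF bounded_linear_scaleC])
  then show "X (a *\<^sub>C x) = a *\<^sub>C X x"
    using assms(1) LIMSEQ_unique by (simp add: BH_iff)
qed

lemma BH_inverse:
  assumes "A \<in> BH" "inverts A B"
  shows "B \<in> BH"
  unfolding BH_iff using assms(1) inverts_apply[OF assms(2)] unfolding BH_iff by metis

lemma fc_BH: "A \<in> BH \<Longrightarrow> fc f A X \<Longrightarrow> X \<in> BH"
  unfolding fc_def by (auto intro: BH_limit BH_bpoly)

lemma BH_sa_intros:
  "0 \<in> BH_sa" "id_blinfun \<in> BH_sa"
  "A \<in> BH_sa \<Longrightarrow> B \<in> BH_sa \<Longrightarrow> A + B \<in> BH_sa"
  "A \<in> BH_sa \<Longrightarrow> B \<in> BH_sa \<Longrightarrow> A - B \<in> BH_sa"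
  "A \<in> BH_sa \<Longrightarrow> c *\<^sub>R A \<in> BH_sa"
  "(\<And>i. i \<in> I \<Longrightarrow> C i \<in> BH_sa) \<Longrightarrow> sum C I \<in> BH_sa"
  "A \<in> BH_sa \<Longrightarrow> B \<in> BH_sa \<Longrightarrow> A o\<^sub>L B o\<^sub>L A \<in> BH_sa"
  "A \<in> BH_sa \<Longrightarrow> inverts A B \<Longrightarrow> B \<in> BH_sa"
  by (simp_all add: BH_sa_iff BH_0 sadj_0 BH_id sadj_id BH_add sadj_add BH_diff sadj_diff BH_scaleR
      sadj_scaleR BH_sum sadj_sum BH_compose sadj_conj BH_inverse[of A B] sadj_inverse[of A B])

subsection \<open>Spectrum and functional calculus\<close>

lemma poly_op_0: "poly_op K 0 A x = hzero K"
  by (simp add: poly_op_def)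

lemma poly_op_pCons:
  "a \<noteq> 0 \<or> p \<noteq> 0 \<Longrightarrow> poly_op K (pCons a p) A x = hadd K (hscale K (of_real a) x) (A (poly_op K p A x))"
  by (auto simp: poly_op_def)

lemma poly_op_hs: "poly_op hs p (blinfun_apply A) = blinfun_apply (bpoly p A)"
proof (induction p)
  case (pCons a p)
  then show ?case by (auto simp: poly_op_pCons fun_eq_iff blinfun.bilinear_simps scaleC_of_real)
qed (simp add: fun_eq_iff poly_op_0)

text \<open>The inverse of a complex-linear operator is complex-linear, so at a real point the real
  and the complex notion of invertibility coincide.\<close>

lemma real_spectrum_hs:
  fixes A :: "'h::complex_hilbert oper"
  assumes "A \<in> BH"
  shows "of_real t \<in> spectrum hs (blinfun_apply A) \<longleftrightarrow> t \<in> rspec A"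
proof -
  have app: "(A - t *\<^sub>R id_blinfun) x = A x - of_real t *\<^sub>C x" for x
    by (simp add: blinfun.bilinear_simps scaleC_of_real)
  have "(\<exists>R\<in>bounded_ops hs. \<forall>x. R (A x - of_real t *\<^sub>C x) = x \<and> A (R x) - of_real t *\<^sub>C R x = x)
      \<longleftrightarrow> (\<exists>B. inverts (A - t *\<^sub>R id_blinfun) B)" (is "?L \<longleftrightarrow> ?R")
  proof
    assume ?L
    then obtain R where R: "R \<in> bounded_ops hs"
      "\<And>x. R (A x - of_real t *\<^sub>C x) = x" "\<And>x. A (R x) - of_real t *\<^sub>C R x = x" by blast
    from R(1) obtain B where "blinfun_apply B = R" by (rule bounded_ops_blinfun)
    with R have "inverts (A - t *\<^sub>R id_blinfun) B" by (intro invertsI) (auto simp: app)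
    then show ?R ..
  next
    assume ?R
    then obtain B where B: "inverts (A - t *\<^sub>R id_blinfun) B" ..
    moreover have "A - t *\<^sub>R id_blinfun \<in> BH" using assms by (intro BH_diff BH_scaleR BH_id)
    ultimately have "blinfun_apply B \<in> bounded_ops hs" using BH_inverse BH_def by blast
    then show ?L using inverts_apply[OF B] by (auto simp: app)
  qed
  then show ?thesis
    unfolding spectrum_def rspec_def mem_Collect_eq hs_simps hsub_hs ball_UNIV by (simp only:)
qed

lemma op_tendsto_hs:
  "op_tendsto hs (\<lambda>m. blinfun_apply (S m)) (blinfun_apply X) \<longleftrightarrow> S \<longlonglongrightarrow> X"
proof
  assume L: "op_tendsto hs (\<lambda>m. blinfun_apply (S m)) (blinfun_apply X)"
  show "S \<longlonglongrightarrow> X"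
    unfolding tendsto_iff
  proof (intro allI impI)
    fix e :: real assume e: "e > 0"
    then have "\<forall>\<^sub>F m in sequentially. \<forall>x. norm (S m x - X x) \<le> e/2 * norm x"
      using L[unfolded op_tendsto_def, rule_format, of "e/2"] by simp
    then show "\<forall>\<^sub>F m in sequentially. dist (S m) X < e"
    proof eventually_elim
      case (elim m)
      then have "norm (S m - X) \<le> e/2"
        using e by (intro norm_blinfun_bound) (auto simp: blinfun.bilinear_simps)
      then show ?case using e by (simp add: dist_norm)
    qed
  qed
next
  assume R: "S \<longlonglongrightarrow> X"
  show "op_tendsto hs (\<lambda>m. blinfun_apply (S m)) (blinfun_apply X)"
    unfolding op_tendsto_def
  proof (intro allI impI)
    fix e :: real assume "e > 0"
    then have "\<forall>\<^sub>F m in sequentially. dist (S m) X < e" using R by (simp add: tendsto_iff)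
    then show "\<forall>\<^sub>F m in sequentially. \<forall>x\<in>hcarrier hs. hnorm hs (hsub hs (S m x) (X x)) \<le> e * hnorm hs x"
    proof eventually_elim
      case (elim m)
      then have "norm ((S m - X) x) \<le> e * norm x" for x
        by (intro order_trans[OF norm_blinfun mult_right_mono]) (auto simp: dist_norm)
      then show ?case by (simp add: blinfun.bilinear_simps)
    qed
  qed
qed

lemma is_fcalc_hs:
  assumes "A \<in> BH"
  shows "is_fcalc hs f (blinfun_apply A) (blinfun_apply X) \<longleftrightarrow> fc f A X"
proof -
  have "blinfun_apply X \<in> bounded_ops hs" if "fc f A X"
    using fc_BH[OF assms that] by (simp add: BH_def)
  then show ?thesis
    unfolding is_fcalc_def poly_op_hs op_tendsto_hs real_spectrum_hs[OF assms] by (auto simp: fc_def)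
qed

lemma fcalc_eqI:
  assumes "A \<in> BH_sa" "fc f A X"
  shows "fcalc f A = X"
  unfolding fcalc_def using assms is_fcalc_hs[of A f] fc_unique[of A f]
  by (intro the_equality) (auto simp: BH_sa_iff)

lemma fc_BH_sa: "A \<in> BH_sa \<Longrightarrow> fc f A X \<Longrightarrow> X \<in> BH_sa"
  using fc_BH fc_sadj by (auto simp: BH_sa_iff)

text \<open>Self-adjoint operators have no non-real spectrum: with \<open>D = A - Re c\<close> and
  \<open>b = Im c \<noteq> 0\<close>, the product of D - ib and D + ib is
  \<open>D\<^sup>2 + b\<^sup>2\<close>, which is coercive; its inverse \<open>N\<close> times D + ib
  is the resolvent at \<open>c\<close>.\<close>

lemma spec_subset:
  fixes A :: "'h::complex_hilbert oper"
  assumes A: "A \<in> BH_sa" and S: "rspec A \<subseteq> S"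
  shows "spec A \<subseteq> of_real ` S"
proof
  fix c assume c: "c \<in> spec A"
  have ABH: "A \<in> BH" and sA: "sadj A" using A by (auto simp: BH_sa_iff)
  have lin: "A (a *\<^sub>C x) = a *\<^sub>C A x" for a x using ABH by (simp add: BH_iff)
  show "c \<in> of_real ` S"
  proof (cases "Im c = 0")
    case True
    then have cr: "c = of_real (Re c)" by (simp add: complex_eq_iff)
    then have "Re c \<in> rspec A"
      using c real_spectrum_hs[OF ABH, of "Re c"] by (simp add: spec_def)
    then show ?thesis using S cr by blast
  next
    case False
    define a b where "a = Re c" and "b = Im c"
    have c_eq: "c *\<^sub>C x = a *\<^sub>R x + b *\<^sub>R (\<i> *\<^sub>C x)" for x :: 'h
    proof -
      have "c = of_real a + of_real b * \<i>" by (simp add: a_def b_def complex_eq_iff)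
      then show ?thesis by (simp add: scaleC_add_left scaleC_scaleC[symmetric] scaleC_of_real)
    qed
    define D where "D = A - a *\<^sub>R id_blinfun"
    define Q where "Q = (D o\<^sub>L D) + b\<^sup>2 *\<^sub>R id_blinfun"
    have DBH: "D \<in> BH" unfolding D_def by (intro BH_diff ABH BH_scaleR BH_id)
    have sD: "sadj D" unfolding D_def by (intro sadj_diff sA sadj_scaleR sadj_id)
    have "qle (b\<^sup>2 *\<^sub>R id_blinfun) Q"
    proof -
      have "inner x (D (D x)) \<ge> 0" for x using sadjD[OF sD, of x "D x"] by (metis inner_ge_zero)
      then show ?thesis by (simp add: qle_def Q_def blinfun.bilinear_simps inner_simps)
    qed
    then obtain N where N: "inverts Q N"
      using coercive_invertible[of "b\<^sup>2" Q] False by (auto simp: b_def)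
    have QBH: "Q \<in> BH" unfolding Q_def by (intro BH_add BH_compose DBH BH_scaleR BH_id)
    have NBH: "N \<in> BH" using BH_inverse[OF QBH N] .
    have ND: "N (D x) = D (N x)" for x
    proof -
      have "Q (D y) = D (Q y)" for y by (simp add: Q_def blinfun.bilinear_simps)
      then show ?thesis by (metis inverts_apply[OF N])
    qed
    have Dlin: "D (a *\<^sub>C x) = a *\<^sub>C D x" and Nlin: "N (a *\<^sub>C x) = a *\<^sub>C N x" for a x
      using DBH NBH by (simp_all add: BH_iff)
    define R where "R x = N (D x + b *\<^sub>R (\<i> *\<^sub>C x))" for x
    have blR: "bounded_linear R"
      unfolding R_def using bounded_linear_scaleC
      by (intro bounded_linear_compose[OF blinfun.bounded_linear_right] bounded_linear_add
          blinfun.bounded_linear_right bounded_linear_compose[OF bounded_linear_scaleR_right])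
    have Rlin: "R (z *\<^sub>C x) = z *\<^sub>C R x" for z x
      by (simp add: R_def Dlin Nlin blinfun.bilinear_simps scaleC_add_right scaleC_simps scaleC_scaleC mult.commute)
    have RB: "R \<in> bounded_ops hs"
      using blR Rlin BH_iff[of "Blinfun R"] by (simp add: bounded_linear_Blinfun_apply BH_def)
    have ii: "\<i> *\<^sub>C \<i> *\<^sub>C x = - x" for x :: 'h
      using scaleC_scaleC[of \<i> \<i> x] scaleC_of_real[of "-1" x] by simp
    have Dc: "A x - c *\<^sub>C x = D x - b *\<^sub>R (\<i> *\<^sub>C x)" for x
      by (simp add: D_def c_eq blinfun.bilinear_simps)
    have alg: "D (D x - b *\<^sub>R (\<i> *\<^sub>C x)) + b *\<^sub>R (\<i> *\<^sub>C (D x - b *\<^sub>R (\<i> *\<^sub>C x))) = Q x" for x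
      by (simp add: Q_def blinfun.bilinear_simps Dlin scaleC_simps ii power2_eq_square algebra_simps)
    have alg2: "D (D x + b *\<^sub>R (\<i> *\<^sub>C x)) - b *\<^sub>R (\<i> *\<^sub>C (D x + b *\<^sub>R (\<i> *\<^sub>C x))) = Q x" for x
      by (simp add: Q_def blinfun.bilinear_simps Dlin scaleC_simps scaleC_add_right ii power2_eq_square algebra_simps)
    have "R (A x - c *\<^sub>C x) = x" for x
      unfolding Dc R_def alg by (rule inverts_apply[OF N])
    moreover have "A (R x) - c *\<^sub>C R x = x" for x
    proof -
      have "R x = D (N x) + b *\<^sub>R (\<i> *\<^sub>C N x)"
        by (simp add: R_def blinfun.bilinear_simps ND Nlin)
      then have "A (R x) - c *\<^sub>C R x = Q (N x)" unfolding Dc by (simp only: alg2)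
      then show ?thesis by (simp add: inverts_apply[OF N])
    qed
    ultimately show ?thesis using c RB by (auto simp: spec_def spectrum_def)
  qed
qed

subsection \<open>Positive invertible operators\<close>

text \<open>A lower bound in place of an inverse: it passes upwards along the order.\<close>

lemma BH_pos_iff: "A \<in> BH_pos \<longleftrightarrow> A \<in> BH_sa \<and> (\<exists>c>0. qle (c *\<^sub>R id_blinfun) A)"
proof
  assume "A \<in> BH_pos"
  then obtain B where A: "A \<in> BH_sa" "0 \<preceq> A" "inverts A B" by (auto simp: BH_pos_def inverts_def)
  then have "sadj A" "qle 0 A" using ole_iff BH_sa_intros(1) by (auto simp: BH_sa_iff)
  then show "A \<in> BH_sa \<and> (\<exists>c>0. qle (c *\<^sub>R id_blinfun) A)"
    using psd_invertible_coercive[of A B] A by blast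
next
  assume "A \<in> BH_sa \<and> (\<exists>c>0. qle (c *\<^sub>R id_blinfun) A)"
  then obtain c where A: "A \<in> BH_sa" and c: "c > 0" "qle (c *\<^sub>R id_blinfun) A" by blast
  obtain B where B: "inverts A B" using coercive_invertible c by blast
  then have "B \<in> BH" using A BH_inverse by (auto simp: BH_sa_iff)
  moreover have "qle 0 (c *\<^sub>R (id_blinfun :: 'a \<Rightarrow>\<^sub>L 'a))"
    using c by (simp add: qle_def blinfun.bilinear_simps)
  then have "qle 0 A" using c(2) by (rule qle_trans)
  then have "0 \<preceq> A" using ole_iff[OF BH_sa_intros(1) A] by simp
  ultimately show "A \<in> BH_pos" using A B by (auto simp: BH_pos_def inverts_def)
qed

lemma BH_pos_sa: "A \<in> BH_pos \<Longrightarrow> A \<in> BH_sa"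
  by (simp add: BH_pos_def)

lemma BH_pos_sadj: "A \<in> BH_pos \<Longrightarrow> sadj A"
  by (simp add: BH_pos_def BH_sa_iff)

lemma BH_pos_qle_0: "A \<in> BH_pos \<Longrightarrow> qle 0 A"
  unfolding BH_pos_def using ole_iff[OF BH_sa_intros(1)] by blast

lemma BH_pos_mono: "A \<in> BH_pos \<Longrightarrow> B \<in> BH_sa \<Longrightarrow> qle A B \<Longrightarrow> B \<in> BH_pos"
  unfolding BH_pos_iff using qle_trans by blast

lemma BH_pos_scaleR:
  assumes "A \<in> BH_pos" "c > 0"
  shows "c *\<^sub>R A \<in> BH_pos"
proof -
  obtain d where d: "d > 0" "qle (d *\<^sub>R id_blinfun) A" using assms by (auto simp: BH_pos_iff)
  then have "qle ((c * d) *\<^sub>R id_blinfun) (c *\<^sub>R A)"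
    using qle_scaleR[of c "d *\<^sub>R id_blinfun" A] assms by simp
  then show ?thesis using assms d BH_sa_intros(5) unfolding BH_pos_iff by (metis mult_pos_pos)
qed

lemma BH_pos_id: "id_blinfun \<in> BH_pos"
  unfolding BH_pos_iff using BH_sa_intros(2) qle_refl by (metis scaleR_one zero_less_one)

lemma BH_pos_rspec:
  assumes "A \<in> BH_pos"
  obtains a b where "0 < a" "rspec A \<subseteq> {a..b}"
proof -
  obtain c where c: "c > 0" "qle (c *\<^sub>R id_blinfun) A" "sadj A"
    using assms by (auto simp: BH_pos_iff BH_sa_iff)
  from rspec_bounds[OF c(3,2) qle_norm(1)] show ?thesis by (rule that[OF c(1)])
qed

section \<open>Inverses and functions of positive operators\<close>

definition opinv :: "('a::real_normed_vector \<Rightarrow>\<^sub>L 'a) \<Rightarrow> 'a \<Rightarrow>\<^sub>L 'a" where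
  "opinv A = (THE B. inverts A B)"

lemma opinv_eqI: "inverts A B \<Longrightarrow> opinv A = B"
  unfolding opinv_def using inverts_unique by (intro the_equality)

lemma inverts_opinv: "A \<in> BH_pos \<Longrightarrow> inverts A (opinv A)"
  unfolding BH_pos_def using opinv_eqI[of A] by (auto simp: inverts_def)

lemma opinv_pos:
  fixes A :: "'h::complex_hilbert oper"
  assumes A: "A \<in> BH_pos"
  shows "opinv A \<in> BH_pos"
proof -
  note inv = inverts_opinv[OF A]
  have sa: "opinv A \<in> BH_sa" using BH_sa_intros(8)[OF BH_pos_sa[OF A] inv] .
  have "inner x (opinv A x) = inner (opinv A x) (A (opinv A x))" for x
    by (simp add: inverts_apply[OF inv] inner_commute)
  then have "qle 0 (opinv A)" using BH_pos_qle_0[OF A] by (simp add: qle_def)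
  then show ?thesis
    using psd_invertible_coercive[of "opinv A" A] inverts_sym[OF inv] sa by (auto simp: BH_pos_iff BH_sa_iff)
qed

lemma opinv_mono: "A \<in> BH_pos \<Longrightarrow> B \<in> BH_pos \<Longrightarrow> qle A B \<Longrightarrow> qle (opinv B) (opinv A)"
  by (rule qle_inverse[OF BH_pos_sadj BH_pos_sadj BH_pos_qle_0 _ inverts_opinv inverts_opinv])

lemma opinv_opinv: "A \<in> BH_pos \<Longrightarrow> opinv (opinv A) = A"
  by (rule opinv_eqI[OF inverts_sym[OF inverts_opinv]])

lemma opinv_scaleR:
  assumes "A \<in> BH_pos" "c > 0"
  shows "opinv (c *\<^sub>R A) = (1/c) *\<^sub>R opinv A"
  using assms by (intro opinv_eqI invertsI) (auto simp: blinfun.bilinear_simps inverts_apply[OF inverts_opinv])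

lemma conj_pos:
  fixes A :: "'h::complex_hilbert oper"
  assumes R: "R \<in> BH_sa" "inverts R R'" and A: "A \<in> BH_pos"
  shows "R o\<^sub>L A o\<^sub>L R \<in> BH_pos"
proof -
  have sR: "inner (R y) z = inner y (R z)" for y z using R(1) by (simp add: BH_sa_iff sadjD)
  have "inverts (R o\<^sub>L A o\<^sub>L R) (R' o\<^sub>L (opinv A o\<^sub>L R'))"
    by (intro inverts_compose R inverts_opinv A)
  moreover have "qle 0 (R o\<^sub>L A o\<^sub>L R)"
    using BH_pos_qle_0[OF A] by (simp add: qle_def sR[symmetric])
  moreover have "R o\<^sub>L A o\<^sub>L R \<in> BH_sa" by (rule BH_sa_intros(7)[OF R(1) BH_pos_sa[OF A]])
  ultimately show ?thesis
    using psd_invertible_coercive[of "R o\<^sub>L A o\<^sub>L R"] unfolding BH_pos_iff BH_sa_iff by blast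
qed

lemma fcalc_pos_domain:
  assumes A: "A \<in> BH_pos" and f: "continuous_on {0<..} f"
  shows "fc f A (fcalc f A)" "fcalc f A \<in> BH_sa" "bounded (f ` rspec A)"
proof -
  obtain a b where ab: "0 < a" "rspec A \<subseteq> {a..b}" using BH_pos_rspec[OF A] .
  have c: "continuous_on {a..b} f" using f ab by (auto elim!: continuous_on_subset)
  obtain X where "fc f A X" using fc_exists[OF BH_pos_sadj[OF A] ab(2) c] ..
  then show *: "fc f A (fcalc f A)" using fcalc_eqI BH_pos_sa[OF A] by metis
  then show "fcalc f A \<in> BH_sa" using fc_BH_sa BH_pos_sa[OF A] by blast
  have "bounded (f ` {a..b})" using c by (intro compact_imp_bounded compact_continuous_image) auto
  then show "bounded (f ` rspec A)" using ab(2) by (meson bounded_subset image_mono)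
qed

lemma fcalc_mult:
  assumes A: "A \<in> BH_pos" and f: "continuous_on {0<..} f" and g: "continuous_on {0<..} g"
  shows "fc (\<lambda>t. f t * g t) A (fcalc f A o\<^sub>L fcalc g A)"
  using fc_mult fcalc_pos_domain[OF A f] fcalc_pos_domain[OF A g] by blast

text \<open>The products of f(A) and (1/f)(A) in both orders are calculi of a function that equals 1
  on the spectrum, so by uniqueness they are the identity.\<close>

lemma fcalc_pos:
  fixes A :: "'h::complex_hilbert oper"
  assumes A: "A \<in> BH_pos" and f: "continuous_on {0<..} f" and pos: "\<And>t. t > 0 \<Longrightarrow> 0 < f t"
  shows "fcalc f A \<in> BH_pos" "opinv (fcalc f A) = fcalc (\<lambda>t. 1 / f t) A"
proof -
  let ?g = "\<lambda>t. 1 / f t"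
  have g: "continuous_on {0<..} ?g" using f pos by (intro continuous_intros) force+
  obtain a b where ab: "0 < a" "rspec A \<subseteq> {a..b}" using BH_pos_rspec[OF A] .
  have id: "X = id_blinfun" if "fc h A X" "\<And>t. t > 0 \<Longrightarrow> h t = 1" for h X
  proof (rule fc_unique[OF BH_pos_sadj[OF A] that(1)])
    show "fc h A id_blinfun" using ab that(2) by (intro fc_polyI[of A h "[:1:]"]) auto
  qed
  have inv: "inverts (fcalc f A) (fcalc ?g A)"
    unfolding inverts_def using pos
    by (intro conjI id[OF fcalc_mult[OF A f g]] id[OF fcalc_mult[OF A g f]]) force+
  have "qle (bpoly 0 A) (fcalc f A)"
    using ab pos by (intro fc_mono[OF BH_pos_sadj[OF A] fc_poly fcalc_pos_domain(1)[OF A f]]) (force intro: less_imp_le)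
  then show "fcalc f A \<in> BH_pos"
    using psd_invertible_coercive[OF _ _ inv] fcalc_pos_domain(2)[OF A f] by (auto simp: BH_pos_iff BH_sa_iff)
  show "opinv (fcalc f A) = fcalc ?g A" by (rule opinv_eqI[OF inv])
qed

lemma fc_affine:
  assumes "fc f A X"
  shows "fc (\<lambda>t. a + b * f t) A (a *\<^sub>R id_blinfun + b *\<^sub>R X)"
proof -
  obtain u where u: "uniform_limit (rspec A) (\<lambda>m. poly (u m)) f sequentially"
    "(\<lambda>m. bpoly (u m) A) \<longlonglongrightarrow> X" using assms unfolding fc_def by blast
  have "uniform_limit (rspec A) (\<lambda>m t. a + b * poly (u m) t) (\<lambda>t. a + b * f t) sequentially"
    using u(1) by (intro uniform_limit_intros) auto
  moreover have "(\<lambda>m. a *\<^sub>R id_blinfun + b *\<^sub>R bpoly (u m) A) \<longlonglongrightarrow> a *\<^sub>R id_blinfun + b *\<^sub>R X"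
    using u(2) by (intro tendsto_intros)
  moreover have "bpoly ([:a:] + smult b (u m)) A = a *\<^sub>R id_blinfun + b *\<^sub>R bpoly (u m) A" for m
    by (simp add: bpoly_add bpoly_smult)
  moreover have "poly ([:a:] + smult b (u m)) = (\<lambda>t. a + b * poly (u m) t)" for m
    by (simp add: fun_eq_iff)
  ultimately show ?thesis unfolding fc_def
    by (intro exI[of _ "\<lambda>m. [:a:] + smult b (u m)"]) (simp only: simp_thms)
qed

lemma fc_opinv:
  fixes A :: "'h::complex_hilbert oper"
  assumes A: "A \<in> BH_pos"
  shows "fc (\<lambda>t. 1 / t) A (opinv A)"
proof -
  have id_A: "fcalc (\<lambda>t. t) A = A"
    by (rule fcalc_eqI[OF BH_pos_sa[OF A]], rule fc_polyI[of A _ "[:0, 1:]"]) (auto intro!: blinfun_eqI)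
  have "opinv A = fcalc (\<lambda>t. 1 / t) A"
    using fcalc_pos(2)[OF A continuous_on_id] by (simp add: id_A)
  then show ?thesis
    using fcalc_pos_domain(1)[OF A, of "\<lambda>t. 1 / t"] by (simp add: continuous_intros)
qed

section \<open>The weighted geometric mean of two operators\<close>

lemma continuous_on_powr_pos: "continuous_on {0<..} (\<lambda>t::real. t powr s)"
  by (intro continuous_intros) auto

lemma weighted_exp_le:
  fixes w x y z :: real
  assumes "0 \<le> w" "w \<le> 1" "(1 - w) * x + w * y = 0"
  shows "exp (w * z) \<le> (1 - w) * exp x + w * exp y * exp z"
proof -
  have "w * z = (1 - w) * x + w * (y + z)" using assms(3) by (simp add: algebra_simps)
  then have "exp (w * z) \<le> (1 - w) * exp x + w * exp (y + z)"
    using convex_onD[OF exp_convex, of w x "y + z"] assms by simp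
  then show ?thesis by (simp add: exp_add)
qed

text \<open>Weighted AM-GM with free parameters: the geometric mean of positive numbers a and b is
  the minimum of \<open>(1 - w) * exp x * a + w * exp y * b\<close> on the line
  \<open>(1 - w) * x + w * y = 0\<close>. The parameters are kept because
  \<open>thompson_gmean_le\<close> tunes them.\<close>

lemma powr_le_tangent:
  fixes t :: real
  assumes "0 \<le> w" "w \<le> 1" "(1 - w) * x + w * y = 0" "t > 0"
  shows "t powr w \<le> (1 - w) * exp x + w * exp y * t"
    and "1 / t powr w \<le> (1 - w) * exp x + w * exp y * (1 / t)"
  using weighted_exp_le[OF assms(1-3), of "ln t"] weighted_exp_le[OF assms(1-3), of "- ln t"] assms(4)
  by (simp_all add: powr_def exp_minus inverse_eq_divide)

lemma qle_conj_affine: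
  assumes R: "sadj R" and le: "qle W (a *\<^sub>R id_blinfun + b *\<^sub>R C)"
  shows "qle (R o\<^sub>L W o\<^sub>L R) (a *\<^sub>R (R o\<^sub>L R) + b *\<^sub>R (R o\<^sub>L C o\<^sub>L R))"
proof -
  have "R o\<^sub>L (a *\<^sub>R id_blinfun + b *\<^sub>R C) o\<^sub>L R = a *\<^sub>R (R o\<^sub>L R) + b *\<^sub>R (R o\<^sub>L C o\<^sub>L R)"
    by (intro blinfun_eqI) (simp add: blinfun.bilinear_simps)
  then show ?thesis using qle_conj[OF R le] by simp
qed

lemma gmean_facts:
  fixes A B :: "'h::complex_hilbert oper"
  assumes A: "A \<in> BH_pos" and B: "B \<in> BH_pos" and w: "0 \<le> w" "w \<le> 1"
  shows gmean_pos: "gmean w A B \<in> BH_pos"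
    and gmean_le: "(1 - w) * x + w * y = 0 \<Longrightarrow>
      qle (gmean w A B) (((1 - w) * exp x) *\<^sub>R A + (w * exp y) *\<^sub>R B)"
    and opinv_gmean_le: "(1 - w) * x + w * y = 0 \<Longrightarrow>
      qle (opinv (gmean w A B)) (((1 - w) * exp x) *\<^sub>R opinv A + (w * exp y) *\<^sub>R opinv B)"
proof -
  let ?h = "\<lambda>t::real. t powr (1/2)" and ?h' = "\<lambda>t::real. t powr (- 1/2)"
  define R R' where "R = fcalc ?h A" and "R' = fcalc ?h' A"
  define C where "C = R' o\<^sub>L B o\<^sub>L R'"
  define W where "W = fcalc (\<lambda>t. t powr w) C"
  define V where "V = fcalc (\<lambda>t. 1 / t powr w) C"
  obtain a b where ab: "0 < a" "rspec A \<subseteq> {a..b}" using BH_pos_rspec[OF A] .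
  note cont = continuous_on_powr_pos
  have Rpos: "R \<in> BH_pos" "R' \<in> BH_pos"
    unfolding R_def R'_def by (auto intro!: fcalc_pos(1)[OF A cont])
  have "opinv R = R'"
    unfolding R_def R'_def by (subst fcalc_pos(2)[OF A cont]) (simp_all add: powr_minus_divide)
  then have RR': "inverts R R'" using inverts_opinv[OF Rpos(1)] by simp
  have "fc (\<lambda>t. ?h t * ?h t) A (R o\<^sub>L R)" unfolding R_def by (rule fcalc_mult[OF A cont cont])
  moreover have "fc (\<lambda>t. ?h t * ?h t) A A"
    using ab by (intro fc_polyI[of A _ "[:0, 1:]"]) (auto simp: powr_add[symmetric] intro!: blinfun_eqI)
  ultimately have RR: "R o\<^sub>L R = A" using fc_unique[OF BH_pos_sadj[OF A]] by blast
  have R'R': "R' o\<^sub>L R' = opinv A"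
    using inverts_compose[OF RR' RR'] opinv_eqI[of A] RR by simp
  have Cpos: "C \<in> BH_pos"
    unfolding C_def by (rule conj_pos[OF BH_pos_sa[OF Rpos(2)] inverts_sym[OF RR'] B])
  have RCR: "R o\<^sub>L C o\<^sub>L R = B"
    by (intro blinfun_eqI) (simp add: C_def inverts_apply[OF RR'])
  have oC: "inverts C (R o\<^sub>L opinv B o\<^sub>L R)"
    using inverts_apply[OF RR'] inverts_apply[OF inverts_opinv[OF B]] by (intro invertsI) (simp_all add: C_def)
  have R'CR': "R' o\<^sub>L opinv C o\<^sub>L R' = opinv B"
    by (intro blinfun_eqI) (simp add: opinv_eqI[OF oC] inverts_apply[OF RR'])
  have Wpos: "W \<in> BH_pos" unfolding W_def by (rule fcalc_pos(1)[OF Cpos cont]) simp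
  have oW: "opinv W = V" unfolding W_def V_def by (rule fcalc_pos(2)[OF Cpos cont]) simp
  have G: "gmean w A B = R o\<^sub>L W o\<^sub>L R"
    by (simp add: gmean_def Let_def R_def R'_def W_def C_def)
  show "gmean w A B \<in> BH_pos"
    unfolding G by (rule conj_pos[OF BH_pos_sa[OF Rpos(1)] RR' Wpos])
  \<comment> \<open>Inversion replaces \<open>R\<close> by \<open>R'\<close> and the power of
    \<open>C\<close> by its reciprocal; the second tangent bound, conjugated by \<open>R'\<close>,
    therefore speaks of \<open>opinv A\<close> and \<open>opinv B\<close>.\<close>
  have oG: "opinv (gmean w A B) = R' o\<^sub>L V o\<^sub>L R'"
    unfolding G oW[symmetric]
    using inverts_apply[OF RR'] inverts_apply[OF inverts_opinv[OF Wpos]]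
    by (intro opinv_eqI invertsI) simp_all
  obtain a' b' where ab': "0 < a'" "rspec C \<subseteq> {a'..b'}" using BH_pos_rspec[OF Cpos] .
  assume xy: "(1 - w) * x + w * y = 0"
  let ?p = "(1 - w) * exp x" and ?q = "w * exp y"
  have fW: "fc (\<lambda>t. t powr w) C W" unfolding W_def by (rule fcalc_pos_domain(1)[OF Cpos cont])
  have fV: "fc (\<lambda>t. 1 / t powr w) C V"
    unfolding V_def by (rule fcalc_pos_domain(1)[OF Cpos]) (intro continuous_intros, auto)
  \<comment> \<open>The tangent as a polynomial of degree one; conjugation by \<open>R\<close> turns
    the identity into \<open>A\<close> and \<open>C\<close> into \<open>B\<close>.\<close>
  have "qle W (bpoly [:?p, ?q:] C)"
    using ab' powr_le_tangent(1)[OF w xy]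
    by (intro fc_mono[OF BH_pos_sadj[OF Cpos] fW fc_poly]) (force simp: mult.commute)
  then have "qle W (?p *\<^sub>R id_blinfun + ?q *\<^sub>R C)"
    by (simp add: qle_def blinfun.bilinear_simps)
  from qle_conj_affine[OF BH_pos_sadj[OF Rpos(1)] this]
  show "qle (gmean w A B) (?p *\<^sub>R A + ?q *\<^sub>R B)" by (simp add: G RR RCR)
  have cfc: "fc (\<lambda>t. ?p + ?q * (1 / t)) C (?p *\<^sub>R id_blinfun + ?q *\<^sub>R opinv C)"
    by (rule fc_affine[OF fc_opinv[OF Cpos]])
  have "qle V (?p *\<^sub>R id_blinfun + ?q *\<^sub>R opinv C)"
    using ab' powr_le_tangent(2)[OF w xy] by (intro fc_mono[OF BH_pos_sadj[OF Cpos] fV cfc]) force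
  from qle_conj_affine[OF BH_pos_sadj[OF Rpos(2)] this]
  show "qle (opinv (gmean w A B)) (?p *\<^sub>R opinv A + ?q *\<^sub>R opinv B)" by (simp add: oG R'R' R'CR')
qed

section \<open>The Thompson metric\<close>

lemma BH_pos_inner_pos:
  assumes "A \<in> BH_pos" "x \<noteq> 0"
  shows "0 < inner x (A x)"
proof -
  obtain c where c: "c > 0" "qle (c *\<^sub>R id_blinfun) A" using assms by (auto simp: BH_pos_iff)
  have "0 < c * inner x x" using c assms by simp
  also have "\<dots> \<le> inner x (A x)" using c(2) by (simp add: qle_def blinfun.bilinear_simps)
  finally show ?thesis .
qed

text \<open>The infimum is attained: every admissible factor dominates the quotients of the two
  quadratic forms, hence so does the infimum. A nonzero vector keeps it positive, as the logarithm
  in \<open>thompson\<close> demands.\<close>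

lemma Mratio_le_iff:
  fixes A B :: "'h::complex_hilbert oper"
  assumes nz: "\<exists>x::'h. x \<noteq> 0" and A: "A \<in> BH_pos" and B: "B \<in> BH_pos"
  shows "0 < Mratio A B" and "0 < \<alpha> \<Longrightarrow> Mratio A B \<le> \<alpha> \<longleftrightarrow> qle B (\<alpha> *\<^sub>R A)"
proof -
  define S where "S = {\<alpha>. 0 < \<alpha> \<and> qle B (\<alpha> *\<^sub>R A)}"
  have M: "Mratio A B = Inf S"
    unfolding Mratio_def S_def using BH_pos_sa[OF A] BH_pos_sa[OF B] by (simp add: ole_iff BH_sa_intros(5))
  obtain c where c: "c > 0" "qle (c *\<^sub>R id_blinfun) A" using A by (auto simp: BH_pos_iff)
  \<comment> \<open>\<open>B\<close> is at most \<open>norm B\<close> and the identity is at most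
    \<open>A / c\<close>; the summand 1 ensures that the factor is positive.\<close>
  have "(norm B + 1) / c \<in> S"
  proof -
    have "inner x (B x) \<le> (norm B + 1) / c * inner x (A x)" for x
    proof -
      have "inner x (B x) \<le> norm B * inner x x"
        using qle_norm(1)[of B] by (simp add: qle_def blinfun.bilinear_simps)
      also have "\<dots> \<le> (norm B + 1) / c * (c * inner x x)"
        using c by (simp add: mult_right_mono)
      also have "\<dots> \<le> (norm B + 1) / c * inner x (A x)"
        using c by (intro mult_left_mono) (auto simp: qle_def blinfun.bilinear_simps)
      finally show ?thesis .
    qed
    then show ?thesis using c by (simp add: S_def qle_def blinfun.bilinear_simps add_nonneg_pos)
  qed
  then have ne: "S \<noteq> {}" by blast
  have quot: "inner x (B x) / inner x (A x) \<le> \<beta>" if "\<beta> \<in> S" "x \<noteq> 0" for \<beta> x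
    using that BH_pos_inner_pos[OF A that(2)] by (simp add: S_def qle_def blinfun.bilinear_simps divide_le_eq)
  obtain x0 :: 'h where x0: "x0 \<noteq> 0" using nz by blast
  have "inner x0 (B x0) / inner x0 (A x0) \<le> Inf S" by (intro cInf_greatest ne quot x0)
  then show pos: "0 < Mratio A B"
    using BH_pos_inner_pos[OF A x0] BH_pos_inner_pos[OF B x0] by (simp add: M) (meson divide_pos_pos less_le_trans)
  assume \<alpha>: "0 < \<alpha>"
  show "Mratio A B \<le> \<alpha> \<longleftrightarrow> qle B (\<alpha> *\<^sub>R A)"
  proof
    assume le: "Mratio A B \<le> \<alpha>"
    have "inner x (B x) \<le> \<alpha> * inner x (A x)" for x
    proof (cases "x = 0")
      case False
      have "inner x (B x) / inner x (A x) \<le> Inf S" by (intro cInf_greatest ne quot False)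
      then show ?thesis using le M BH_pos_inner_pos[OF A False] by (simp add: divide_le_eq) (meson mult_right_mono order_trans less_imp_le)
    qed simp
    then show "qle B (\<alpha> *\<^sub>R A)" by (simp add: qle_def blinfun.bilinear_simps)
  next
    assume "qle B (\<alpha> *\<^sub>R A)"
    then have "\<alpha> \<in> S" using \<alpha> by (simp add: S_def)
    then show "Mratio A B \<le> \<alpha>" unfolding M by (intro cInf_lower bdd_belowI[of _ 0]) (auto simp: S_def)
  qed
qed

lemma thompson_le_iff:
  fixes A B :: "'h::complex_hilbert oper"
  assumes "\<exists>x::'h. x \<noteq> 0" "A \<in> BH_pos" "B \<in> BH_pos"
  shows "thompson A B \<le> r \<longleftrightarrow> qle A (exp r *\<^sub>R B) \<and> qle B (exp r *\<^sub>R A)"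
proof -
  have "ln m \<le> r \<longleftrightarrow> m \<le> exp r" if "0 < m" for m using that by (metis exp_le_cancel_iff exp_ln)
  then show ?thesis
    unfolding thompson_def using Mratio_le_iff[OF assms] Mratio_le_iff[OF assms(1,3,2)] by auto
qed

lemma thompson_commute: "thompson A B = thompson B A"
  by (simp add: thompson_def max.commute)

lemma thompsonD:
  fixes A B :: "'h::complex_hilbert oper"
  assumes "\<exists>x::'h. x \<noteq> 0" "A \<in> BH_pos" "B \<in> BH_pos" "thompson A B \<le> r"
  shows "qle A (exp r *\<^sub>R B)" "qle B (exp r *\<^sub>R A)"
  using thompson_le_iff[OF assms(1-3)] assms(4) by auto

lemma thompson_self_le:
  fixes A :: "'h::complex_hilbert oper"
  assumes "\<exists>x::'h. x \<noteq> 0" "A \<in> BH_pos"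
  shows "thompson A A \<le> 0"
  by (simp add: thompson_le_iff assms qle_refl)

lemma thompson_triangle:
  fixes A B C :: "'h::complex_hilbert oper"
  assumes nz: "\<exists>x::'h. x \<noteq> 0" and ABC: "A \<in> BH_pos" "B \<in> BH_pos" "C \<in> BH_pos"
  shows "thompson A C \<le> thompson A B + thompson B C"
proof -
  have tr: "qle X (exp (r + s) *\<^sub>R Z)" if "qle X (exp r *\<^sub>R Y)" "qle Y (exp s *\<^sub>R Z)"
    for X Y Z :: "'h oper" and r s
    using that(1) qle_scaleR[OF _ that(2), of "exp r"] by (simp add: exp_add) (rule qle_trans)
  show ?thesis
    unfolding thompson_le_iff[OF nz ABC(1,3)]
  proof
    show "qle A (exp (thompson A B + thompson B C) *\<^sub>R C)"
      by (rule tr[OF thompsonD(1)[OF nz ABC(1,2) order_refl] thompsonD(1)[OF nz ABC(2,3) order_refl]])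
    show "qle C (exp (thompson A B + thompson B C) *\<^sub>R A)"
      using tr[OF thompsonD(2)[OF nz ABC(2,3) order_refl] thompsonD(2)[OF nz ABC(1,2) order_refl]]
      by (simp add: add.commute)
  qed
qed

lemma thompson_nonneg:
  fixes A B :: "'h::complex_hilbert oper"
  assumes nz: "\<exists>x::'h. x \<noteq> 0" and AB: "A \<in> BH_pos" "B \<in> BH_pos"
  shows "0 \<le> thompson A B"
proof -
  obtain x :: 'h where x: "x \<noteq> 0" using nz by blast
  let ?r = "thompson A A"
  have "inner x (A x) \<le> exp ?r * inner x (A x)"
    using thompsonD(1)[OF nz AB(1) AB(1) order_refl] by (simp add: qle_def blinfun.bilinear_simps)
  then have "1 \<le> exp ?r" using BH_pos_inner_pos[OF AB(1) x] by simp
  then have "0 \<le> ?r" by simp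
  then show ?thesis using thompson_triangle[OF nz AB(1) AB(2) AB(1)] thompson_commute[of B A] by simp
qed

lemma thompson_le_0_eq:
  fixes A B :: "'h::complex_hilbert oper"
  assumes "\<exists>x::'h. x \<noteq> 0" "A \<in> BH_pos" "B \<in> BH_pos" "thompson A B \<le> 0"
  shows "A = B"
  using thompsonD[OF assms] by (intro qle_antisym BH_pos_sadj assms) auto

text \<open>Inversion exchanges the two inequalities behind the Thompson metric, so an upper bound
  for an inverse serves as a lower bound for the operator.\<close>

lemma qle_opinv_scale_iff:
  assumes "A \<in> BH_pos" "B \<in> BH_pos" "0 < c"
  shows "qle (opinv A) (c *\<^sub>R opinv B) \<longleftrightarrow> qle B (c *\<^sub>R A)"
proof
  assume "qle B (c *\<^sub>R A)"
  then have "qle (opinv (c *\<^sub>R A)) (opinv B)" by (intro opinv_mono assms BH_pos_scaleR)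
  then have "qle (c *\<^sub>R opinv (c *\<^sub>R A)) (c *\<^sub>R opinv B)" using assms by (intro qle_scaleR) auto
  then show "qle (opinv A) (c *\<^sub>R opinv B)" using assms by (simp add: opinv_scaleR)
next
  assume "qle (opinv A) (c *\<^sub>R opinv B)"
  then have "qle (opinv (c *\<^sub>R opinv B)) (opinv (opinv A))" by (intro opinv_mono opinv_pos BH_pos_scaleR assms)
  then have "qle (c *\<^sub>R ((1 / c) *\<^sub>R B)) (c *\<^sub>R A)"
    using assms by (intro qle_scaleR) (auto simp: opinv_scaleR opinv_opinv opinv_pos)
  then show "qle B (c *\<^sub>R A)" using assms by simp
qed

lemma thompson_gmean_le:
  fixes A B Z :: "'h::complex_hilbert oper"
  assumes nz: "\<exists>x::'h. x \<noteq> 0" and A: "A \<in> BH_pos" and B: "B \<in> BH_pos" and Z: "Z \<in> BH_pos"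
    and w: "0 \<le> w" "w \<le> 1"
  shows "thompson (gmean w A B) Z \<le> (1 - w) * thompson A Z + w * thompson B Z"
proof -
  define a b r where "a = thompson A Z" and "b = thompson B Z" and "r = (1 - w) * a + w * b"
  \<comment> \<open>With the parameters \<open>r - a\<close> and \<open>r - b\<close> the factors
    \<open>exp a\<close> and \<open>exp b\<close> of the two arguments both become
    \<open>exp r\<close>. The constraint then says exactly that \<open>r\<close> is the weighted
    average of \<open>a\<close> and \<open>b\<close>.\<close>
  have xy: "(1 - w) * (r - a) + w * (r - b) = 0" by (simp add: r_def algebra_simps)
  note Gpos = gmean_pos[OF A B w]
  have combine: "qle G (exp r *\<^sub>R Y)"
    if G: "qle G (((1 - w) * exp (r - a)) *\<^sub>R P + (w * exp (r - b)) *\<^sub>R Q)"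
      and P: "qle P (exp a *\<^sub>R Y)" and Q: "qle Q (exp b *\<^sub>R Y)" for G P Q Y :: "'h oper"
  proof -
    have "qle (((1 - w) * exp (r - a)) *\<^sub>R P + (w * exp (r - b)) *\<^sub>R Q)
      (((1 - w) * exp (r - a)) *\<^sub>R exp a *\<^sub>R Y + (w * exp (r - b)) *\<^sub>R exp b *\<^sub>R Y)"
      using w P Q by (intro qle_add qle_scaleR) auto
    also have "((1 - w) * exp (r - a)) *\<^sub>R exp a *\<^sub>R Y + (w * exp (r - b)) *\<^sub>R exp b *\<^sub>R Y = exp r *\<^sub>R Y"
      by (simp add: exp_diff scaleR_left.add[symmetric]) (simp add: algebra_simps)
    finally show ?thesis using G by (rule qle_trans[rotated])
  qed
  have "qle (gmean w A B) (exp r *\<^sub>R Z)"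
    by (rule combine[OF gmean_le[OF A B w xy]])
      (simp_all add: a_def b_def thompsonD(1)[OF nz _ Z order_refl] A B)
  moreover have "qle (opinv (gmean w A B)) (exp r *\<^sub>R opinv Z)"
    by (rule combine[OF opinv_gmean_le[OF A B w xy]])
      (simp_all add: a_def b_def qle_opinv_scale_iff A B Z thompsonD(2)[OF nz _ Z order_refl])
  then have "qle Z (exp r *\<^sub>R gmean w A B)" by (simp add: qle_opinv_scale_iff Gpos Z)
  ultimately show ?thesis by (simp add: thompson_le_iff[OF nz Gpos Z] r_def a_def b_def)
qed

text \<open>A common upper bound \<open>K\<close> turns multiplicative closeness into norm closeness
  \<open>(exp (d r) - 1) * K\<close>. The norm limit inherits the order bounds, and these are
  Thompson bounds again.\<close>

lemma thompson_complete:
  fixes X :: "nat \<Rightarrow> 'h::complex_hilbert oper"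
  assumes nz: "\<exists>x::'h. x \<noteq> 0" and X: "\<And>r. X r \<in> BH_pos"
    and le: "\<And>r s. r \<le> s \<Longrightarrow> thompson (X s) (X r) \<le> d r" and d: "d \<longlonglongrightarrow> 0"
  obtains L where "L \<in> BH_pos" "\<And>r. thompson (X r) L \<le> d r"
proof -
  define K where "K = exp (d 0) * norm (X 0) + 1"
  have K: "qle (X s) (K *\<^sub>R id_blinfun)" for s
  proof -
    have "inner x (X s x) \<le> K * inner x x" for x
    proof -
      have "inner x (X s x) \<le> exp (d 0) * inner x (X 0 x)"
        using thompsonD(1)[OF nz X X le[of 0 s]] by (simp add: qle_def blinfun.bilinear_simps)
      also have "\<dots> \<le> exp (d 0) * (norm (X 0) * inner x x)"
        using qle_norm(1)[of "X 0"] by (simp add: qle_def blinfun.bilinear_simps)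
      also have "\<dots> \<le> K * inner x x" by (simp add: K_def algebra_simps)
      finally show ?thesis .
    qed
    then show ?thesis by (simp add: qle_def blinfun.bilinear_simps)
  qed
  have d0: "0 \<le> d r" for r using le[of r r] thompson_nonneg[OF nz X X, of r r] by simp
  have nle: "norm (X s - X r) \<le> (exp (d r) - 1) * K" if "r \<le> s" for r s
  proof (rule sadj_norm_le)
    show "sadj (X s - X r)" by (intro sadj_diff BH_pos_sadj X)
    show "0 \<le> (exp (d r) - 1) * K" using d0[of r] by (simp add: K_def)
    note t = thompsonD[OF nz X X le[OF that]]
    have Kx: "inner x (X m x) * (exp (d r) - 1) \<le> (K * inner x x) * (exp (d r) - 1)" for m x
      using K[of m] d0[of r] by (intro mult_right_mono) (auto simp: qle_def blinfun.bilinear_simps)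
    show "qle (X s - X r) (((exp (d r) - 1) * K) *\<^sub>R id_blinfun)"
      unfolding qle_def
    proof
      fix x
      have "inner x (X s x) \<le> exp (d r) * inner x (X r x)"
        using t(1) by (simp add: qle_def blinfun.bilinear_simps)
      then show "inner x ((X s - X r) x) \<le> inner x ((((exp (d r) - 1) * K) *\<^sub>R id_blinfun) x)"
        using Kx[of x r] by (simp add: blinfun.bilinear_simps inner_simps algebra_simps)
    qed
    show "qle (- ((exp (d r) - 1) * K) *\<^sub>R id_blinfun) (X s - X r)"
      unfolding qle_def
    proof
      fix x
      have "inner x (X r x) \<le> exp (d r) * inner x (X s x)"
        using t(2) by (simp add: qle_def blinfun.bilinear_simps)
      then show "inner x ((- ((exp (d r) - 1) * K) *\<^sub>R id_blinfun) x) \<le> inner x ((X s - X r) x)"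
        using Kx[of x s] by (simp add: blinfun.bilinear_simps inner_simps algebra_simps)
    qed
  qed
  have lim0: "(\<lambda>r. (exp (d r) - 1) * K) \<longlonglongrightarrow> 0"
    using d by (auto intro!: tendsto_eq_intros)
  have "Cauchy X"
  proof (rule CauchyI')
    fix e :: real assume "e > 0"
    then obtain N where "\<bar>(exp (d N) - 1) * K\<bar> < e / 2"
      using lim0[unfolded LIMSEQ_iff, rule_format, of "e/2"] by auto
    then have N: "norm (X s - X N) < e / 2" if "N \<le> s" for s using nle[OF that] by simp
    have "norm (X m - X n) < e" if "m \<ge> N" "n > m" for m n
    proof -
      have "norm ((X m - X N) - (X n - X N)) < e / 2 + e / 2"
        using norm_triangle_ineq4[of "X m - X N" "X n - X N"] N[of m] N[of n] that by linarith
      then show ?thesis by simp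
    qed
    then show "\<exists>M. \<forall>m\<ge>M. \<forall>n>m. dist (X m) (X n) < e" unfolding dist_norm by blast
  qed
  then obtain L where L: "X \<longlonglongrightarrow> L" using Cauchy_convergent_iff convergent_def by blast
  have XL: "qle (X r) (exp (d r) *\<^sub>R L)" for r
  proof (rule qle_limit)
    show "qle (X r) (exp (d r) *\<^sub>R X (s + r))" for s by (rule thompsonD(2)[OF nz X X le]) simp
    show "(\<lambda>s. exp (d r) *\<^sub>R X (s + r)) \<longlonglongrightarrow> exp (d r) *\<^sub>R L"
      using LIMSEQ_ignore_initial_segment[OF L] by (intro tendsto_intros)
    show "(\<lambda>s. X r) \<longlonglongrightarrow> X r" by simp
  qed
  have LX: "qle L (exp (d r) *\<^sub>R X r)" for r
  proof (rule qle_limit)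
    show "qle (X (s + r)) (exp (d r) *\<^sub>R X r)" for s by (rule thompsonD(1)[OF nz X X le]) simp
    show "(\<lambda>s. X (s + r)) \<longlonglongrightarrow> L" by (rule LIMSEQ_ignore_initial_segment[OF L])
    show "(\<lambda>s. exp (d r) *\<^sub>R X r) \<longlonglongrightarrow> exp (d r) *\<^sub>R X r" by simp
  qed
  have "L \<in> BH_sa" using L X BH_pos_sa by (auto simp: BH_sa_iff intro: BH_limit sadj_limit)
  \<comment> \<open>A positive multiple of \<open>X 0\<close> below the limit keeps the limit
    invertible.\<close>
  moreover have "qle (exp (- d 0) *\<^sub>R X 0) L"
    using qle_scaleR[OF _ XL[of 0], of "exp (- d 0)"] by (simp add: exp_minus)
  ultimately have Lpos: "L \<in> BH_pos" by (rule BH_pos_mono[OF BH_pos_scaleR[OF X exp_gt_zero]])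
  show ?thesis using that[OF Lpos] XL LX by (simp add: thompson_le_iff[OF nz X Lpos])
qed

declare sum.lessThan_Suc [simp del]

section \<open>Limits of averaging iterations\<close>

text \<open>An invariant under geometric means, omission of an entry and common limits. The harmonic
  bound is stated for inverses, where it is linear in \<open>opinv (A i)\<close>; the Thompson
  clause drives the convergence at the next level.\<close>

definition is_mean :: "nat \<Rightarrow> (nat \<Rightarrow> real) \<Rightarrow> ((nat \<Rightarrow> 'h::complex_hilbert oper) \<Rightarrow> 'h oper) \<Rightarrow> bool" where
  "is_mean n w F \<longleftrightarrow> (\<forall>A. (\<forall>i<n. A i \<in> BH_pos) \<longrightarrow>
     F A \<in> BH_pos \<and>
     qle (F A) (\<Sum>i<n. w i *\<^sub>R A i) \<and>
     qle (opinv (F A)) (\<Sum>i<n. w i *\<^sub>R opinv (A i)) \<and>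
     (\<forall>Z\<in>BH_pos. thompson (F A) Z \<le> (\<Sum>i<n. w i * thompson (A i) Z)))"

lemma is_meanD:
  assumes "is_mean n w F" "\<And>i. i < n \<Longrightarrow> A i \<in> BH_pos"
  shows "F A \<in> BH_pos" "qle (F A) (\<Sum>i<n. w i *\<^sub>R A i)"
    "qle (opinv (F A)) (\<Sum>i<n. w i *\<^sub>R opinv (A i))"
    "Z \<in> BH_pos \<Longrightarrow> thompson (F A) Z \<le> (\<Sum>i<n. w i * thompson (A i) Z)"
  using assms unfolding is_mean_def by auto

lemma is_mean_cong:
  assumes "\<And>i. i < n \<Longrightarrow> v i = w i"
  shows "is_mean n v F \<longleftrightarrow> is_mean n w F"
  using assms unfolding is_mean_def by simp

lemma sum_omit:
  assumes "i < Suc m"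
  shows "(\<Sum>j<m. omit i h j) = (\<Sum>j\<in>{..<Suc m} - {i}. h j)"
  by (rule sum.reindex_bij_witness[where i = "\<lambda>j. if j < i then j else j - 1" and j = "\<lambda>j. if j < i then j else Suc j"])
    (use assms in \<open>auto simp: omit_def split: if_splits\<close>)

text \<open>Giving the omitted entry weight 0 makes all maps of one iteration step means of the same
  tuple, so their weights form a square matrix.\<close>

lemma is_mean_omit:
  fixes G :: "(nat \<Rightarrow> 'h::complex_hilbert oper) \<Rightarrow> 'h oper"
  assumes G: "is_mean m u G" and i: "i < Suc m" and u: "\<And>j. j < m \<Longrightarrow> u j = omit i v j" and v: "v i = 0"
  shows "is_mean (Suc m) v (\<lambda>A. G (omit i A))"
  unfolding is_mean_def
proof (intro allI impI)
  fix A :: "nat \<Rightarrow> 'h oper"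
  assume A: "\<forall>i<Suc m. A i \<in> BH_pos"
  have pos: "omit i A j \<in> BH_pos" if "j < m" for j using A that by (simp add: omit_def)
  have drop: "sum h ({..<Suc m} - {i}) = sum h {..<Suc m}" if "h i = 0" for h :: "nat \<Rightarrow> 'b::comm_monoid_add"
    using i that by (intro sum.mono_neutral_left) auto
  have s1: "(\<Sum>j<m. u j *\<^sub>R g (omit i A j)) = (\<Sum>j<Suc m. v j *\<^sub>R g (A j))" for g :: "'h oper \<Rightarrow> 'h oper"
    using sum_omit[OF i, of "\<lambda>j. v j *\<^sub>R g (A j)"] drop[of "\<lambda>j. v j *\<^sub>R g (A j)"] v u
    by (simp add: omit_def if_distrib cong: if_cong sum.cong)
      (smt (verit) lessThan_iff sum.cong)
  have s2: "(\<Sum>j<m. u j * g (omit i A j)) = (\<Sum>j<Suc m. v j * g (A j))" for g :: "'h oper \<Rightarrow> real"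
    using sum_omit[OF i, of "\<lambda>j. v j * g (A j)"] drop[of "\<lambda>j. v j * g (A j)"] v u
    by (simp add: omit_def if_distrib cong: if_cong sum.cong)
      (smt (verit) lessThan_iff sum.cong)
  note D = is_meanD[where A = "omit i A", OF G pos]
  show "G (omit i A) \<in> BH_pos \<and> qle (G (omit i A)) (\<Sum>i<Suc m. v i *\<^sub>R A i) \<and>
      qle (opinv (G (omit i A))) (\<Sum>i<Suc m. v i *\<^sub>R opinv (A i)) \<and>
      (\<forall>Z\<in>BH_pos. thompson (G (omit i A)) Z \<le> (\<Sum>i<Suc m. v i * thompson (A i) Z))"
    unfolding s1[of "\<lambda>x. x", symmetric] s1[of opinv, symmetric] s2[of "\<lambda>x. thompson x Z" for Z, symmetric]
    using D by blast
qed

lemma is_mean_gmean: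
  fixes F G :: "(nat \<Rightarrow> 'h::complex_hilbert oper) \<Rightarrow> 'h oper"
  assumes nz: "\<exists>x::'h. x \<noteq> 0" and F: "is_mean n u F" and G: "is_mean n v G" and c: "0 \<le> c" "c \<le> 1"
  shows "is_mean n (\<lambda>j. (1 - c) * u j + c * v j) (\<lambda>A. gmean c (F A) (G A))"
  unfolding is_mean_def
proof (intro allI impI)
  fix A :: "nat \<Rightarrow> 'h oper"
  assume "\<forall>i<n. A i \<in> BH_pos"
  then have F': "F A \<in> BH_pos" "qle (F A) (\<Sum>i<n. u i *\<^sub>R A i)"
      "qle (opinv (F A)) (\<Sum>i<n. u i *\<^sub>R opinv (A i))"
      "\<And>Z. Z \<in> BH_pos \<Longrightarrow> thompson (F A) Z \<le> (\<Sum>i<n. u i * thompson (A i) Z)"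
    and G': "G A \<in> BH_pos" "qle (G A) (\<Sum>i<n. v i *\<^sub>R A i)"
      "qle (opinv (G A)) (\<Sum>i<n. v i *\<^sub>R opinv (A i))"
      "\<And>Z. Z \<in> BH_pos \<Longrightarrow> thompson (G A) Z \<le> (\<Sum>i<n. v i * thompson (A i) Z)"
    using is_meanD[OF F] is_meanD[OF G] by auto
  have split: "(\<Sum>i<n. ((1 - c) * u i + c * v i) *\<^sub>R g i) = (1 - c) *\<^sub>R (\<Sum>i<n. u i *\<^sub>R g i) + c *\<^sub>R (\<Sum>i<n. v i *\<^sub>R g i)"
    for g :: "nat \<Rightarrow> 'b::real_vector"
    by (simp add: scaleR_sum_right scaleR_add_left sum.distrib)
  have comb: "qle X ((1 - c) *\<^sub>R U + c *\<^sub>R V)"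
    if X: "qle X (((1 - c) * exp 0) *\<^sub>R P + (c * exp 0) *\<^sub>R Q)" and P: "qle P U" and Q: "qle Q V"
    for X P Q U V :: "'h oper"
  proof (rule qle_trans[OF X])
    show "qle (((1 - c) * exp 0) *\<^sub>R P + (c * exp 0) *\<^sub>R Q) ((1 - c) *\<^sub>R U + c *\<^sub>R V)"
      using c P Q by (simp add: qle_add qle_scaleR)
  qed
  \<comment> \<open>At zero parameters the tangent bounds are the plain arithmetic and harmonic
    bounds.\<close>
  have xy: "(1 - c) * 0 + c * 0 = 0" by simp
  have "qle (gmean c (F A) (G A)) (\<Sum>i<n. ((1 - c) * u i + c * v i) *\<^sub>R A i)"
    unfolding split by (rule comb[OF gmean_le[OF F'(1) G'(1) c xy] F'(2) G'(2)])
  moreover have "qle (opinv (gmean c (F A) (G A))) (\<Sum>i<n. ((1 - c) * u i + c * v i) *\<^sub>R opinv (A i))"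
    unfolding split by (rule comb[OF opinv_gmean_le[OF F'(1) G'(1) c xy] F'(3) G'(3)])
  moreover have "thompson (gmean c (F A) (G A)) Z \<le> (\<Sum>i<n. ((1 - c) * u i + c * v i) * thompson (A i) Z)"
    if Z: "Z \<in> BH_pos" for Z
  proof -
    have "thompson (gmean c (F A) (G A)) Z \<le> (1 - c) * thompson (F A) Z + c * thompson (G A) Z"
      by (rule thompson_gmean_le[OF nz F'(1) G'(1) Z c])
    also have "\<dots> \<le> (1 - c) * (\<Sum>i<n. u i * thompson (A i) Z) + c * (\<Sum>i<n. v i * thompson (A i) Z)"
      using c F'(4)[OF Z] G'(4)[OF Z] by (intro add_mono mult_left_mono) auto
    finally show ?thesis using split[of "\<lambda>i. thompson (A i) Z"] by simp
  qed
  ultimately show "gmean c (F A) (G A) \<in> BH_pos \<and>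
      qle (gmean c (F A) (G A)) (\<Sum>i<n. ((1 - c) * u i + c * v i) *\<^sub>R A i) \<and>
      qle (opinv (gmean c (F A) (G A))) (\<Sum>i<n. ((1 - c) * u i + c * v i) *\<^sub>R opinv (A i)) \<and>
      (\<forall>Z\<in>BH_pos. thompson (gmean c (F A) (G A)) Z \<le> (\<Sum>i<n. ((1 - c) * u i + c * v i) * thompson (A i) Z))"
    using gmean_pos[OF F'(1) G'(1) c] by blast
qed

lemma is_mean_proj:
  fixes k n :: nat
  assumes "k < n"
  shows "is_mean n (\<lambda>j. if j = k then 1 else 0) (\<lambda>A. A k)"
proof -
  have s1: "(\<Sum>i<n. (if i = k then 1 else 0) *\<^sub>R g i) = g k" for g :: "nat \<Rightarrow> 'b::real_vector"
    using assms by (simp add: if_distrib[of "\<lambda>c. c *\<^sub>R _"] cong: if_cong)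
  have s2: "(\<Sum>i<n. (if i = k then 1 else 0) * g i) = g k" for g :: "nat \<Rightarrow> real"
    using assms by (simp add: if_distrib[of "\<lambda>c. c * _"] cong: if_cong)
  show ?thesis using assms unfolding is_mean_def s1 s2 by (simp add: qle_refl)
qed

text \<open>
  Since \<open>thompson (F i A) Z\<close> is bounded by a weighted average of the \<open>thompson (A j) Z\<close>, using this
  bound in both arguments shows that one step multiplies the diameter of the tuple by at most \<open>q\<close>,
  because the diagonal terms of the resulting double average vanish.
\<close>

lemma is_mean_common_lim:
  fixes F :: "nat \<Rightarrow> (nat \<Rightarrow> 'h::complex_hilbert oper) \<Rightarrow> 'h oper"
  assumes nz: "\<exists>x::'h. x \<noteq> 0" and n: "0 < n"
    and F: "\<And>i. i < n \<Longrightarrow> is_mean n (v i) (F i)"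
    and v0: "\<And>i j. i < n \<Longrightarrow> j < n \<Longrightarrow> 0 \<le> v i j" and v1: "\<And>i. i < n \<Longrightarrow> (\<Sum>j<n. v i j) = 1"
    and w0: "\<And>i. i < n \<Longrightarrow> 0 \<le> w i" and w1: "(\<Sum>i<n. w i) = 1"
    and wv: "\<And>j. j < n \<Longrightarrow> (\<Sum>i<n. w i * v i j) = w j"
    and q: "0 \<le> q" "q < 1" "\<And>i k. i < n \<Longrightarrow> k < n \<Longrightarrow> 1 - q \<le> (\<Sum>j<n. v i j * v k j)"
  shows "is_mean n w (\<lambda>A. common_lim n (\<lambda>r. ((\<lambda>S i. F i S) ^^ r) A))"
  unfolding is_mean_def
proof (intro allI impI)
  fix A :: "nat \<Rightarrow> 'h oper"
  assume A: "\<forall>i<n. A i \<in> BH_pos"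
  define S where "S r = ((\<lambda>S i. F i S) ^^ r) A" for r
  have S0: "S 0 = A" and SS: "S (Suc r) i = F i (S r)" for r i by (simp_all add: S_def)
  have pos: "i < n \<Longrightarrow> S r i \<in> BH_pos" for r i
  proof (induction r arbitrary: i)
    case (Suc r)
    then show ?case unfolding SS using is_meanD(1)[OF F] by blast
  qed (use A S0 in simp)
  note FD = is_meanD[where A = "S r" for r, OF F pos]
  have avg_le: "(\<Sum>j<n. v i j * g j) \<le> c" if "i < n" "\<And>j. j < n \<Longrightarrow> g j \<le> c" for i c and g :: "nat \<Rightarrow> real"
  proof -
    have "(\<Sum>j<n. v i j * g j) \<le> (\<Sum>j<n. v i j * c)"
      using that v0 by (intro sum_mono mult_left_mono) auto
    then show ?thesis using v1[OF that(1)] by (simp add: sum_distrib_right[symmetric])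
  qed
  have step_le: "thompson (S (Suc r) i) Z \<le> (\<Sum>j<n. v i j * thompson (S r j) Z)" if "i < n" "Z \<in> BH_pos" for r i Z
    unfolding SS using FD(4)[OF that(1) _ that(2)] by simp
  \<comment> \<open>The sum of all initial distances, a crude bound for the diameter.\<close>
  define D where "D = (\<Sum>j<n. \<Sum>l<n. thompson (A j) (A l))"
  have diam: "thompson (S r i) (S r k) \<le> q ^ r * D" if "i < n" "k < n" for r i k
    using that
  proof (induction r arbitrary: i k)
    case 0
    have nn: "0 \<le> thompson (A j) (A l)" if "j < n" "l < n" for j l using thompson_nonneg[OF nz] A that by blast
    have "thompson (A i) (A k) \<le> (\<Sum>l<n. thompson (A i) (A l))"
      using 0 nn by (intro member_le_sum[of k "{..<n}"]) auto
    also have "\<dots> \<le> D" unfolding D_def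
      using 0 nn by (intro member_le_sum[of i "{..<n}" "\<lambda>j. \<Sum>l<n. thompson (A j) (A l)"]) (auto intro!: sum_nonneg)
    finally show ?case by (simp add: S0)
  next
    case (Suc r)
    define c where "c = q ^ r * D"
    have c0: "0 \<le> c"
      using Suc.IH[OF Suc.prems] thompson_nonneg[OF nz pos pos, OF Suc.prems, of r r] by (simp add: c_def)
    have cb: "thompson (S r l) (S r j) \<le> (if l = j then 0 else c)" if "l < n" "j < n" for l j
      using Suc.IH[OF that] thompson_self_le[OF nz pos[OF that(1)]] by (auto simp: c_def)
    have "thompson (S (Suc r) i) (S (Suc r) k) \<le> (\<Sum>j<n. v i j * thompson (S r j) (S (Suc r) k))"
      by (intro step_le Suc.prems pos)
    also have "\<dots> \<le> (\<Sum>j<n. v i j * ((1 - v k j) * c))"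
    proof (intro sum_mono mult_left_mono)
      fix j assume "j \<in> {..<n}"
      then have j: "j < n" by simp
      have "thompson (S r j) (S (Suc r) k) \<le> (\<Sum>l<n. v k l * thompson (S r l) (S r j))"
        using step_le[OF Suc.prems(2) pos[OF j], of r r] by (simp add: thompson_commute)
      also have "\<dots> \<le> (\<Sum>l<n. v k l * (if l = j then 0 else c))"
        using Suc.prems v0 cb j by (intro sum_mono mult_left_mono) auto
      also have "\<dots> = (\<Sum>l<n. v k l * c - (if l = j then v k l * c else 0))"
        by (intro sum.cong) auto
      also have "\<dots> = (1 - v k j) * c"
        using j v1[OF Suc.prems(2)] by (simp add: sum_subtractf sum_distrib_right[symmetric] left_diff_distrib)
      finally show "thompson (S r j) (S (Suc r) k) \<le> (1 - v k j) * c" .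
      show "0 \<le> v i j" using v0 Suc.prems j by blast
    qed
    also have "\<dots> = (1 - (\<Sum>j<n. v i j * v k j)) * c"
    proof -
      have "(\<Sum>j<n. v i j * ((1 - v k j) * c)) = (\<Sum>j<n. v i j * c - v i j * v k j * c)"
        by (intro sum.cong) (auto simp: algebra_simps)
      then show ?thesis
        using v1[OF Suc.prems(1)] by (simp add: sum_subtractf sum_distrib_right[symmetric] left_diff_distrib)
    qed
    also have "\<dots> \<le> q * c" using q(3)[OF Suc.prems] c0 by (intro mult_right_mono) auto
    finally show ?case by (simp add: c_def)
  qed
  \<comment> \<open>A bound for the distances to the fixed operator \<open>S r k\<close> survives
    averaging, so the diameter at time \<open>r\<close> controls all later entries.\<close>
  have cauchy: "thompson (S s i) (S r k) \<le> q ^ r * D" if "r \<le> s" "i < n" "k < n" for r s i k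
    using that
  proof (induction s arbitrary: i rule: dec_induct)
    case base
    then show ?case using diam by blast
  next
    case (step s)
    then show ?case
      using order_trans[OF step_le avg_le] pos by blast
  qed
  have qlim: "(\<lambda>r. q ^ r * D) \<longlonglongrightarrow> 0"
    using LIMSEQ_realpow_zero[OF q(1,2)] by (rule tendsto_mult_left_zero)
  obtain L where L: "L \<in> BH_pos" "\<And>r. thompson (S r 0) L \<le> q ^ r * D"
    using thompson_complete[of "\<lambda>r. S r 0", OF nz pos[OF n] cauchy[OF _ n n] qlim] by blast
  \<comment> \<open>Doubled because the limit is found for entry 0 and the other entries reach it
    through that one.\<close>
  define \<tau> where "\<tau> r = 2 * (q ^ r * D)" for r
  have \<tau>: "thompson (S r i) L \<le> \<tau> r" if "i < n" for r i
    using thompson_triangle[OF nz pos[OF that] pos[OF n] L(1), of r r] cauchy[OF order_refl that n, of r] L(2)[of r]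
    by (simp add: \<tau>_def)
  have \<tau>lim: "\<tau> \<longlonglongrightarrow> 0" unfolding \<tau>_def using tendsto_mult_right_zero[OF qlim, of 2] .
  have lim: "(\<lambda>r. thompson (S r i) L) \<longlonglongrightarrow> 0" if "i < n" for i
    using \<tau>[OF that] thompson_nonneg[OF nz pos[OF that] L(1)]
    by (intro tendsto_sandwich[OF _ _ tendsto_const \<tau>lim]) auto
  have eq: "common_lim n S = L"
    unfolding common_lim_def
  proof (rule the_equality)
    show "L \<in> BH_pos \<and> (\<forall>i<n. (\<lambda>r. thompson (S r i) L) \<longlonglongrightarrow> 0)" using L(1) lim by blast
  next
    fix L' assume L': "L' \<in> BH_pos \<and> (\<forall>i<n. (\<lambda>r. thompson (S r i) L') \<longlonglongrightarrow> 0)"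
    then have "(\<lambda>r. thompson (S r 0) L' + thompson (S r 0) L) \<longlonglongrightarrow> 0 + 0"
      using lim n by (intro tendsto_add) auto
    moreover have "thompson L' L \<le> thompson (S r 0) L' + thompson (S r 0) L" for r
      using thompson_triangle[OF nz _ pos[OF n] L(1), of L' r] L' by (simp add: thompson_commute)
    ultimately have "thompson L' L \<le> 0" by (auto intro: LIMSEQ_le_const)
    then show "L' = L" using thompson_le_0_eq[OF nz _ L(1)] L' by blast
  qed
  \<comment> \<open>\<open>w\<close> is stationary for the weight matrix \<open>v\<close>; hence the
    \<open>w\<close>-averages of the entries, of their inverses and of the distances to
    \<open>Z\<close> do not grow along the iteration.\<close>
  have swap: "(\<Sum>i<n. w i *\<^sub>R (\<Sum>j<n. v i j *\<^sub>R g j)) = (\<Sum>j<n. w j *\<^sub>R g j)" for g :: "nat \<Rightarrow> 'b::real_vector"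
  proof -
    have "(\<Sum>i<n. w i *\<^sub>R (\<Sum>j<n. v i j *\<^sub>R g j)) = (\<Sum>j<n. \<Sum>i<n. (w i * v i j) *\<^sub>R g j)"
      unfolding scaleR_sum_right by (subst sum.swap) simp
    also have "\<dots> = (\<Sum>j<n. w j *\<^sub>R g j)"
      using wv by (simp add: scaleR_sum_left[symmetric])
    finally show ?thesis .
  qed
  \<comment> \<open>Compare \<open>X\<close> with every entry up to a factor tending to 1, average
    with \<open>w\<close>, and use that the averages stay below \<open>Y\<close>.\<close>
  have limit_mean: "qle X Y"
    if X: "\<And>r i. i < n \<Longrightarrow> qle X (exp (\<tau> r) *\<^sub>R B r i)"
      and B: "\<And>r. qle (\<Sum>i<n. w i *\<^sub>R B r i) Y" for X Y :: "'h oper" and B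
  proof (rule qle_limit)
    fix r
    have "qle (\<Sum>i<n. w i *\<^sub>R X) (\<Sum>i<n. w i *\<^sub>R (exp (\<tau> r) *\<^sub>R B r i))"
      using w0 X by (intro qle_sum qle_scaleR) auto
    also have "(\<Sum>i<n. w i *\<^sub>R X) = X" by (simp add: scaleR_sum_left[symmetric] w1)
    also have "(\<Sum>i<n. w i *\<^sub>R (exp (\<tau> r) *\<^sub>R B r i)) = exp (\<tau> r) *\<^sub>R (\<Sum>i<n. w i *\<^sub>R B r i)"
      by (simp add: scaleR_sum_right mult.commute)
    finally show "qle X (exp (\<tau> r) *\<^sub>R Y)" using qle_trans qle_scaleR[OF _ B[of r], of "exp (\<tau> r)"] by simp
  next
    show "(\<lambda>r. X) \<longlonglongrightarrow> X" by simp
    have "(\<lambda>r. exp (\<tau> r) *\<^sub>R Y) \<longlonglongrightarrow> exp 0 *\<^sub>R Y" by (intro tendsto_intros \<tau>lim)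
    then show "(\<lambda>r. exp (\<tau> r) *\<^sub>R Y) \<longlonglongrightarrow> Y" by simp
  qed
  have "qle L (\<Sum>i<n. w i *\<^sub>R A i)"
  proof (rule limit_mean)
    show "qle L (exp (\<tau> r) *\<^sub>R S r i)" if "i < n" for r i
      using thompsonD(2)[OF nz pos[OF that] L(1) \<tau>[OF that]] .
    show "qle (\<Sum>i<n. w i *\<^sub>R S r i) (\<Sum>i<n. w i *\<^sub>R A i)" for r
    proof (induction r)
      case (Suc r)
      have "qle (\<Sum>i<n. w i *\<^sub>R S (Suc r) i) (\<Sum>i<n. w i *\<^sub>R (\<Sum>j<n. v i j *\<^sub>R S r j))"
        unfolding SS using w0 FD(2) by (intro qle_sum qle_scaleR) auto
      then show ?case unfolding swap using Suc qle_trans by blast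
    qed (simp add: S0 qle_refl)
  qed
  moreover have "qle (opinv L) (\<Sum>i<n. w i *\<^sub>R opinv (A i))"
  proof (rule limit_mean)
    show "qle (opinv L) (exp (\<tau> r) *\<^sub>R opinv (S r i))" if "i < n" for r i
      unfolding qle_opinv_scale_iff[OF L(1) pos[OF that] exp_gt_zero]
      using thompsonD(1)[OF nz pos[OF that] L(1) \<tau>[OF that]] .
    show "qle (\<Sum>i<n. w i *\<^sub>R opinv (S r i)) (\<Sum>i<n. w i *\<^sub>R opinv (A i))" for r
    proof (induction r)
      case (Suc r)
      have "qle (\<Sum>i<n. w i *\<^sub>R opinv (S (Suc r) i)) (\<Sum>i<n. w i *\<^sub>R (\<Sum>j<n. v i j *\<^sub>R opinv (S r j)))"
        unfolding SS using w0 FD(3) by (intro qle_sum qle_scaleR) auto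
      then show ?case unfolding swap using Suc qle_trans by blast
    qed (simp add: S0 qle_refl)
  qed
  moreover have "thompson L Z \<le> (\<Sum>i<n. w i * thompson (A i) Z)" if Z: "Z \<in> BH_pos" for Z
  proof -
    have dec: "(\<Sum>i<n. w i * thompson (S r i) Z) \<le> (\<Sum>i<n. w i * thompson (A i) Z)" for r
    proof (induction r)
      case (Suc r)
      have "(\<Sum>i<n. w i * thompson (S (Suc r) i) Z) \<le> (\<Sum>i<n. w i * (\<Sum>j<n. v i j * thompson (S r j) Z))"
        using w0 step_le[OF _ Z] by (intro sum_mono mult_left_mono) auto
      then show ?case using Suc swap[of "\<lambda>j. thompson (S r j) Z"] by simp
    qed (simp add: S0)
    have "thompson L Z \<le> \<tau> r + (\<Sum>i<n. w i * thompson (A i) Z)" for r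
    proof -
      have "thompson L Z = (\<Sum>i<n. w i * thompson L Z)" by (simp add: sum_distrib_right[symmetric] w1)
      also have "\<dots> \<le> (\<Sum>i<n. w i * (\<tau> r + thompson (S r i) Z))"
      proof (intro sum_mono mult_left_mono)
        fix i assume "i \<in> {..<n}"
        then have i: "i < n" by simp
        show "thompson L Z \<le> \<tau> r + thompson (S r i) Z"
          using thompson_triangle[OF nz L(1) pos[OF i] Z, of r] \<tau>[OF i, of r] thompson_commute[of L "S r i"] by simp
      qed (use w0 in auto)
      also have "\<dots> = \<tau> r + (\<Sum>i<n. w i * thompson (S r i) Z)"
        by (simp add: distrib_left sum.distrib sum_distrib_right[symmetric] w1)
      finally show ?thesis using dec[of r] by simp
    qed
    moreover have "(\<lambda>r. \<tau> r + (\<Sum>i<n. w i * thompson (A i) Z)) \<longlonglongrightarrow> 0 + (\<Sum>i<n. w i * thompson (A i) Z)"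
      by (intro tendsto_intros \<tau>lim)
    ultimately show ?thesis by (auto intro: LIMSEQ_le_const)
  qed
  ultimately show "common_lim n (\<lambda>r. ((\<lambda>S i. F i S) ^^ r) A) \<in> BH_pos \<and>
      qle (common_lim n (\<lambda>r. ((\<lambda>S i. F i S) ^^ r) A)) (\<Sum>i<n. w i *\<^sub>R A i) \<and>
      qle (opinv (common_lim n (\<lambda>r. ((\<lambda>S i. F i S) ^^ r) A))) (\<Sum>i<n. w i *\<^sub>R opinv (A i)) \<and>
      (\<forall>Z\<in>BH_pos. thompson (common_lim n (\<lambda>r. ((\<lambda>S i. F i S) ^^ r) A)) Z \<le> (\<Sum>i<n. w i * thompson (A i) Z))"
    unfolding S_def[symmetric] eq using L(1) by blast
qed

section \<open>The ALM and BMP means\<close>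

lemma is_mean_gmean2:
  assumes nz: "\<exists>x::'h::complex_hilbert. x \<noteq> 0" and c: "0 \<le> c" "c \<le> 1"
  shows "is_mean 2 (\<lambda>j. if j = 0 then 1 - c else c) (\<lambda>A :: nat \<Rightarrow> 'h oper. gmean c (A 0) (A 1))"
proof (rule iffD1[OF is_mean_cong is_mean_gmean[OF nz is_mean_proj[of 0] is_mean_proj[of 1] c]])
  show "(1 - c) * (if i = 0 then 1 else 0) + c * (if i = 1 then 1 else 0) = (if i = 0 then 1 - c else c)"
    if "i < 2" for i :: nat using that by (auto simp: less_2_cases_iff)
qed simp_all

lemma is_mean_alm:
  assumes nz: "\<exists>x::'h::complex_hilbert. x \<noteq> 0"
  shows "is_mean (Suc (Suc m)) (\<lambda>_. 1 / real (Suc (Suc m))) (alm (Suc (Suc m)) :: (nat \<Rightarrow> 'h oper) \<Rightarrow> _)"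
proof (induction m)
  case 0
  have "is_mean 2 (\<lambda>_. 1/2) (\<lambda>A :: nat \<Rightarrow> 'h oper. gmean (1/2) (A 0) (A 1))"
    by (rule iffD1[OF is_mean_cong is_mean_gmean2[OF nz, of "1/2"]]) auto
  moreover have "(\<lambda>A :: nat \<Rightarrow> 'h oper. gmean (1/2) (A 0) (A 1)) = alm (Suc (Suc 0))" by (simp add: fun_eq_iff)
  ultimately show ?case by (simp add: numeral_2_eq_2)
next
  case (Suc m)
  let ?n = "Suc (Suc (Suc m))" and ?k = "real (Suc (Suc m))"
  define v where "v i j = (if j = i then 0 else 1 / ?k)" for i j :: nat
  have eq: "alm ?n = (\<lambda>A :: nat \<Rightarrow> 'h oper. common_lim ?n (\<lambda>r. ((\<lambda>S i. alm (Suc (Suc m)) (omit i S)) ^^ r) A))"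
    by (simp add: fun_eq_iff)
  have card_rm: "card ({..<?n} - {i}) = Suc (Suc m)" if "i < ?n" for i using that by simp
  have v1: "(\<Sum>j<?n. v i j) = 1" if "i < ?n" for i
  proof -
    have "(\<Sum>j<?n. v i j) = (\<Sum>j\<in>{..<?n} - {i}. 1 / ?k)"
      by (intro sum.mono_neutral_cong_right) (auto simp: v_def)
    then show ?thesis using card_rm[OF that] by simp
  qed
  have v_sym: "v i j = v j i" for i j by (simp add: v_def)
  \<comment> \<open>There are at least three indices, so two rows that each omit one index share a
    third, where both have weight \<open>1 / ?k\<close>.\<close>
  have overlap: "1 / ?k\<^sup>2 \<le> (\<Sum>j<?n. v i j * v k j)" if "i < ?n" "k < ?n" for i k
  proof -
    have "\<exists>j<?n. j \<noteq> i \<and> j \<noteq> k"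
    proof -
      have "card {i, k} \<le> 2" by (simp add: card_insert_if)
      then have "\<not> {..<?n} \<subseteq> {i, k}" using card_mono[of "{i, k}" "{..<?n}"] by auto
      then show ?thesis by auto
    qed
    then obtain j where j: "j < ?n" "j \<noteq> i" "j \<noteq> k" by blast
    have "v i j * v k j \<le> (\<Sum>j<?n. v i j * v k j)"
      using j by (intro member_le_sum[of j "{..<?n}"]) (auto simp: v_def)
    then show ?thesis using j by (simp add: v_def power2_eq_square)
  qed
  show ?case
    unfolding eq
  proof (rule is_mean_common_lim[OF nz, where v = v and q = "1 - 1 / ?k\<^sup>2"])
    show "is_mean ?n (v i) (\<lambda>S :: nat \<Rightarrow> 'h oper. alm (Suc (Suc m)) (omit i S))" if "i < ?n" for i
      by (rule is_mean_omit[OF Suc.IH that]) (auto simp: v_def omit_def)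
    \<comment> \<open>The weight matrix is symmetric: its columns sum to 1 like its rows, and the
      uniform weights are stationary.\<close>
    show "(\<Sum>i<?n. 1 / real ?n * v i j) = 1 / real ?n" if "j < ?n" for j
      using v1[OF that] by (simp add: v_sym[of _ j] sum_divide_distrib[symmetric])
    have "1 \<le> ?k\<^sup>2" by (rule one_le_power) simp
    then show "0 \<le> 1 - 1 / ?k\<^sup>2" by (simp add: divide_le_eq_1 del: of_nat_Suc)
    show "(\<Sum>i<?n. 1 / real ?n) = 1" by simp
  qed (use v1 overlap in \<open>auto simp: v_def\<close>)
qed

text \<open>After a BMP step every entry carries the same weights:
  \<open>(1 - w i) * (w j / (1 - w i)) = w j\<close> for \<open>j \<noteq> i\<close>, and
  \<open>w i\<close> for the entry itself. All rows of the weight matrix equal \<open>w\<close>, and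
  their overlap is the sum of the squares.\<close>

lemma is_mean_bmp:
  assumes nz: "\<exists>x::'h::complex_hilbert. x \<noteq> 0" and w: "w \<in> weights (Suc (Suc m))"
  shows "is_mean (Suc (Suc m)) w (bmp (Suc (Suc m)) w :: (nat \<Rightarrow> 'h oper) \<Rightarrow> _)"
  using w
proof (induction m arbitrary: w)
  case 0
  then have w: "w 0 = 1 - w 1" "0 \<le> w 1" "w 1 \<le> 1" by (auto simp: weights_def sum.lessThan_Suc)
  have "is_mean 2 w (\<lambda>A :: nat \<Rightarrow> 'h oper. gmean (w 1) (A 0) (A 1))"
    by (rule iffD1[OF is_mean_cong is_mean_gmean2[OF nz w(2,3)]]) (auto simp: w less_2_cases_iff)
  moreover have "(\<lambda>A :: nat \<Rightarrow> 'h oper. gmean (w 1) (A 0) (A 1)) = bmp (Suc (Suc 0)) w" by (simp add: fun_eq_iff)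
  ultimately show ?case by (simp add: numeral_2_eq_2)
next
  case (Suc m)
  let ?n = "Suc (Suc (Suc m))"
  have w0: "0 < w i" "w i < 1" if "i < ?n" for i using Suc.prems that by (auto simp: weights_def)
  have w1: "(\<Sum>i<?n. w i) = 1" using Suc.prems by (simp add: weights_def)
  have rest: "(\<Sum>k\<in>{..<?n} - {i}. w k) = 1 - w i" if "i < ?n" for i
    using w1 that sum.remove[of "{..<?n}" i w] by simp
  have ow: "omit_weight ?n i w \<in> weights (Suc (Suc m))" if i: "i < ?n" for i
  proof -
    have pos: "0 < omit_weight ?n i w j" if "j < Suc (Suc m)" for j
      using that i w0 unfolding omit_weight_def rest[OF i] by (simp add: omit_def)
    have sum1: "(\<Sum>j<Suc (Suc m). omit_weight ?n i w j) = 1"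
      using sum_omit[OF i, of w] rest[OF i] w0[OF i]
      unfolding omit_weight_def by (simp add: sum_divide_distrib[symmetric])
    have "omit_weight ?n i w j < 1" if j: "j < Suc (Suc m)" for j
    proof -
      \<comment> \<open>At least two weights remain after the omission; the positive weight at a
        second index \<open>l\<close> keeps the one at \<open>j\<close> below 1.\<close>
      define l where "l = (if j = 0 then 1 else 0 :: nat)"
      have l: "l < Suc (Suc m)" "l \<noteq> j" by (auto simp: l_def)
      have "omit_weight ?n i w j + omit_weight ?n i w l = (\<Sum>k\<in>{j, l}. omit_weight ?n i w k)" using l by simp
      also have "\<dots> \<le> (\<Sum>k<Suc (Suc m). omit_weight ?n i w k)"
        using l j pos by (intro sum_mono2) (auto intro: less_imp_le)
      finally show ?thesis using sum1 pos[OF l(1)] by linarith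
    qed
    then show ?thesis using pos sum1 by (simp add: weights_def)
  qed
  define F where "F i A = gmean (w i) (bmp (Suc (Suc m)) (omit_weight ?n i w) (omit i A)) (A i)"
    for i and A :: "nat \<Rightarrow> 'h oper"
  have eq: "bmp ?n w = (\<lambda>A :: nat \<Rightarrow> 'h oper. common_lim ?n (\<lambda>r. ((\<lambda>S i. F i S) ^^ r) A))"
    by (simp add: fun_eq_iff F_def)
  define q where "q = 1 - (\<Sum>j<?n. w j * w j)"
  have sq: "0 < (\<Sum>j<?n. w j * w j)" "(\<Sum>j<?n. w j * w j) \<le> 1"
  proof -
    show "0 < (\<Sum>j<?n. w j * w j)" using w0 by (intro sum_pos) auto
    have "(\<Sum>j<?n. w j * w j) \<le> (\<Sum>j<?n. w j)"
      using w0 by (intro sum_mono mult_left_le) (auto intro: less_imp_le)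
    then show "(\<Sum>j<?n. w j * w j) \<le> 1" using w1 by simp
  qed
  show ?case
    unfolding eq
  proof (rule is_mean_common_lim[OF nz, where v = "\<lambda>_. w" and q = q])
    show "is_mean ?n w (F i)" if i: "i < ?n" for i
    proof -
      define v where "v j = (if j = i then 0 else w j / (1 - w i))" for j
      have "is_mean ?n v (\<lambda>A :: nat \<Rightarrow> 'h oper. bmp (Suc (Suc m)) (omit_weight ?n i w) (omit i A))"
        by (rule is_mean_omit[OF Suc.IH[OF ow[OF i]] i])
          (use rest[OF i] in \<open>auto simp: v_def omit_def omit_weight_def\<close>)
      from is_mean_gmean[OF nz this is_mean_proj[OF i], of "w i"]
      have "is_mean ?n (\<lambda>j. (1 - w i) * v j + w i * (if j = i then 1 else 0)) (F i)"
        unfolding F_def using w0[OF i] by simp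
      then show ?thesis
        by (rule iffD1[OF is_mean_cong, rotated]) (use w0[OF i] in \<open>auto simp: v_def\<close>)
    qed
    show "(\<Sum>i<?n. w i * w j) = w j" for j
      using w1 by (simp add: sum_distrib_right[symmetric])
    show "0 \<le> q" "q < 1" using sq by (simp_all add: q_def)
    show "1 - q \<le> (\<Sum>j<?n. w j * w j)" by (simp add: q_def)
  qed (use w0 w1 in \<open>auto intro: less_imp_le\<close>)
qed

section \<open>Comparison of the means with the identity\<close>

text \<open>From left to right by \<open>1 + t \<le> exp t\<close>; conversely
  \<open>X \<le> 0\<close> puts the spectrum where \<open>exp\<close> is at most 1.\<close>

lemma fcalc_exp_le_id_iff:
  fixes X :: "'h::complex_hilbert oper"
  assumes X: "X \<in> BH_sa"
  shows "fcalc exp X \<in> BH_sa" "fcalc exp X \<preceq> id_blinfun \<longleftrightarrow> qle X 0"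
proof -
  have sX: "sadj X" using X by (simp add: BH_sa_iff)
  obtain a b where ab: "rspec X \<subseteq> {a..b}" using rspec_bounds[OF sX qle_norm(2) qle_norm(1)] by blast
  have "continuous_on {a..b} (exp :: real \<Rightarrow> real)" by (intro continuous_intros)
  then obtain E where E: "fc exp X E" using fc_exists[OF sX ab] by blast
  then have fE: "fcalc exp X = E" by (rule fcalc_eqI[OF X])
  show sa: "fcalc exp X \<in> BH_sa" unfolding fE by (rule fc_BH_sa[OF X E])
  have "qle E id_blinfun \<longleftrightarrow> qle X 0"
  proof
    assume le: "qle E id_blinfun"
    have "qle (bpoly [:1, 1:] X) E" by (rule fc_mono[OF sX fc_poly E]) simp
    then have "qle (bpoly [:1, 1:] X) id_blinfun" using le by (rule qle_trans)
    then show "qle X 0" by (simp add: qle_def blinfun.bilinear_simps inner_simps)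
  next
    assume "qle X 0"
    then have "rspec X \<subseteq> {- norm X..0}" by (intro rspec_bounds[OF sX qle_norm(2)]) simp
    then have "qle E (bpoly [:1:] X)" by (intro fc_mono[OF sX E fc_poly]) auto
    then show "qle E id_blinfun" by (simp add: qle_def blinfun.bilinear_simps)
  qed
  then show "fcalc exp X \<preceq> id_blinfun \<longleftrightarrow> qle X 0"
    using ole_iff[OF sa BH_sa_intros(2)] by (simp add: fE)
qed

lemma fcalc_ln_bounds:
  fixes A :: "'h::complex_hilbert oper"
  assumes A: "A \<in> BH_pos"
  shows "fcalc ln A \<in> BH_sa" "qle (fcalc ln A) (A - id_blinfun)" "qle (id_blinfun - opinv A) (fcalc ln A)"
proof -
  note sA = BH_pos_sadj[OF A]
  obtain a b where ab: "0 < a" "rspec A \<subseteq> {a..b}" using BH_pos_rspec[OF A] .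
  have "continuous_on {0<..} (ln :: real \<Rightarrow> real)" by (intro continuous_intros) auto
  note L = fcalc_pos_domain[OF A this]
  show "fcalc ln A \<in> BH_sa" by (rule L)
  have "qle (fcalc ln A) (bpoly [:- 1, 1:] A)"
    using ab ln_le_minus_one by (intro fc_mono[OF sA L(1) fc_poly]) force
  then show "qle (fcalc ln A) (A - id_blinfun)" by (simp add: qle_def blinfun.bilinear_simps)
  have lb: "1 + (- 1) * (1 / t) \<le> ln t" if "t > 0" for t :: real
    using ln_le_minus_one[of "1 / t"] that by (simp add: ln_div)
  have "qle (1 *\<^sub>R id_blinfun + (- 1) *\<^sub>R opinv A) (fcalc ln A)"
    using ab lb by (intro fc_mono[OF sA fc_affine[OF fc_opinv[OF A]] L(1)]) force
  then show "qle (id_blinfun - opinv A) (fcalc ln A)" by simp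
qed

section \<open>Finite powers of a Hilbert space\<close>

text \<open>Sequences that vanish from \<open>n\<close> on: the powers for all \<open>n\<close>
  share the type \<open>nat \<Rightarrow> 'h\<close>, about which the monotonicity hypothesis
  speaks.\<close>

definition hsn :: "nat \<Rightarrow> (nat \<Rightarrow> 'h::complex_hilbert) hspace" where
  "hsn n = \<lparr>hcarrier = {x. \<forall>i\<ge>n. x i = 0}, hadd = (\<lambda>x y i. x i + y i), hzero = (\<lambda>i. 0),
     hscale = (\<lambda>a x i. a *\<^sub>C x i), hinner = (\<lambda>x y. \<Sum>i<n. cinner (x i) (y i))\<rparr>"

lemma hsn_simps [simp]:
  "hcarrier (hsn n) = {x. \<forall>i\<ge>n. x i = 0}" "hadd (hsn n) = (\<lambda>x y i. x i + y i)" "hzero (hsn n) = (\<lambda>i. 0)"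
  "hscale (hsn n) = (\<lambda>a x i. a *\<^sub>C x i)" "hinner (hsn n) = (\<lambda>x y. \<Sum>i<n. cinner (x i) (y i))"
  by (simp_all add: hsn_def)

lemma scaleC_one_minus: "1 *\<^sub>C x = x" "(- 1) *\<^sub>C x = - x" "0 *\<^sub>C x = 0" for x :: "'h::complex_hilbert"
  using scaleC_of_real[of 1 x] scaleC_of_real[of "- 1" x] scaleC_of_real[of 0 x] by simp_all

lemma scaleC_diff_left: "(a - b) *\<^sub>C x = a *\<^sub>C x - b *\<^sub>C (x :: 'h::complex_hilbert)"
  using scaleC_add_left[of "a - b" b x] by simp

lemma hsub_hsn [simp]: "hsub (hsn n) x y = (\<lambda>i. x i - y i)"
  by (simp add: hsub_def scaleC_one_minus)

lemma hnorm_hsn: "hnorm (hsn n) x = sqrt (\<Sum>i<n. (norm (x i))\<^sup>2)"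
  by (simp add: hnorm_def Re_cinner power2_norm_eq_inner)

lemma norm_le_hnorm_hsn: "i < n \<Longrightarrow> norm (x i) \<le> hnorm (hsn n) x"
  unfolding hnorm_hsn
  by (intro real_le_rsqrt member_le_sum[of i "{..<n}" "\<lambda>i. (norm (x i))\<^sup>2"]) auto

lemma hnorm_hsn_mono:
  assumes "0 \<le> C" "\<And>i. i < n \<Longrightarrow> norm (y i) \<le> C * norm (x i)"
  shows "hnorm (hsn n) y \<le> C * hnorm (hsn n) x"
proof -
  have "(\<Sum>i<n. (norm (y i))\<^sup>2) \<le> (\<Sum>i<n. (C * norm (x i))\<^sup>2)"
    using assms by (intro sum_mono power_mono) auto
  also have "\<dots> = C\<^sup>2 * (\<Sum>i<n. (norm (x i))\<^sup>2)" by (simp add: power_mult_distrib sum_distrib_left)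
  finally have "sqrt (\<Sum>i<n. (norm (y i))\<^sup>2) \<le> sqrt (C\<^sup>2 * (\<Sum>i<n. (norm (x i))\<^sup>2))" by simp
  then show ?thesis using assms(1) by (simp add: hnorm_hsn real_sqrt_mult)
qed

lemma cinner_zero: "cinner x 0 = 0" "cinner 0 x = 0"
  using cinner_scaleC_right[of x 0 0] cinner_commute[of 0 x] by (simp_all add: scaleC_one_minus)

lemma complex_hilbert_space_hsn: "complex_hilbert_space (hsn n :: (nat \<Rightarrow> 'h::complex_hilbert) hspace)"
proof
  fix X :: "nat \<Rightarrow> nat \<Rightarrow> 'h"
  assume X: "\<And>m. X m \<in> hcarrier (hsn n)"
    and C: "\<And>e. 0 < e \<Longrightarrow> \<exists>N. \<forall>i\<ge>N. \<forall>j\<ge>N. hnorm (hsn n) (hsub (hsn n) (X i) (X j)) < e"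
  have "\<exists>l. (\<lambda>m. X m i) \<longlonglongrightarrow> l" if i: "i < n" for i
  proof -
    have "Cauchy (\<lambda>m. X m i)"
      unfolding Cauchy_def dist_norm
    proof (intro allI impI)
      fix e :: real assume "e > 0"
      then obtain N where N: "\<And>k j. k \<ge> N \<Longrightarrow> j \<ge> N \<Longrightarrow> hnorm (hsn n) (\<lambda>i. X k i - X j i) < e"
        using C[of e] by auto
      have "norm (X k i - X j i) < e" if "k \<ge> N" "j \<ge> N" for k j
        using norm_le_hnorm_hsn[OF i, of "\<lambda>i. X k i - X j i"] N[OF that] by linarith
      then show "\<exists>M. \<forall>m\<ge>M. \<forall>n\<ge>M. norm (X m i - X n i) < e" by blast
    qed
    then show ?thesis using Cauchy_convergent_iff convergent_def by blast
  qed
  then obtain l where l: "\<And>i. i < n \<Longrightarrow> (\<lambda>m. X m i) \<longlonglongrightarrow> l i" by metis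
  define x where "x i = (if i < n then l i else 0)" for i
  have "(\<lambda>m. sqrt (\<Sum>i<n. (norm (X m i - x i))\<^sup>2)) \<longlonglongrightarrow> sqrt (\<Sum>i<n. (norm (x i - x i))\<^sup>2)"
    using l by (intro tendsto_intros) (auto simp: x_def)
  then have "(\<lambda>m. hnorm (hsn n) (hsub (hsn n) (X m) x)) \<longlonglongrightarrow> 0" by (simp add: hnorm_hsn)
  then show "\<exists>x\<in>hcarrier (hsn n). (\<lambda>m. hnorm (hsn n) (hsub (hsn n) (X m) x)) \<longlonglongrightarrow> 0"
    by (intro bexI[of _ x]) (auto simp: x_def)
next
  fix x :: "nat \<Rightarrow> 'h"
  assume x: "x \<in> hcarrier (hsn n)" "x \<noteq> hzero (hsn n)"
  then obtain i where i: "x i \<noteq> 0" by (auto simp: fun_eq_iff)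
  then have "i < n" using x(1) by (simp) (meson not_le)
  then have "0 < (\<Sum>i<n. inner (x i) (x i))" using i by (intro sum_pos2[of _ i]) auto
  then show "0 < Re (hinner (hsn n) x x)" by (simp add: Re_cinner)
next
  fix x y :: "nat \<Rightarrow> 'h"
  show "hinner (hsn n) x y = cnj (hinner (hsn n) y x)"
    by (simp, rule sum.cong[OF refl], rule cinner_commute)
qed (auto simp: scaleC_add_right scaleC_add_left scaleC_scaleC add.assoc add.commute scaleC_simps scaleC_one_minus
    cinner_add_right cinner_scaleC_right sum.distrib sum_distrib_left)

section \<open>Diagonal operators on the power\<close>

definition dop :: "nat \<Rightarrow> (nat \<Rightarrow> 'h::complex_hilbert oper) \<Rightarrow> (nat \<Rightarrow> 'h) \<Rightarrow> nat \<Rightarrow> 'h" where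
  "dop n A = (\<lambda>x\<in>{x. \<forall>i\<ge>n. x i = 0}. \<lambda>i. if i < n then A i (x i) else 0)"

lemma dop_apply: "x \<in> {x. \<forall>i\<ge>n. x i = 0} \<Longrightarrow> dop n A x = (\<lambda>i. if i < n then A i (x i) else 0)"
  by (simp add: dop_def)

lemma dop_bounded:
  assumes "\<And>i. i < n \<Longrightarrow> A i \<in> BH"
  shows "dop n A \<in> bounded_ops (hsn n)"
proof -
  have "hnorm (hsn n) (dop n A x) \<le> (\<Sum>i<n. norm (A i)) * hnorm (hsn n) x" if "x \<in> {x. \<forall>i\<ge>n. x i = 0}" for x
  proof (rule hnorm_hsn_mono)
    fix i assume i: "i < n"
    have "norm (A i (x i)) \<le> norm (A i) * norm (x i)" by (rule norm_blinfun)
    also have "\<dots> \<le> (\<Sum>i<n. norm (A i)) * norm (x i)"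
      using i by (intro mult_right_mono member_le_sum) auto
    finally show "norm (dop n A x i) \<le> (\<Sum>i<n. norm (A i)) * norm (x i)" using i by (simp add: dop_apply[OF that])
  qed (auto intro: sum_nonneg)
  then show ?thesis
    using assms unfolding bounded_ops_def
    by (auto simp: dop_def BH_iff blinfun.bilinear_simps fun_eq_iff scaleC_simps)
qed

lemma dop_selfadjoint:
  assumes "\<And>i. i < n \<Longrightarrow> A i \<in> BH_sa"
  shows "dop n A \<in> selfadjoint_ops (hsn n)"
proof -
  have "cinner (A i x) y = cinner x (A i y)" if "i < n" for i x y
    using assms[OF that] by (auto simp: BH_sa_def selfadjoint_ops_def)
  then show ?thesis
    using dop_bounded[of n A] assms unfolding selfadjoint_ops_def by (auto simp: dop_def BH_sa_iff)
qed

lemma dop_spectrum: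
  fixes A :: "nat \<Rightarrow> 'h::complex_hilbert oper"
  assumes "\<And>i. i < n \<Longrightarrow> spec (A i) \<subseteq> S"
  shows "spectrum (hsn n) (dop n A) \<subseteq> S"
proof
  fix c assume c: "c \<in> spectrum (hsn n) (dop n A)"
  show "c \<in> S"
  proof (rule ccontr)
    assume "c \<notin> S"
    have "\<exists>B\<in>BH. \<forall>x. B (A i x - c *\<^sub>C x) = x \<and> A i (B x) - c *\<^sub>C B x = x" if "i < n" for i
    proof -
      have "c \<notin> spec (A i)" using assms that \<open>c \<notin> S\<close> by blast
      then obtain R where R: "R \<in> bounded_ops hs" "\<And>x. R (A i x - c *\<^sub>C x) = x \<and> A i (R x) - c *\<^sub>C R x = x"
        by (auto simp: spec_def spectrum_def)
      from R(1) show ?thesis using R(2) by (elim bounded_ops_blinfun) blast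
    qed
    then obtain B where B: "\<And>i. i < n \<Longrightarrow> B i \<in> BH"
      "\<And>i x. i < n \<Longrightarrow> B i (A i x - c *\<^sub>C x) = x \<and> A i (B i x) - c *\<^sub>C B i x = x" by metis
    have "dop n B \<in> bounded_ops (hsn n)" using B(1) by (rule dop_bounded)
    moreover have "\<forall>x\<in>hcarrier (hsn n). dop n B (hsub (hsn n) (dop n A x) (hscale (hsn n) c x)) = x \<and>
        hsub (hsn n) (dop n A (dop n B x)) (hscale (hsn n) c (dop n B x)) = x"
      using B(2) by (auto simp: dop_def scaleC_simps fun_eq_iff)
    ultimately show False using c unfolding spectrum_def by blast
  qed
qed

lemma dop_poly:
  fixes A :: "nat \<Rightarrow> 'h::complex_hilbert oper"
  assumes "x \<in> {x. \<forall>i\<ge>n. x i = 0}"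
  shows "poly_op (hsn n) p (dop n A) x = dop n (\<lambda>i. bpoly p (A i)) x"
proof (induction p)
  case 0
  then show ?case using assms by (auto simp: poly_op_0 dop_def)
next
  case (pCons a p)
  then show ?case
    using assms by (auto simp: poly_op_pCons dop_def fun_eq_iff blinfun.bilinear_simps scaleC_of_real)
qed

text \<open>The calculus of a diagonal operator takes one polynomial sequence for all blocks, so
  \<open>p\<close> converges on a set \<open>S\<close> that contains every spectrum instead of being
  chosen block by block.\<close>

lemma dop_fcalc:
  fixes A :: "nat \<Rightarrow> 'h::complex_hilbert oper"
  assumes A: "\<And>i. i < n \<Longrightarrow> A i \<in> BH" and S: "\<And>i. i < n \<Longrightarrow> spec (A i) \<subseteq> of_real ` S"
    and p: "uniform_limit S (\<lambda>m. poly (p m)) f sequentially"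
    and F: "\<And>i. i < n \<Longrightarrow> (\<lambda>m. bpoly (p m) (A i)) \<longlonglongrightarrow> F i"
  shows "is_fcalc (hsn n) f (dop n A) (dop n F)"
proof -
  have "dop n F \<in> bounded_ops (hsn n)" using A BH_limit[OF BH_bpoly F] by (intro dop_bounded) blast
  moreover have "{t. of_real t \<in> spectrum (hsn n) (dop n A)} \<subseteq> S"
    using dop_spectrum[of n A, OF S] by auto
  moreover have "op_tendsto (hsn n) (\<lambda>m. poly_op (hsn n) (p m) (dop n A)) (dop n F)"
    unfolding op_tendsto_def
  proof (intro allI impI)
    fix e :: real assume e: "e > 0"
    have "\<forall>\<^sub>F m in sequentially. \<forall>i\<in>{..<n}. dist (bpoly (p m) (A i)) (F i) < e"
      using F e by (intro eventually_ball_finite) (auto simp: tendsto_iff)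
    then show "\<forall>\<^sub>F m in sequentially. \<forall>x\<in>hcarrier (hsn n).
        hnorm (hsn n) (hsub (hsn n) (poly_op (hsn n) (p m) (dop n A) x) (dop n F x)) \<le> e * hnorm (hsn n) x"
    proof eventually_elim
      case (elim m)
      show ?case
      proof
        fix x :: "nat \<Rightarrow> 'h" assume "x \<in> hcarrier (hsn n)"
        then have x: "x \<in> {x. \<forall>i\<ge>n. x i = 0}" by simp
        have "norm (bpoly (p m) (A i) (x i) - F i (x i)) \<le> e * norm (x i)" if "i < n" for i
        proof -
          have "norm ((bpoly (p m) (A i) - F i) (x i)) \<le> norm (bpoly (p m) (A i) - F i) * norm (x i)"
            by (rule norm_blinfun)
          also have "\<dots> \<le> e * norm (x i)"
            using elim that by (intro mult_right_mono) (auto simp: dist_norm intro: less_imp_le)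
          finally show ?thesis by (simp add: blinfun.bilinear_simps)
        qed
        then show "hnorm (hsn n) (hsub (hsn n) (poly_op (hsn n) (p m) (dop n A) x) (dop n F x)) \<le> e * hnorm (hsn n) x"
          unfolding dop_poly[OF x] dop_apply[OF x] using e by (intro hnorm_hsn_mono) auto
      qed
    qed
  qed
  ultimately show ?thesis using uniform_limit_on_subset[OF p] unfolding is_fcalc_def by blast
qed

text \<open>
  For a real unit vector \<open>u\<close>, \<open>pop n u a b\<close> is \<open>a P + b (1 - P)\<close> with \<open>P = V V\<^sup>*\<close> the projection onto the
  range of the isometry \<open>V v = (u 0 v, \<dots>, u (n - 1) v)\<close>, and \<open>vadj n u\<close> is \<open>V\<^sup>*\<close>.
\<close>

definition vadj :: "nat \<Rightarrow> (nat \<Rightarrow> real) \<Rightarrow> (nat \<Rightarrow> 'h::complex_hilbert) \<Rightarrow> 'h" where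
  "vadj n u x = (\<Sum>i<n. u i *\<^sub>R x i)"

definition pop :: "nat \<Rightarrow> (nat \<Rightarrow> real) \<Rightarrow> complex \<Rightarrow> complex \<Rightarrow> (nat \<Rightarrow> 'h::complex_hilbert) \<Rightarrow> nat \<Rightarrow> 'h" where
  "pop n u a b = (\<lambda>x\<in>{x. \<forall>i\<ge>n. x i = 0}. \<lambda>i. if i < n then b *\<^sub>C x i + (a - b) *\<^sub>C (u i *\<^sub>R vadj n u x) else 0)"

lemma pop_apply:
  "x \<in> {x. \<forall>i\<ge>n. x i = 0} \<Longrightarrow>
    pop n u a b x = (\<lambda>i. if i < n then b *\<^sub>C x i + (a - b) *\<^sub>C (u i *\<^sub>R vadj n u x) else 0)"
  by (simp add: pop_def)

lemma vadj_add: "vadj n u (\<lambda>i. x i + y i) = vadj n u x + vadj n u y"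
  by (simp add: vadj_def scaleR_add_right sum.distrib)

lemma vadj_scaleC: "vadj n u (\<lambda>i. a *\<^sub>C x i) = a *\<^sub>C vadj n u x"
  by (simp add: vadj_def linear_sum[OF bounded_linear.linear[OF bounded_linear_scaleC]] scaleC_simps)

lemma vadj_cong: "(\<And>i. i < n \<Longrightarrow> x i = y i) \<Longrightarrow> vadj n u x = vadj n u y"
  by (simp add: vadj_def)

lemma vadj_const:
  assumes "(\<Sum>i<n. (u i)\<^sup>2) = 1"
  shows "vadj n u (\<lambda>i. u i *\<^sub>R v) = v"
  using assms by (simp add: vadj_def scaleR_sum_left[symmetric] power2_eq_square)

lemma vadj_pop:
  assumes u: "(\<Sum>i<n. (u i)\<^sup>2) = 1" and x: "x \<in> {x. \<forall>i\<ge>n. x i = 0}"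
  shows "vadj n u (pop n u a b x) = a *\<^sub>C vadj n u x"
proof -
  have "vadj n u (pop n u a b x) = vadj n u (\<lambda>i. b *\<^sub>C x i + (a - b) *\<^sub>C (u i *\<^sub>R vadj n u x))"
    using x by (intro vadj_cong) (simp add: pop_apply)
  also have "\<dots> = b *\<^sub>C vadj n u x + (a - b) *\<^sub>C vadj n u x"
    by (simp add: vadj_add vadj_scaleC vadj_const[OF u])
  finally show ?thesis by (simp add: scaleC_add_left[symmetric])
qed

lemma pop_carrier: "x \<in> {x. \<forall>i\<ge>n. x i = 0} \<Longrightarrow> pop n u a b x \<in> {x. \<forall>i\<ge>n. x i = 0}"
  by (simp add: pop_def)

text \<open>P and 1 - P are complementary projections, so their coefficients multiply separately.
  Polynomials and resolvents of \<open>pop\<close> both reduce to this rule.\<close>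

lemma pop_pop:
  assumes u: "(\<Sum>i<n. (u i)\<^sup>2) = 1" and x: "x \<in> {x. \<forall>i\<ge>n. x i = 0}"
  shows "pop n u a b (pop n u c d x) = pop n u (a * c) (b * d) x"
proof -
  have coeff: "b * (c - d) + (a - b) * c = a * c - b * d" by (simp add: algebra_simps)
  have "pop n u a b (pop n u c d x) i = pop n u (a * c) (b * d) x i" for i
  proof (cases "i < n")
    case True
    then have "pop n u a b (pop n u c d x) i =
        b *\<^sub>C (d *\<^sub>C x i + (c - d) *\<^sub>C (u i *\<^sub>R vadj n u x)) + (a - b) *\<^sub>C (u i *\<^sub>R (c *\<^sub>C vadj n u x))"
      by (subst pop_apply[OF pop_carrier[OF x]]) (simp add: vadj_pop[OF u x], simp add: pop_apply[OF x])
    also have "\<dots> = (b * d) *\<^sub>C x i + (b * (c - d) + (a - b) * c) *\<^sub>C (u i *\<^sub>R vadj n u x)"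
      by (simp add: scaleC_add_right scaleC_scaleC scaleC_add_left scaleC_simps(4)[symmetric])
    finally show ?thesis using True by (simp add: coeff pop_apply[OF x])
  next
    case False
    then show ?thesis by (subst pop_apply[OF pop_carrier[OF x]]) (simp add: pop_apply[OF x])
  qed
  then show ?thesis ..
qed

lemma pop_one: "x \<in> {x. \<forall>i\<ge>n. x i = 0} \<Longrightarrow> pop n u 1 1 x = x"
  by (auto simp: pop_apply scaleC_one_minus fun_eq_iff)

lemma pop_affine:
  "x \<in> {x. \<forall>i\<ge>n. x i = 0} \<Longrightarrow> (\<lambda>i. pop n u a b x i - c *\<^sub>C x i) = pop n u (a - c) (b - c) x"
  by (auto simp: pop_apply fun_eq_iff scaleC_diff_left scaleC_simps)

lemma pop_bounded: "pop n u a b \<in> bounded_ops (hsn n)"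
proof -
  define C where "C = cmod b + cmod (a - b) * ((\<Sum>i<n. \<bar>u i\<bar>) * (\<Sum>i<n. \<bar>u i\<bar>))"
  have s0: "0 \<le> (\<Sum>i<n. \<bar>u i\<bar>)" by (intro sum_nonneg) auto
  have C0: "0 \<le> C" using s0 by (simp add: C_def)
  \<comment> \<open>Each of the \<open>n\<close> coordinates is at most \<open>C\<close> times the
    norm of \<open>x\<close>, whence the factor \<open>sqrt n\<close>.\<close>
  have "hnorm (hsn n) (pop n u a b x) \<le> (sqrt n * C) * hnorm (hsn n) x" if x: "x \<in> {x. \<forall>i\<ge>n. x i = 0}" for x
  proof -
    define N where "N = hnorm (hsn n) x"
    have N0: "0 \<le> N" by (simp add: N_def hnorm_hsn sum_nonneg)
    have v: "norm (vadj n u x) \<le> (\<Sum>i<n. \<bar>u i\<bar>) * N"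
      unfolding vadj_def sum_distrib_right
      by (rule sum_norm_le) (auto simp: N_def intro!: mult_left_mono norm_le_hnorm_hsn)
    have "norm (pop n u a b x i) \<le> C * N" if i: "i < n" for i
    proof -
      have ui: "\<bar>u i\<bar> \<le> (\<Sum>i<n. \<bar>u i\<bar>)" using i by (intro member_le_sum) auto
      have "norm (pop n u a b x i) \<le> cmod b * norm (x i) + cmod (a - b) * (\<bar>u i\<bar> * norm (vadj n u x))"
        using i by (simp add: pop_apply[OF x] norm_triangle_le norm_scaleC)
      also have "\<dots> \<le> cmod b * N + cmod (a - b) * ((\<Sum>i<n. \<bar>u i\<bar>) * ((\<Sum>i<n. \<bar>u i\<bar>) * N))"
        using i v ui s0 by (intro add_mono mult_left_mono mult_mono) (auto simp: N_def norm_le_hnorm_hsn)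
      finally show ?thesis by (simp add: C_def algebra_simps)
    qed
    then have "(\<Sum>i<n. (norm (pop n u a b x i))\<^sup>2) \<le> (\<Sum>i<n. (C * N)\<^sup>2)"
      by (intro sum_mono power_mono) auto
    then have "hnorm (hsn n) (pop n u a b x) \<le> sqrt (real n * (C * N)\<^sup>2)" by (simp add: hnorm_hsn)
    then show ?thesis using C0 N0 by (simp add: real_sqrt_mult N_def)
  qed
  then have bd: "\<exists>C. \<forall>x\<in>hcarrier (hsn n). hnorm (hsn n) (pop n u a b x) \<le> C * hnorm (hsn n) x" by auto
  have pie: "pop n u a b \<in> hcarrier (hsn n) \<rightarrow>\<^sub>E hcarrier (hsn n)" by (auto simp: pop_def)
  have add: "\<forall>x\<in>hcarrier (hsn n). \<forall>y\<in>hcarrier (hsn n).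
      pop n u a b (hadd (hsn n) x y) = hadd (hsn n) (pop n u a b x) (pop n u a b y)"
    by (auto simp: pop_apply vadj_add scaleC_add_right scaleR_add_right fun_eq_iff)
  have scale: "\<forall>z. \<forall>x\<in>hcarrier (hsn n).
      pop n u a b (hscale (hsn n) z x) = hscale (hsn n) z (pop n u a b x)"
    by (auto simp: pop_apply vadj_scaleC scaleC_add_right scaleC_scaleC scaleC_simps(4)[symmetric] scaleC_simps(2)
        mult.commute fun_eq_iff)
  show ?thesis unfolding bounded_ops_def mem_Collect_eq by (intro conjI pie add scale bd)
qed

lemma cinner_add_left: "cinner (x + y) z = cinner x z + cinner y (z :: 'h::complex_hilbert)"
  using cinner_add_right[of z x y] cinner_commute by (metis complex_cnj_add)

lemma cinner_scaleR: "cinner (r *\<^sub>R x) y = of_real r * cinner x y" "cinner x (r *\<^sub>R y) = of_real r * cinner x y"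
proof -
  show right: "cinner x (r *\<^sub>R y) = of_real r * cinner x y" for x y :: 'a
    using cinner_scaleC_right[of x "of_real r" y] by (simp add: scaleC_of_real)
  have "cinner (r *\<^sub>R x) y = cnj (cinner y (r *\<^sub>R x))" by (rule cinner_commute)
  also have "\<dots> = of_real r * cnj (cinner y x)" by (simp add: right)
  also have "cnj (cinner y x) = cinner x y" by (rule cinner_commute[symmetric])
  finally show "cinner (r *\<^sub>R x) y = of_real r * cinner x y" .
qed

lemma cinner_vadj:
  "cinner (vadj n u x) y = (\<Sum>i<n. of_real (u i) * cinner (x i) y)"
  "cinner y (vadj n u x) = (\<Sum>i<n. of_real (u i) * cinner y (x i))"
proof -
  have s: "cinner (\<Sum>i<n. g i) y = (\<Sum>i<n. cinner (g i) y)" "cinner y (\<Sum>i<n. g i) = (\<Sum>i<n. cinner y (g i))"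
    for g :: "nat \<Rightarrow> 'a"
    by (induction n) (simp_all add: sum.lessThan_Suc cinner_zero cinner_add_left cinner_add_right)
  show "cinner (vadj n u x) y = (\<Sum>i<n. of_real (u i) * cinner (x i) y)"
    "cinner y (vadj n u x) = (\<Sum>i<n. of_real (u i) * cinner y (x i))"
    unfolding vadj_def s by (simp_all add: cinner_scaleR)
qed

lemma pop_inner:
  assumes "x \<in> {x. \<forall>i\<ge>n. x i = 0}"
  shows "(\<Sum>i<n. cinner (y i) (pop n u (of_real a) (of_real b) x i)) =
      of_real b * (\<Sum>i<n. cinner (y i) (x i)) + of_real (a - b) * cinner (vadj n u y) (vadj n u x)"
    and "(\<Sum>i<n. cinner (pop n u (of_real a) (of_real b) x i) (y i)) =
      of_real b * (\<Sum>i<n. cinner (x i) (y i)) + of_real (a - b) * cinner (vadj n u x) (vadj n u y)"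
proof -
  have r: "pop n u (of_real a) (of_real b) x i = b *\<^sub>R x i + (a - b) *\<^sub>R (u i *\<^sub>R vadj n u x)" if "i < n" for i
    using that scaleC_of_real[of "a - b" "u i *\<^sub>R vadj n u x"] by (simp add: pop_apply[OF assms] scaleC_of_real)
  show "(\<Sum>i<n. cinner (y i) (pop n u (of_real a) (of_real b) x i)) =
      of_real b * (\<Sum>i<n. cinner (y i) (x i)) + of_real (a - b) * cinner (vadj n u y) (vadj n u x)"
    by (simp add: r cinner_add_right cinner_scaleR cinner_vadj(1) sum.distrib sum_distrib_left mult_ac
        del: scaleR_scaleR)
  show "(\<Sum>i<n. cinner (pop n u (of_real a) (of_real b) x i) (y i)) =
      of_real b * (\<Sum>i<n. cinner (x i) (y i)) + of_real (a - b) * cinner (vadj n u x) (vadj n u y)"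
    by (simp add: r cinner_add_left cinner_scaleR cinner_vadj(2) sum.distrib sum_distrib_left mult_ac
        del: scaleR_scaleR)
qed

lemma pop_selfadjoint:
  "(pop n u (of_real a) (of_real b) :: (nat \<Rightarrow> 'a::complex_hilbert) \<Rightarrow> _) \<in> selfadjoint_ops (hsn n)"
proof -
  have "(\<Sum>i<n. cinner (pop n u (of_real a) (of_real b) x i) (y i)) =
      (\<Sum>i<n. cinner (x i) (pop n u (of_real a) (of_real b) y i))"
    if "x \<in> {x. \<forall>i\<ge>n. x i = 0}" "y \<in> {x. \<forall>i\<ge>n. x i = 0}" for x y :: "nat \<Rightarrow> 'a"
    unfolding pop_inner(2)[OF that(1)] pop_inner(1)[OF that(2)] by (rule refl)
  then show ?thesis using pop_bounded by (auto simp: selfadjoint_ops_def)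
qed

lemma pop_spectrum:
  assumes u: "(\<Sum>i<n. (u i)\<^sup>2) = 1"
  shows "spectrum (hsn n) (pop n u a b :: (nat \<Rightarrow> 'h::complex_hilbert) \<Rightarrow> _) \<subseteq> {a, b}"
proof
  fix c assume c: "c \<in> spectrum (hsn n) (pop n u a b :: (nat \<Rightarrow> 'h) \<Rightarrow> _)"
  show "c \<in> {a, b}"
  proof (rule ccontr)
    assume "c \<notin> {a, b}"
    then have ne: "a - c \<noteq> 0" "b - c \<noteq> 0" by auto
    define R :: "(nat \<Rightarrow> 'h) \<Rightarrow> _" where "R = pop n u (1 / (a - c)) (1 / (b - c))"
    have "R \<in> bounded_ops (hsn n)" unfolding R_def by (rule pop_bounded)
    moreover have "\<forall>x\<in>hcarrier (hsn n). R (hsub (hsn n) (pop n u a b x) (hscale (hsn n) c x)) = x \<and>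
        hsub (hsn n) (pop n u a b (R x)) (hscale (hsn n) c (R x)) = x"
    proof
      fix x :: "nat \<Rightarrow> 'h" assume "x \<in> hcarrier (hsn n)"
      then have x: "x \<in> {x. \<forall>i\<ge>n. x i = 0}" by simp
      have Rx: "R x \<in> {x. \<forall>i\<ge>n. x i = 0}" unfolding R_def by (rule pop_carrier[OF x])
      have "R (pop n u (a - c) (b - c) x) = x"
        unfolding R_def pop_pop[OF u x] using ne by (simp add: pop_one[OF x])
      moreover have "pop n u (a - c) (b - c) (R x) = x"
        unfolding R_def pop_pop[OF u x] using ne by (simp add: pop_one[OF x])
      ultimately show "R (hsub (hsn n) (pop n u a b x) (hscale (hsn n) c x)) = x \<and>
        hsub (hsn n) (pop n u a b (R x)) (hscale (hsn n) c (R x)) = x"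
        using pop_affine[OF x, of u a b c] pop_affine[OF Rx, of u a b c] by simp
    qed
    ultimately show False using c unfolding spectrum_def by blast
  qed
qed

lemma pop_poly:
  assumes u: "(\<Sum>i<n. (u i)\<^sup>2) = 1" and x: "x \<in> {x. \<forall>i\<ge>n. x i = 0}"
  shows "poly_op (hsn n) p (pop n u (of_real a) (of_real b)) x = pop n u (of_real (poly p a)) (of_real (poly p b)) x"
proof (induction p)
  case 0
  then show ?case by (auto simp: poly_op_0 pop_apply[OF x] scaleC_one_minus)
next
  case (pCons c p)
  then have "poly_op (hsn n) (pCons c p) (pop n u (of_real a) (of_real b)) x =
      (\<lambda>i. of_real c *\<^sub>C x i + pop n u (of_real (a * poly p a)) (of_real (b * poly p b)) x i)"
    by (simp add: poly_op_pCons pop_pop[OF u x])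
  also have "\<dots> = (\<lambda>i. pop n u (of_real (a * poly p a)) (of_real (b * poly p b)) x i - (- of_real c) *\<^sub>C x i)"
    by (simp add: scaleC_minus_left add.commute)
  also have "\<dots> = pop n u (of_real (poly (pCons c p) a)) (of_real (poly (pCons c p) b)) x"
    unfolding pop_affine[OF x] by (simp add: add.commute)
  finally show ?case .
qed

lemma linear_interpolation:
  fixes f :: "real \<Rightarrow> real"
  obtains p :: "real poly" where "poly p a = f a" "poly p b = f b"
proof (cases "a = b")
  case True
  then show ?thesis using that[of "[:f a:]"] by simp
next
  case False
  define k where "k = (f b - f a) / (b - a)"
  have "k * (b - a) = f b - f a" using False by (simp add: k_def)
  then show ?thesis using that[of "[:f a - k * a, k:]"] by (simp add: algebra_simps)
qed

text \<open>There are at most two spectral points, so on the spectrum \<open>f\<close> is an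
  interpolating polynomial. This makes operator monotonicity usable before \<open>f\<close> is known
  to be continuous.\<close>

lemma pop_fcalc:
  assumes u: "(\<Sum>i<n. (u i)\<^sup>2) = 1"
  shows "is_fcalc (hsn n) f (pop n u (of_real a) (of_real b) :: (nat \<Rightarrow> 'h::complex_hilbert) \<Rightarrow> _)
      (pop n u (of_real (f a)) (of_real (f b)))"
proof -
  obtain p where p: "poly p a = f a" "poly p b = f b" by (rule linear_interpolation)
  have sp: "{t. of_real t \<in> spectrum (hsn n) (pop n u (of_real a) (of_real b) :: (nat \<Rightarrow> 'h) \<Rightarrow> _)} \<subseteq> {a, b}"
    using pop_spectrum[OF u, of "of_real a" "of_real b"] by auto
  have "uniform_limit {a, b} (\<lambda>m. poly p) f sequentially"
    using p by (auto simp: uniform_limit_iff)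
  moreover have "op_tendsto (hsn n) (\<lambda>m. poly_op (hsn n) p (pop n u (of_real a) (of_real b) :: (nat \<Rightarrow> 'h) \<Rightarrow> _))
      (pop n u (of_real (f a)) (of_real (f b)))"
    unfolding op_tendsto_def by (auto simp: pop_poly[OF u] p hnorm_hsn sum_nonneg)
  ultimately show ?thesis
    unfolding is_fcalc_def using pop_bounded uniform_limit_on_subset[OF _ sp]
    by (intro conjI exI[of _ "\<lambda>_. p"]) blast+
qed

lemma op_le_hsn_iff:
  assumes A: "A \<in> selfadjoint_ops (hsn n)" and B: "B \<in> selfadjoint_ops (hsn n)"
  shows "op_le (hsn n) A B \<longleftrightarrow>
    (\<forall>x\<in>{x. \<forall>i\<ge>n. x i = 0}. Re (\<Sum>i<n. cinner (x i) (A x i)) \<le> Re (\<Sum>i<n. cinner (x i) (B x i)))"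
proof -
  have real: "Im (\<Sum>i<n. cinner (x i) (C x i)) = 0"
    if C: "C \<in> selfadjoint_ops (hsn n)" and x: "x \<in> {x. \<forall>i\<ge>n. x i = 0}" for C x
  proof -
    have "(\<Sum>i<n. cinner (x i) (C x i)) = (\<Sum>i<n. cinner (C x i) (x i))"
      using C x by (auto simp: selfadjoint_ops_def)
    also have "\<dots> = (\<Sum>i<n. cnj (cinner (x i) (C x i)))" by (rule sum.cong[OF refl], rule cinner_commute)
    also have "\<dots> = cnj (\<Sum>i<n. cinner (x i) (C x i))" by simp
    finally have "(\<Sum>i<n. cinner (x i) (C x i)) = cnj (\<Sum>i<n. cinner (x i) (C x i))" .
    moreover have "Im z = 0" if "z = cnj z" for z using that by (simp add: complex_eq_iff)
    ultimately show ?thesis by blast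
  qed
  have diff: "cinner x (y - z) = cinner x y - cinner x z" for x y z :: 'a
    using cinner_add_right[of x "y - z" z] by simp
  show ?thesis
    unfolding op_le_def using real[OF A] real[OF B]
    by (auto simp: complex_nonneg_Reals_iff diff sum_subtractf)
qed

text \<open>Comparing \<open>diag (A 0, \<dots>)\<close> with \<open>y P + \<mu> (1 - P)\<close> in \<open>H\<^sup>n\<close> is how operator monotonicity is applied.\<close>

lemma operator_monotone_dominate:
  fixes A F :: "nat \<Rightarrow> 'h::complex_hilbert oper"
  assumes f: "operator_monotone_on TYPE(nat \<Rightarrow> 'h) {0<..} f"
    and A: "\<And>i. i < n \<Longrightarrow> A i \<in> BH_sa" and S: "\<And>i. i < n \<Longrightarrow> rspec (A i) \<subseteq> S" "S \<subseteq> {0<..}"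
    and p: "uniform_limit S (\<lambda>m. poly (p m)) f sequentially"
    and F: "\<And>i. i < n \<Longrightarrow> (\<lambda>m. bpoly (p m) (A i)) \<longlonglongrightarrow> F i"
    and u: "(\<Sum>i<n. (u i)\<^sup>2) = 1" and y: "0 < y" and \<mu>: "0 < \<mu>"
    and le: "\<And>x. (\<Sum>i<n. inner (x i) (A i (x i))) \<le>
        \<mu> * (\<Sum>i<n. inner (x i) (x i)) + (y - \<mu>) * inner (vadj n u x) (vadj n u x)"
  shows "(\<Sum>i<n. inner (x i) (F i (x i))) \<le>
        f \<mu> * (\<Sum>i<n. inner (x i) (x i)) + (f y - f \<mu>) * inner (vadj n u x) (vadj n u x)"
proof -
  define Z :: "real \<Rightarrow> real \<Rightarrow> (nat \<Rightarrow> 'h) \<Rightarrow> nat \<Rightarrow> 'h" where "Z a b = pop n u (of_real a) (of_real b)" for a b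
  have FB: "F i \<in> BH_sa" if "i < n" for i
    using fc_BH_sa[OF A[OF that], of f] F[OF that] uniform_limit_on_subset[OF p S(1)[OF that]] by (auto simp: fc_def)
  have Rd: "Re (\<Sum>i<n. cinner (x i) (dop n G x i)) = (\<Sum>i<n. inner (x i) (G i (x i)))"
    if "x \<in> {x. \<forall>i\<ge>n. x i = 0}" for x and G :: "nat \<Rightarrow> 'h oper"
    by (simp add: dop_apply[OF that] Re_cinner)
  have Rp: "Re (\<Sum>i<n. cinner (x i) (Z a b x i)) =
      b * (\<Sum>i<n. inner (x i) (x i)) + (a - b) * inner (vadj n u x) (vadj n u x)"
    if "x \<in> {x. \<forall>i\<ge>n. x i = 0}" for x a b
    unfolding Z_def pop_inner(1)[OF that] by (simp add: Re_cinner del: of_real_diff)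
  have Zsa: "Z a b \<in> selfadjoint_ops (hsn n)" for a b unfolding Z_def by (rule pop_selfadjoint)
  have specA: "spec (A i) \<subseteq> of_real ` S" if "i < n" for i
    by (rule spec_subset[OF A[OF that] S(1)[OF that]])
  have dA: "dop n A \<in> selfadjoint_ops (hsn n)" and dF: "dop n F \<in> selfadjoint_ops (hsn n)"
    using A FB dop_selfadjoint by blast+
  have "op_le (hsn n) (dop n A) (Z y \<mu>)"
    unfolding op_le_hsn_iff[OF dA Zsa] using le by (intro ballI) (simp only: Rd Rp)
  moreover have "spectrum (hsn n) (dop n A) \<subseteq> of_real ` {0<..}"
    using dop_spectrum[of n A, OF specA] S(2) by blast
  moreover have "spectrum (hsn n) (Z y \<mu>) \<subseteq> of_real ` {0<..}"
    using pop_spectrum[OF u, of "of_real y" "of_real \<mu>"] y \<mu> unfolding Z_def by auto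
  moreover have "is_fcalc (hsn n) f (dop n A) (dop n F)"
    by (rule dop_fcalc[OF _ specA p F]) (use A BH_sa_iff in blast)
  moreover have "is_fcalc (hsn n) f (Z y \<mu>) (Z (f y) (f \<mu>))" unfolding Z_def by (rule pop_fcalc[OF u])
  ultimately have "op_le (hsn n) (dop n F) (Z (f y) (f \<mu>))"
    using f complex_hilbert_space_hsn dA Zsa unfolding operator_monotone_on_def by blast
  then have concl: "(\<Sum>i<n. inner (x i) (F i (x i))) \<le>
        f \<mu> * (\<Sum>i<n. inner (x i) (x i)) + (f y - f \<mu>) * inner (vadj n u x) (vadj n u x)"
    if "x \<in> {x. \<forall>i\<ge>n. x i = 0}" for x
    unfolding op_le_hsn_iff[OF dF Zsa]
    using that by (elim ballE[of _ _ x]) (simp_all only: Rd Rp simp_thms)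
  \<comment> \<open>\<open>x\<close> may be nonzero from \<open>n\<close> on and so lie outside the
    carrier; truncation leaves the sums unchanged.\<close>
  define x' where "x' i = (if i < n then x i else 0)" for i
  have "vadj n u x' = vadj n u x" by (rule vadj_cong) (simp add: x'_def)
  then show ?thesis using concl[of x'] by (simp add: x'_def)
qed

section \<open>Monotonicity on two-by-two matrices\<close>

text \<open>
  With \<open>c\<^sup>2 = p\<close> and \<open>s\<^sup>2 = q\<close>, rotating \<open>diag (a, b)\<close> by the angle with cosine \<open>c\<close> gives diagonal entries
  \<open>p a + q b\<close> and \<open>q a + p b\<close> and off-diagonal entry \<open>c s (b - a)\<close>; the conditions say that the rotated
  matrix is at most \<open>diag (y, \<mu>)\<close>.
\<close>

definition rot_le :: "real \<Rightarrow> real \<Rightarrow> real \<Rightarrow> real \<Rightarrow> real \<Rightarrow> real \<Rightarrow> bool" where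
  "rot_le p q a b y \<mu> \<longleftrightarrow> p * a + q * b \<le> y \<and> q * a + p * b \<le> \<mu> \<and>
     p * q * (b - a)\<^sup>2 \<le> (y - (p * a + q * b)) * (\<mu> - (q * a + p * b))"

definition rot_monotone :: "(real \<Rightarrow> real) \<Rightarrow> bool" where
  "rot_monotone f \<longleftrightarrow> (\<forall>p q a b y \<mu>. 0 \<le> p \<and> 0 \<le> q \<and> p + q = 1 \<and> 0 < a \<and> 0 < b \<and> 0 < y \<and> 0 < \<mu> \<and>
     rot_le p q a b y \<mu> \<longrightarrow> rot_le p q (f a) (f b) (f y) (f \<mu>))"

lemma rot_monotoneD:
  assumes "rot_monotone f" "rot_le p q a b y \<mu>" "0 \<le> p" "0 \<le> q" "p + q = 1" "0 < a" "0 < b" "0 < y" "0 < \<mu>"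
  shows "p * f a + q * f b \<le> f y" "q * f a + p * f b \<le> f \<mu>"
    "p * q * (f b - f a)\<^sup>2 \<le> (f y - (p * f a + q * f b)) * (f \<mu> - (q * f a + p * f b))"
  using assms unfolding rot_monotone_def rot_le_def by blast+

lemma psd2_discriminant:
  fixes Y N d :: real
  assumes "\<And>\<alpha> \<beta>. 0 \<le> Y * \<alpha>\<^sup>2 - 2 * d * \<alpha> * \<beta> + N * \<beta>\<^sup>2"
  shows "0 \<le> Y" "0 \<le> N" "d\<^sup>2 \<le> Y * N"
proof -
  show Y: "0 \<le> Y" using assms[of 1 0] by simp
  show "0 \<le> N" using assms[of 0 1] by simp
  show "d\<^sup>2 \<le> Y * N"
  proof (cases "Y = 0")
    case True
    have "d = 0"
    proof (rule ccontr)
      assume "d \<noteq> 0"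
      \<comment> \<open>At this point the form takes the value -1.\<close>
      then show False using assms[of "(N + 1) / (2 * d)" 1] True by simp
    qed
    then show ?thesis using True by simp
  next
    case False
    then have "0 < Y" using Y by simp
    have "0 \<le> Y * (Y * N - d\<^sup>2)"
      using assms[of d Y] by (simp add: power2_eq_square algebra_simps)
    then show ?thesis using \<open>0 < Y\<close> by (simp add: zero_le_mult_iff)
  qed
qed

lemma psd2_inner:
  fixes \<alpha> \<beta> :: "'a::real_inner"
  assumes "0 \<le> Y" "0 \<le> N" "d\<^sup>2 \<le> Y * N"
  shows "0 \<le> Y * inner \<alpha> \<alpha> - 2 * d * inner \<alpha> \<beta> + N * inner \<beta> \<beta>"
proof -
  have "\<bar>d\<bar> \<le> sqrt Y * sqrt N"
    using assms real_sqrt_le_mono[OF assms(3)] by (simp add: real_sqrt_mult)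
  then have "\<bar>d * inner \<alpha> \<beta>\<bar> \<le> (sqrt Y * sqrt N) * (norm \<alpha> * norm \<beta>)"
    unfolding abs_mult using Cauchy_Schwarz_ineq2 assms by (intro mult_mono) auto
  then have "2 * d * inner \<alpha> \<beta> \<le> 2 * (sqrt Y * norm \<alpha>) * (sqrt N * norm \<beta>)" by (simp add: mult_ac)
  also have "\<dots> \<le> (sqrt Y * norm \<alpha>)\<^sup>2 + (sqrt N * norm \<beta>)\<^sup>2" by (rule sum_squares_bound)
  also have "\<dots> = Y * inner \<alpha> \<alpha> + N * inner \<beta> \<beta>"
    using assms by (simp add: power_mult_distrib power2_norm_eq_inner)
  finally show ?thesis by simp
qed

text \<open>Scalars act on H as multiples of the identity, so the matrices in question are a
  diagonal operator and a \<open>pop\<close> operator on the square of H, with unit vector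
  \<open>(c, s)\<close>. Testing with multiples of one vector of norm 1 reads the scalar matrix
  inequality back.\<close>

lemma operator_monotone_rot:
  assumes nz: "\<exists>x::'h::complex_hilbert. x \<noteq> 0"
    and f: "operator_monotone_on TYPE(nat \<Rightarrow> 'h) {0<..} f"
  shows "rot_monotone f"
  unfolding rot_monotone_def
proof (intro allI impI, elim conjE)
  fix p q a b y \<mu> :: real
  assume pq: "0 \<le> p" "0 \<le> q" "p + q = 1" and pos: "0 < a" "0 < b" "0 < y" "0 < \<mu>"
    and rot: "rot_le p q a b y \<mu>"
  define c s where "c = sqrt p" and "s = sqrt q"
  have cs: "c * c = p" "s * s = q" using pq by (simp_all add: c_def s_def)
  define u where "u i = (if i = 0 then c else s)" for i :: nat
  define A where "A g i = (if i = 0 then g a else g b) *\<^sub>R (id_blinfun :: 'h oper)" for g and i :: nat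
  have sum2: "(\<Sum>i<2. h i) = h 0 + h 1" for h :: "nat \<Rightarrow> 'b::comm_monoid_add"
    by (simp add: numeral_2_eq_2 sum.lessThan_Suc)
  have u1: "(\<Sum>i<2. (u i)\<^sup>2) = 1" using pq cs by (simp add: sum2 u_def power2_eq_square)
  obtain P where P: "poly P a = f a" "poly P b = f b" by (rule linear_interpolation)
  have bp: "bpoly P (A (\<lambda>t. t) i) = A f i" for i
  proof -
    have "bpoly r (t *\<^sub>R id_blinfun) = poly r t *\<^sub>R (id_blinfun :: 'h oper)" for r t
      by (induction r) (auto intro!: blinfun_eqI simp: blinfun.bilinear_simps algebra_simps)
    then show ?thesis using P by (simp add: A_def)
  qed
  text \<open>Coordinates in the rotated basis: \<open>\<alpha>\<close> spans the range of \<open>P\<close>, \<open>\<beta>\<close> its complement.\<close>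
  have form: "k * (\<Sum>i<2. inner (x i) (x i)) + (l - k) * inner (vadj 2 u x) (vadj 2 u x)
        - (\<Sum>i<2. inner (x i) (A g i (x i)))
      = (l - (p * g a + q * g b)) * inner \<alpha> \<alpha> - 2 * (c * s * (g b - g a)) * inner \<alpha> \<beta>
        + (k - (q * g a + p * g b)) * inner \<beta> \<beta>"
    if "x 0 = c *\<^sub>R \<alpha> - s *\<^sub>R \<beta>" "x 1 = s *\<^sub>R \<alpha> + c *\<^sub>R \<beta>" for x :: "nat \<Rightarrow> 'h" and \<alpha> \<beta> k l g
  proof -
    have "vadj 2 u x = c *\<^sub>R x 0 + s *\<^sub>R x 1" by (simp add: vadj_def sum2 u_def)
    also have "\<dots> = (c * c + s * s) *\<^sub>R \<alpha>" unfolding that by (simp add: algebra_simps)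
    finally have "vadj 2 u x = (c * c + s * s) *\<^sub>R \<alpha>" .
    then have V: "vadj 2 u x = \<alpha>" using cs pq by simp
    have x0: "inner (x 0) (x 0) = p * inner \<alpha> \<alpha> - 2 * (c * s) * inner \<alpha> \<beta> + q * inner \<beta> \<beta>"
      unfolding that cs[symmetric] by (simp add: inner_simps inner_commute algebra_simps)
    have x1: "inner (x 1) (x 1) = q * inner \<alpha> \<alpha> + 2 * (c * s) * inner \<alpha> \<beta> + p * inner \<beta> \<beta>"
      unfolding that cs[symmetric] by (simp add: inner_simps inner_commute algebra_simps)
    have q': "q = 1 - p" using pq by simp
    show ?thesis
      unfolding V sum2 by (simp add: A_def blinfun.bilinear_simps x0 x1[simplified] q' algebra_simps)
  qed
  have dom: "0 \<le> f \<mu> * (\<Sum>i<2. inner (x i) (x i)) + (f y - f \<mu>) * inner (vadj 2 u x) (vadj 2 u x)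
        - (\<Sum>i<2. inner (x i) (A f i (x i)))" for x
  proof -
    have "(\<Sum>i<2. inner (x i) (A f i (x i))) \<le>
        f \<mu> * (\<Sum>i<2. inner (x i) (x i)) + (f y - f \<mu>) * inner (vadj 2 u x) (vadj 2 u x)"
    proof (rule operator_monotone_dominate[OF f, where A = "A (\<lambda>t. t)" and S = "{a, b}" and p = "\<lambda>_. P"])
      show "A (\<lambda>t. t) i \<in> BH_sa" for i unfolding A_def by (rule BH_sa_intros(5)[OF BH_sa_intros(2)])
      show "rspec (A (\<lambda>t. t) i) \<subseteq> {a, b}" for i
        using rspec_bounds[OF sadj_scaleR[OF sadj_id] qle_refl qle_refl, of "if i = 0 then a else b"]
        by (auto simp: A_def split: if_splits)
      show "{a, b} \<subseteq> {0<..}" using pos by simp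
      show "uniform_limit {a, b} (\<lambda>m. poly P) f sequentially" using P by (auto simp: uniform_limit_iff)
      show "(\<lambda>m. bpoly P (A (\<lambda>t. t) i)) \<longlonglongrightarrow> A f i" for i by (simp add: bp)
      show "(\<Sum>i<2. inner (z i) (A (\<lambda>t. t) i (z i))) \<le>
          \<mu> * (\<Sum>i<2. inner (z i) (z i)) + (y - \<mu>) * inner (vadj 2 u z) (vadj 2 u z)" for z
      proof -
        define \<alpha> \<beta> where "\<alpha> = c *\<^sub>R z 0 + s *\<^sub>R z 1" and "\<beta> = c *\<^sub>R z 1 - s *\<^sub>R z 0"
        have "c *\<^sub>R \<alpha> - s *\<^sub>R \<beta> = (c * c + s * s) *\<^sub>R z 0" "s *\<^sub>R \<alpha> + c *\<^sub>R \<beta> = (c * c + s * s) *\<^sub>R z 1"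
          by (simp_all add: \<alpha>_def \<beta>_def algebra_simps)
        then have z: "z 0 = c *\<^sub>R \<alpha> - s *\<^sub>R \<beta>" "z 1 = s *\<^sub>R \<alpha> + c *\<^sub>R \<beta>" using cs pq by simp_all
        have "0 \<le> (y - (p * a + q * b)) * inner \<alpha> \<alpha> - 2 * (c * s * (b - a)) * inner \<alpha> \<beta>
            + (\<mu> - (q * a + p * b)) * inner \<beta> \<beta>"
        proof (rule psd2_inner)
          have "(c * s * (b - a))\<^sup>2 = p * q * (b - a)\<^sup>2" unfolding cs[symmetric] by (simp add: power2_eq_square)
          then show "(c * s * (b - a))\<^sup>2 \<le> (y - (p * a + q * b)) * (\<mu> - (q * a + p * b))"
            using rot by (simp add: rot_le_def)
        qed (use rot in \<open>simp_all add: rot_le_def\<close>)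
        then show ?thesis using form[OF z, of \<mu> y "\<lambda>t. t"] by simp
      qed
    qed (use u1 pos in auto)
    then show ?thesis by simp
  qed
  obtain e :: 'h where "e \<noteq> 0" using nz by blast
  define e' where "e' = e /\<^sub>R norm e"
  have e': "inner e' e' = 1" using \<open>e \<noteq> 0\<close> by (simp add: e'_def power2_norm_eq_inner[symmetric] power2_eq_square)
  have psd: "0 \<le> (f y - (p * f a + q * f b)) * \<alpha>\<^sup>2 - 2 * (c * s * (f b - f a)) * \<alpha> * \<beta> + (f \<mu> - (q * f a + p * f b)) * \<beta>\<^sup>2"
    for \<alpha> \<beta> :: real
  proof -
    define x where "x i = (if i = 0 then c *\<^sub>R (\<alpha> *\<^sub>R e') - s *\<^sub>R (\<beta> *\<^sub>R e') else s *\<^sub>R (\<alpha> *\<^sub>R e') + c *\<^sub>R (\<beta> *\<^sub>R e'))" for i :: nat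
    have "x 0 = c *\<^sub>R (\<alpha> *\<^sub>R e') - s *\<^sub>R (\<beta> *\<^sub>R e')" "x 1 = s *\<^sub>R (\<alpha> *\<^sub>R e') + c *\<^sub>R (\<beta> *\<^sub>R e')"
      by (simp_all add: x_def)
    from form[OF this, of "f \<mu>" "f y" f] dom[of x] show ?thesis by (simp add: e' power2_eq_square mult_ac)
  qed
  have "(c * s * (f b - f a))\<^sup>2 = p * q * (f b - f a)\<^sup>2" unfolding cs[symmetric] by (simp add: power2_eq_square)
  then show "rot_le p q (f a) (f b) (f y) (f \<mu>)"
    using psd2_discriminant[OF psd] by (simp add: rot_le_def)
qed

section \<open>Continuity and concavity from two-by-two comparisons\<close>

lemma rot_monotone_mono:
  assumes "rot_monotone f" "0 < a" "a \<le> y"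
  shows "f a \<le> f y"
  using rot_monotoneD(1)[OF assms(1), of 1 0 a y y y] assms by (simp add: rot_le_def)

text \<open>The strict gap \<open>y - m\<close> leaves room for a \<open>\<mu>\<close> so large that
  the determinant condition holds, here with equality.\<close>

lemma rot_monotone_jensen_gap:
  assumes f: "rot_monotone f" and pq: "0 \<le> p" "0 \<le> q" "p + q = 1" and ab: "0 < a" "0 < b"
    and y: "p * a + q * b < y"
  shows "p * f a + q * f b \<le> f y"
proof -
  define m m' where "m = p * a + q * b" and "m' = q * a + p * b"
  define \<mu> where "\<mu> = m' + p * q * (b - a)\<^sup>2 / (y - m)"
  have comb: "0 < r * a + r' * b" if "0 \<le> r" "0 \<le> r'" "r + r' = 1" for r r'
    using that ab by (cases "r = 0") (auto intro!: add_pos_nonneg)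
  have mm: "0 < m" "0 < m'" using comb pq by (auto simp: m_def m'_def)
  have ym: "0 < y - m" using y by (simp add: m_def)
  have e: "0 \<le> p * q * (b - a)\<^sup>2 / (y - m)" using pq ym by simp
  have "rot_le p q a b y \<mu>"
    using ym e by (auto simp: rot_le_def m_def[symmetric] m'_def[symmetric] \<mu>_def)
  then show ?thesis
    using rot_monotoneD(1)[OF f, of p q a b y \<mu>] pq ab mm ym e by (simp add: \<mu>_def)
qed

lemma rot_monotone_lipschitz:
  assumes f: "rot_monotone f" and pos: "\<And>t. 0 < t \<Longrightarrow> 0 < f t" and st: "0 < s" "s \<le> t" "t - s < t / 4"
  shows "f t - f s \<le> 4 * (t - s) / t * f t"
proof (cases "s = t")
  case False
  \<comment> \<open>The factor 4 places the combination of \<open>t / 2\<close> and \<open>t\<close>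
    at \<open>t - 2 * (t - s)\<close>, strictly below \<open>s\<close> as the Jensen bound requires;
    the factor 2 would give \<open>s\<close> itself.\<close>
  define p where "p = 4 * (t - s) / t"
  have t: "0 < t" using st by simp
  have p: "0 \<le> p" "p \<le> 1" using st t by (auto simp: p_def field_simps)
  have "p * (t / 2) + (1 - p) * t = t - 2 * (t - s)" using t by (simp add: p_def field_simps)
  then have "p * f (t / 2) + (1 - p) * f t \<le> f s"
    using p t st False by (intro rot_monotone_jensen_gap[OF f]) auto
  moreover have "0 \<le> p * f (t / 2)" using p pos[of "t / 2"] t by simp
  ultimately show ?thesis by (simp add: p_def algebra_simps)
qed simp

lemma rot_monotone_continuous:
  assumes f: "rot_monotone f" and pos: "\<And>t. 0 < t \<Longrightarrow> 0 < f t"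
  shows "continuous_on {0<..} f"
proof (rule continuous_at_imp_continuous_on, rule ballI)
  fix t :: real assume "t \<in> {0<..}"
  then have t: "0 < t" by simp
  \<comment> \<open>The preceding estimate is used at the larger of \<open>x\<close> and
    \<open>t\<close>, which lies between \<open>t\<close> and \<open>2 * t\<close>; bounding it
    there gives \<open>K\<close>.\<close>
  define K where "K = 4 / t * f (2 * t)"
  have K: "0 < K" using t pos[of "2 * t"] by (simp add: K_def)
  have bound: "\<bar>f x - f t\<bar> \<le> K * \<bar>x - t\<bar>" if x: "\<bar>x - t\<bar> < t / 8" for x
  proof -
    define l h where "l = min x t" and "h = max x t"
    have lh: "0 < l" "l \<le> h" "h - l < h / 4" "h \<le> 2 * t" "t \<le> h" "h - l = \<bar>x - t\<bar>" "0 < h"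
      using x t unfolding l_def h_def by (cases "x \<le> t"; simp add: abs_if split: if_splits)+
    have "f h - f l \<le> 4 * (h - l) / h * f h" by (rule rot_monotone_lipschitz[OF f pos lh(1-3)])
    also have "\<dots> = 4 * (h - l) * (f h / h)" by simp
    also have "\<dots> \<le> 4 * (h - l) * (f (2 * t) / t)"
      using lh t pos[of h] rot_monotone_mono[OF f lh(7,4)] by (intro mult_left_mono frac_le) auto
    finally have "f h - f l \<le> K * \<bar>x - t\<bar>" using lh by (simp add: K_def mult_ac)
    moreover have "\<bar>f x - f t\<bar> = f h - f l"
      using rot_monotone_mono[OF f lh(1,2)] by (auto simp: l_def h_def min_def max_def split: if_splits)
    ultimately show ?thesis by simp
  qed
  show "isCont f t"
    unfolding continuous_at_eps_delta
  proof (intro allI impI)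
    fix e :: real assume e: "0 < e"
    define d where "d = min (t / 8) (e / K)"
    have "dist (f x) (f t) < e" if "dist x t < d" for x
    proof -
      have "\<bar>f x - f t\<bar> \<le> K * \<bar>x - t\<bar>" using that by (intro bound) (simp add: d_def dist_real_def)
      also have "\<dots> < K * (e / K)" using that K by (intro mult_strict_left_mono) (auto simp: d_def dist_real_def)
      finally show ?thesis using K by (simp add: dist_real_def)
    qed
    then show "\<exists>d>0. \<forall>x. dist x t < d \<longrightarrow> dist (f x) (f t) < e"
      using t e K by (intro exI[of _ d]) (auto simp: d_def)
  qed
qed

text \<open>Jensen's inequality with a gap \<open>1 / (k + 1)\<close>, which continuity then
  removes.\<close>

lemma rot_monotone_concave:
  assumes f: "rot_monotone f" and pos: "\<And>t. 0 < t \<Longrightarrow> 0 < f t" and xyz: "0 < x" "x < y" "y < z"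
  shows "(z - y) * f x + (y - x) * f z \<le> (z - x) * f y"
proof -
  define p q where "p = (z - y) / (z - x)" and "q = (y - x) / (z - x)"
  have pq: "0 \<le> p" "0 \<le> q" "p + q = 1"
    using xyz by (simp_all add: p_def q_def add_divide_distrib[symmetric])
  have "p * x + q * z = ((z - y) * x + (y - x) * z) / (z - x)"
    by (simp add: p_def q_def add_divide_distrib)
  also have "(z - y) * x + (y - x) * z = y * (z - x)" by (simp add: algebra_simps)
  finally have m: "p * x + q * z = y" using xyz by simp
  have "isCont f y"
    using rot_monotone_continuous[OF f pos] xyz by (simp add: continuous_on_eq_continuous_at)
  moreover have "(\<lambda>k. y + 1 / real (Suc k)) \<longlonglongrightarrow> y + 0"
    by (intro tendsto_intros LIMSEQ_Suc lim_1_over_n)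
  ultimately have "(\<lambda>k. f (y + 1 / real (Suc k))) \<longlonglongrightarrow> f y"
    using isCont_tendsto_compose[of y f "\<lambda>k. y + 1 / real (Suc k)"] by (simp del: of_nat_Suc)
  moreover have "p * f x + q * f z \<le> f (y + 1 / real (Suc k))" for k
    using m xyz pq by (intro rot_monotone_jensen_gap[OF f]) auto
  ultimately have "p * f x + q * f z \<le> f y" by (auto intro: LIMSEQ_le_const)
  then have "(z - x) * (p * f x + q * f z) \<le> (z - x) * f y" using xyz by (intro mult_left_mono) auto
  moreover have "(z - x) * p = z - y" "(z - x) * q = y - x" using xyz by (simp_all add: p_def q_def)
  ultimately show ?thesis by (simp add: distrib_left mult.assoc[symmetric])
qed

text \<open>
  The determinant of the Loewner matrix at \<open>a\<close>, \<open>b\<close> is nonnegative, with slopes \<open>\<alpha>\<close>, \<open>\<beta>\<close> of majorants in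
  place of derivatives: rotate \<open>diag (a, b)\<close> by an angle tending to \<open>0\<close>.
\<close>

lemma rot_monotone_loewner:
  assumes f: "rot_monotone f" and ab: "0 < a" "a < b"
    and \<alpha>: "\<And>t. a \<le> t \<Longrightarrow> f t \<le> f a + \<alpha> * (t - a)" and \<beta>: "\<And>t. b \<le> t \<Longrightarrow> f t \<le> f b + \<beta> * (t - b)"
  shows "(f b - f a)\<^sup>2 \<le> \<alpha> * \<beta> * (b - a)\<^sup>2"
proof -
  define D F where "D = b - a" and "F = f b - f a"
  have D: "0 < D" using ab by (simp add: D_def)
  have rot: "(1 - q) * F\<^sup>2 \<le> (\<alpha> * (q * D + \<eta>) - q * F) * (\<beta> * ((1 - q) * D\<^sup>2 / \<eta> - D) + F)"
    if q: "0 < q" "q \<le> 1 / 2" and \<eta>: "0 < \<eta>" "\<eta> \<le> D / 2" for q \<eta>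
  proof -
    \<comment> \<open>\<open>y\<close> exceeds the rotated diagonal entry by \<open>\<eta>\<close>,
      and \<open>\<mu>\<close> is what the determinant condition then demands. The bounds on
      \<open>q\<close> and \<open>\<eta>\<close> ensure \<open>b \<le> \<mu>\<close>, so that the
      majorant at \<open>b\<close> applies.\<close>
    define y \<mu> where "y = a + q * D + \<eta>" and "\<mu> = b - q * D + (1 - q) * q * D\<^sup>2 / \<eta>"
    have qD: "0 \<le> q * D" using q D by simp
    have m: "(1 - q) * a + q * b = a + q * D" "q * a + (1 - q) * b = b - q * D"
      by (simp_all add: D_def algebra_simps)
    have "1 / 2 * D \<le> (1 - q) * D" using q D by (intro mult_right_mono) auto
    then have "\<eta> \<le> (1 - q) * D" using \<eta> by linarith
    then have "1 \<le> (1 - q) * D / \<eta>" using \<eta> by simp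
    from mult_left_mono[OF this qD] have \<mu>b: "b \<le> \<mu>" by (simp add: \<mu>_def power2_eq_square mult_ac)
    have e: "0 \<le> (1 - q) * q * D\<^sup>2 / \<eta>" using q \<eta> by simp
    have "rot_le (1 - q) q a b y \<mu>"
      unfolding rot_le_def m using e \<eta> by (simp add: y_def \<mu>_def D_def[symmetric])
    from rot_monotoneD[OF f this] q ab \<eta> qD \<mu>b
    have R: "(1 - q) * f a + q * f b \<le> f y" "q * f a + (1 - q) * f b \<le> f \<mu>"
      "(1 - q) * q * F\<^sup>2 \<le> (f y - ((1 - q) * f a + q * f b)) * (f \<mu> - (q * f a + (1 - q) * f b))"
      by (simp_all add: y_def F_def)
    have fm: "(1 - q) * f a + q * f b = f a + q * F" "q * f a + (1 - q) * f b = f b - q * F"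
      by (simp_all add: F_def algebra_simps)
    have Y: "f y - (f a + q * F) \<le> \<alpha> * (q * D + \<eta>) - q * F"
      using \<alpha>[of y] qD \<eta> by (simp add: y_def add.assoc)
    have N: "f \<mu> - (f b - q * F) \<le> q * (\<beta> * ((1 - q) * D\<^sup>2 / \<eta> - D) + F)"
    proof -
      have "f \<mu> - (f b - q * F) \<le> \<beta> * (\<mu> - b) + q * F" using \<beta>[OF \<mu>b] by simp
      also have "\<mu> - b = q * ((1 - q) * D\<^sup>2 / \<eta> - D)" by (simp add: \<mu>_def algebra_simps)
      finally show ?thesis by (simp add: algebra_simps)
    qed
    have "(1 - q) * q * F\<^sup>2 \<le> (\<alpha> * (q * D + \<eta>) - q * F) * (q * (\<beta> * ((1 - q) * D\<^sup>2 / \<eta> - D) + F))"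
      using R unfolding fm by (elim order_trans) (intro mult_mono Y N; use R Y fm in simp)
    \<comment> \<open>Both sides carry a factor \<open>q\<close>; only after cancelling it does the
      limit at angle 0 say something.\<close>
    then have "q * ((1 - q) * F\<^sup>2) \<le> q * ((\<alpha> * (q * D + \<eta>) - q * F) * (\<beta> * ((1 - q) * D\<^sup>2 / \<eta> - D) + F))"
      by (simp add: mult_ac)
    then show ?thesis using q by simp
  qed
  have eta: "F\<^sup>2 \<le> \<alpha> * \<eta> * (\<beta> * (D\<^sup>2 / \<eta> - D) + F)" if \<eta>: "0 < \<eta>" "\<eta> \<le> D / 2" for \<eta>
  proof (rule tendsto_le[of "at_right (0::real)"])
    let ?L = "\<lambda>q. (1 - q) * F\<^sup>2"
    let ?R = "\<lambda>q. (\<alpha> * (q * D + \<eta>) - q * F) * (\<beta> * ((1 - q) * D\<^sup>2 / \<eta> - D) + F)"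
    have "(?R \<longlongrightarrow> (\<alpha> * (0 * D + \<eta>) - 0 * F) * (\<beta> * ((1 - 0) * D\<^sup>2 / \<eta> - D) + F)) (at_right 0)"
      using \<eta> by (intro tendsto_intros) auto
    then show "(?R \<longlongrightarrow> \<alpha> * \<eta> * (\<beta> * (D\<^sup>2 / \<eta> - D) + F)) (at_right 0)" by simp
    have "(?L \<longlongrightarrow> (1 - 0) * F\<^sup>2) (at_right 0)" by (intro tendsto_intros)
    then show "(?L \<longlongrightarrow> F\<^sup>2) (at_right 0)" by simp
    show "\<forall>\<^sub>F q in at_right 0. ?L q \<le> ?R q"
      unfolding eventually_at_right_field using rot[OF _ _ \<eta>] by (intro exI[of _ "1/2"]) auto
  qed simp
  \<comment> \<open>The product of \<open>\<alpha> * \<eta>\<close> and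
    \<open>\<beta> * D\<^sup>2 / \<eta>\<close> does not depend on \<open>\<eta>\<close>, and the
    other terms vanish with it.\<close>
  have "F\<^sup>2 \<le> \<alpha> * \<beta> * D\<^sup>2"
  proof (rule tendsto_le[of "at_right (0::real)"])
    have "((\<lambda>\<eta>. \<alpha> * \<beta> * D\<^sup>2 + \<eta> * (\<alpha> * F - \<alpha> * \<beta> * D)) \<longlongrightarrow> \<alpha> * \<beta> * D\<^sup>2 + 0 * (\<alpha> * F - \<alpha> * \<beta> * D)) (at_right 0)"
      by (intro tendsto_intros)
    then show "((\<lambda>\<eta>. \<alpha> * \<beta> * D\<^sup>2 + \<eta> * (\<alpha> * F - \<alpha> * \<beta> * D)) \<longlongrightarrow> \<alpha> * \<beta> * D\<^sup>2) (at_right 0)" by simp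
    show "\<forall>\<^sub>F \<eta> in at_right 0. F\<^sup>2 \<le> \<alpha> * \<beta> * D\<^sup>2 + \<eta> * (\<alpha> * F - \<alpha> * \<beta> * D)"
      unfolding eventually_at_right_field
    proof (intro exI[of _ "D / 2"] conjI allI impI)
      fix \<eta> assume "0 < \<eta>" "\<eta> < D / 2"
      then show "F\<^sup>2 \<le> \<alpha> * \<beta> * D\<^sup>2 + \<eta> * (\<alpha> * F - \<alpha> * \<beta> * D)"
        using eta[of \<eta>] by (simp add: algebra_simps)
    qed (use D in simp)
  qed (simp_all add: tendsto_const)
  then show ?thesis by (simp add: D_def F_def)
qed

text \<open>Beyond its right end a chord lies above a concave function. This supplies slopes for
  \<open>rot_monotone_loewner\<close> while no derivative is at hand.\<close>

lemma rot_monotone_chord_majorant: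
  assumes f: "rot_monotone f" and pos: "\<And>t. 0 < t \<Longrightarrow> 0 < f t" and ab: "0 < a" "a < b" and t: "b \<le> t"
  shows "f t \<le> f b + (f b - f a) / (b - a) * (t - b)"
proof (cases "t = b")
  case False
  then have "(t - b) * f a + (b - a) * f t \<le> (t - a) * f b"
    using ab t by (intro rot_monotone_concave[OF f pos]) auto
  then have "(b - a) * f t \<le> (b - a) * f b + (f b - f a) * (t - b)" by (simp add: algebra_simps)
  then show ?thesis using ab by (simp add: field_simps)
qed simp

text \<open>
  \<open>l\<close> and \<open>r\<close> are the chord slopes to the left and to the right of \<open>1\<close>; they are monotone, and the Loewner
  inequality at \<open>1 - h\<close>, \<open>1 + h\<close> gives \<open>(L + R)\<^sup>2 \<le> 4 L R\<close> for their limits.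
\<close>

lemma rot_monotone_derivative_at_1:
  assumes f: "rot_monotone f" and pos: "\<And>t. 0 < t \<Longrightarrow> 0 < f t" and f1: "f 1 = 1"
    and nc: "\<not> f constant_on {0<..}"
  obtains c where "0 < c"
    "\<And>e. 0 < e \<Longrightarrow> \<exists>d>0. \<forall>s. \<bar>s\<bar> \<le> d \<longrightarrow> 1 + c * s - e * \<bar>s\<bar> \<le> f (1 + s)"
proof -
  define r l where "r h = (f (1 + h) - 1) / h" and "l h = (1 - f (1 - h)) / h" for h
  note conc = rot_monotone_concave[OF f pos]
  have r_mono: "r h \<le> r k" if "0 < k" "k \<le> h" for h k
  proof (cases "k = h")
    case False
    then show ?thesis using conc[of 1 "1 + k" "1 + h"] that f1
      by (simp add: r_def divide_le_eq field_simps)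
  qed simp
  have l_mono: "l k \<le> l h" if "0 < k" "k \<le> h" "h < 1" for h k
  proof (cases "k = h")
    case False
    then show ?thesis using conc[of "1 - h" "1 - k" 1] that f1
      by (simp add: l_def divide_le_eq field_simps)
  qed simp
  have rl: "r k \<le> l h" if "0 < k" "0 < h" "h < 1" for h k
    using conc[of "1 - h" 1 "1 + k"] that f1
    by (simp add: r_def l_def divide_le_eq field_simps)
  have r0: "0 \<le> r k" if "0 < k" for k
    using rot_monotone_mono[OF f, of 1 "1 + k"] that f1 by (simp add: r_def)
  define h where "h k = (1/2::real) ^ (k + 1)" for k :: nat
  have h: "0 < h k" "h k < 1" for k
    using power_decreasing[of 1 "k + 1" "1/2::real"] by (simp_all add: h_def)
  have hs: "h (Suc k) = h k / 2" for k by (simp add: h_def)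
  have hd: "h n \<le> h m" if "m \<le> n" for m n unfolding h_def using that by (intro power_decreasing) auto
  have incr: "incseq (\<lambda>k. r (h k))" using r_mono[OF h(1) hd] by (simp add: incseq_def)
  have decr: "decseq (\<lambda>k. l (h k))" using l_mono[OF h(1) hd h(2)] by (simp add: decseq_def)
  obtain R where R: "(\<lambda>k. r (h k)) \<longlonglongrightarrow> R" "\<And>k. r (h k) \<le> R"
    using incseq_convergent[OF incr, of "l (h 0)"] rl h by metis
  obtain L where L: "(\<lambda>k. l (h k)) \<longlonglongrightarrow> L" "\<And>k. L \<le> l (h k)"
    using decseq_convergent[OF decr, of 0] r0 rl h by (metis order_trans)
  have loew: "(r (h (Suc k)) + l (h (Suc k)))\<^sup>2 \<le> 4 * ((2 * l (h k) - l (h (Suc k))) * r (h (Suc k)))" for k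
  proof -
    define e where "e = h (Suc k)"
    have e: "0 < e" "2 * e < 1" "h k = 2 * e" using h[of k] h[of "Suc k"] hs[of k] by (simp_all add: e_def)
    \<comment> \<open>Slopes of chords ending at \<open>1 - e\<close> and \<open>1 + e\<close>. The
      first is \<open>2 * l (2 * e) - l e\<close>, which tends to the same limit as
      \<open>l\<close>; the dyadic steps make \<open>2 * e\<close> a step again.\<close>
    define \<alpha> \<beta> where "\<alpha> = (f (1 - e) - f (1 - 2 * e)) / e" and "\<beta> = (f (1 + e) - f 1) / e"
    have "(f (1 + e) - f (1 - e))\<^sup>2 \<le> \<alpha> * \<beta> * ((1 + e) - (1 - e))\<^sup>2"
    proof (rule rot_monotone_loewner[OF f])
      show "f t \<le> f (1 - e) + \<alpha> * (t - (1 - e))" if "1 - e \<le> t" for t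
        using rot_monotone_chord_majorant[OF f pos, of "1 - 2 * e" "1 - e" t] that e by (simp add: \<alpha>_def)
      show "f t \<le> f (1 + e) + \<beta> * (t - (1 + e))" if "1 + e \<le> t" for t
        using rot_monotone_chord_majorant[OF f pos, of 1 "1 + e" t] that e by (simp add: \<beta>_def)
    qed (use e in auto)
    moreover have "f (1 + e) - f (1 - e) = e * (r e + l e)" using e by (simp add: r_def l_def distrib_left)
    moreover have "\<alpha> = 2 * l (2 * e) - l e" using e by (simp add: \<alpha>_def l_def field_simps)
    moreover have "\<beta> = r e" by (simp add: \<beta>_def r_def f1)
    ultimately have "e\<^sup>2 * (r e + l e)\<^sup>2 \<le> e\<^sup>2 * (4 * ((2 * l (2 * e) - l e) * r e))"
      by (simp add: power_mult_distrib mult_ac power2_eq_square)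
    then show ?thesis using e by (simp add: e_def[symmetric])
  qed
  have "(R + L)\<^sup>2 \<le> 4 * ((2 * L - L) * R)"
  proof (rule LIMSEQ_le[OF _ _ exI[of _ 0]])
    note Suc = LIMSEQ_Suc[OF R(1)] LIMSEQ_Suc[OF L(1)]
    show "(\<lambda>k. (r (h (Suc k)) + l (h (Suc k)))\<^sup>2) \<longlonglongrightarrow> (R + L)\<^sup>2" by (intro tendsto_intros Suc)
    show "(\<lambda>k. 4 * ((2 * l (h k) - l (h (Suc k))) * r (h (Suc k)))) \<longlonglongrightarrow> 4 * ((2 * L - L) * R)"
      by (intro tendsto_intros Suc L)
  qed (use loew in blast)
  then have "(R - L)\<^sup>2 \<le> 0" by (simp add: power2_eq_square algebra_simps)
  then have RL: "R = L" by simp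
  have "0 \<le> R" using R(2)[of 0] r0[OF h(1), of 0] by linarith
  \<comment> \<open>If the slope at 1 were 0, monotone chord slopes would make \<open>f\<close>
    constant to the right of 1, and the Loewner inequality with slope 0 at the point 2 would extend
    this to the left.\<close>
  moreover have "R \<noteq> 0"
  proof
    assume "R = 0"
    have hr0: "r k = 0" if "0 < k" for k
    proof -
      obtain j where "(1/2) ^ j < k" using real_arch_pow_inv[of k "1/2"] \<open>0 < k\<close> by auto
      moreover have "h j \<le> (1/2) ^ j" unfolding h_def by (intro power_decreasing) auto
      ultimately have j: "h j < k" by linarith
      have "r k \<le> r (h j)" using j h by (intro r_mono) auto
      then show ?thesis using R(2)[of j] \<open>R = 0\<close> r0[OF that] by linarith
    qed
    have f_ge: "f t = 1" if "1 \<le> t" for t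
      using hr0[of "t - 1"] that f1 by (cases "t = 1") (auto simp: r_def)
    have f_lt: "f t = 1" if "0 < t" "t < 1" for t
    proof -
      have "(f 2 - f t)\<^sup>2 \<le> (f t - f (t / 2)) / (t - t / 2) * 0 * (2 - t)\<^sup>2"
      proof (rule rot_monotone_loewner[OF f])
        show "f s \<le> f t + (f t - f (t / 2)) / (t - t / 2) * (s - t)" if "t \<le> s" for s
          using that \<open>0 < t\<close> by (intro rot_monotone_chord_majorant[OF f pos]) auto
        show "f s \<le> f 2 + 0 * (s - 2)" if "2 \<le> s" for s using that f_ge[of s] f_ge[of 2] by simp
      qed (use that in auto)
      then show ?thesis using f_ge[of 2] by simp
    qed
    have "f constant_on {0<..}"
      unfolding constant_on_def using f_ge f_lt by (intro exI[of _ 1]) (metis greaterThan_iff not_le)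
    then show False using nc by simp
  qed
  ultimately have c: "0 < R" by simp
  have "\<exists>d>0. \<forall>s. \<bar>s\<bar> \<le> d \<longrightarrow> 1 + R * s - e * \<bar>s\<bar> \<le> f (1 + s)" if e: "0 < e" for e
  proof -
    \<comment> \<open>A single step size suffices, since the chord slopes are monotone and the
      bounds persist for all smaller steps.\<close>
    have "\<forall>\<^sub>F k in sequentially. R - e < r (h k) \<and> l (h k) < L + e"
      using e by (intro eventually_conj order_tendstoD(1)[OF R(1)] order_tendstoD(2)[OF L(1)]) auto
    then obtain k where k: "R - e < r (h k)" "l (h k) < L + e" by (auto simp: eventually_sequentially)
    have "1 + R * s - e * \<bar>s\<bar> \<le> f (1 + s)" if s: "\<bar>s\<bar> \<le> h k" for s
    proof (cases s "0::real" rule: linorder_cases)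
      case greater
      then have "R - e \<le> r s" using k(1) r_mono[of s "h k"] s by simp
      then have "(R - e) * s \<le> f (1 + s) - 1" using greater by (simp add: r_def le_divide_eq)
      then show ?thesis using greater by (simp add: algebra_simps)
    next
      case less
      then have "l (- s) \<le> R + e" using k(2) l_mono[of "- s" "h k"] s h(2)[of k] RL by simp
      then have "(1 - f (1 + s)) / (- s) \<le> R + e" by (simp add: l_def)
      then have "1 - f (1 + s) \<le> (R + e) * (- s)"
        using iffD1[OF pos_divide_le_eq[of "- s" "1 - f (1 + s)" "R + e"]] less by linarith
      then show ?thesis using less by (simp add: algebra_simps)
    qed (simp add: f1)
    then show ?thesis using h(1)[of k] by blast
  qed
  with c show ?thesis by (rule that)
qed

text \<open>The harmonic bound involves \<open>1 / f\<close>. Half of the error \<open>e\<close> is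
  spent on the lower bound for \<open>f\<close>, the other half on the quadratic term of the
  reciprocal.\<close>

lemma rot_monotone_inverse_upper:
  assumes f: "rot_monotone f" and pos: "\<And>t. 0 < t \<Longrightarrow> 0 < f t" and f1: "f 1 = 1"
    and nc: "\<not> f constant_on {0<..}"
  obtains c where "0 < c"
    "\<And>e. 0 < e \<Longrightarrow> \<exists>d>0. \<forall>s. \<bar>s\<bar> \<le> d \<longrightarrow> 1 / f (1 + s) \<le> 1 - c * s + e * \<bar>s\<bar>"
proof -
  obtain c where c: "0 < c"
    and low: "\<And>e. 0 < e \<Longrightarrow> \<exists>d>0. \<forall>s. \<bar>s\<bar> \<le> d \<longrightarrow> 1 + c * s - e * \<bar>s\<bar> \<le> f (1 + s)"
    using rot_monotone_derivative_at_1[OF f pos f1 nc] by blast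
  have "\<exists>d>0. \<forall>s. \<bar>s\<bar> \<le> d \<longrightarrow> 1 / f (1 + s) \<le> 1 - c * s + e * \<bar>s\<bar>" if e: "0 < e" for e
  proof -
    define k where "k = c + e / 2"
    have k: "0 < k" using c e by (simp add: k_def)
    obtain d where d: "0 < d" "\<And>s. \<bar>s\<bar> \<le> d \<Longrightarrow> 1 + c * s - e / 2 * \<bar>s\<bar> \<le> f (1 + s)"
      using low[of "e / 2"] e by auto
    \<comment> \<open>\<open>1 / (2 * k)\<close> keeps \<open>\<bar>v\<bar>\<close> at most 1/2, and
      \<open>e / (4 * k\<^sup>2)\<close> keeps \<open>2 * v\<^sup>2\<close> at most
      \<open>e / 2 * \<bar>s\<bar>\<close>.\<close>
    define d' where "d' = min d (min (1 / (2 * k)) (e / (4 * k\<^sup>2)))"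
    have "1 / f (1 + s) \<le> 1 - c * s + e * \<bar>s\<bar>" if s: "\<bar>s\<bar> \<le> d'" for s
    proof -
      define v where "v = c * s - e / 2 * \<bar>s\<bar>"
      have "\<bar>v\<bar> \<le> \<bar>c * s\<bar> + \<bar>e / 2 * \<bar>s\<bar>\<bar>" unfolding v_def by (rule abs_triangle_ineq4)
      then have vk: "\<bar>v\<bar> \<le> k * \<bar>s\<bar>" using c e by (simp add: k_def abs_mult algebra_simps)
      also have "\<dots> \<le> k * (1 / (2 * k))" using s k by (intro mult_left_mono) (auto simp: d'_def)
      finally have v: "\<bar>v\<bar> \<le> 1 / 2" using k by simp
      have "1 + v \<le> f (1 + s)" using d(2)[of s] s by (simp add: v_def d'_def)
      moreover have v1: "0 < 1 + v" "0 \<le> 1 + 2 * v" using v by linarith+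
      ultimately have "1 / f (1 + s) \<le> 1 / (1 + v)" by (intro frac_le) auto
      also have "\<dots> \<le> 1 - v + 2 * v\<^sup>2"
      proof -
        have "0 \<le> v\<^sup>2 * (1 + 2 * v)" using v1 by simp
        then have "1 \<le> (1 - v + 2 * v\<^sup>2) * (1 + v)" by (simp add: power2_eq_square algebra_simps)
        then show ?thesis using v1 by (simp add: divide_le_eq)
      qed
      also have "2 * v\<^sup>2 \<le> e / 2 * \<bar>s\<bar>"
      proof -
        have "v\<^sup>2 \<le> (k * \<bar>s\<bar>)\<^sup>2" using power_mono[OF vk abs_ge_zero, of 2] by simp
        also have "\<dots> = k\<^sup>2 * \<bar>s\<bar> * \<bar>s\<bar>" by (simp add: power2_eq_square mult_ac)
        also have "\<dots> \<le> k\<^sup>2 * (e / (4 * k\<^sup>2)) * \<bar>s\<bar>"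
          using s by (intro mult_right_mono mult_left_mono) (auto simp: d'_def)
        finally show ?thesis using k by simp
      qed
      finally show ?thesis by (simp add: v_def)
    qed
    moreover have "0 < d'" using d k e by (simp add: d'_def)
    ultimately show ?thesis by blast
  qed
  with c show ?thesis by (rule that)
qed

section \<open>The equivalence\<close>

lemma mean_le_id:
  fixes A :: "nat \<Rightarrow> 'h::complex_hilbert oper" and M :: "(nat \<Rightarrow> real) \<Rightarrow> (nat \<Rightarrow> 'h oper) \<Rightarrow> 'h oper"
  assumes nz: "\<exists>x::'h. x \<noteq> 0" and n: "n \<ge> 2" and w: "w \<in> weights n"
    and M: "(M = (\<lambda>_. alm n) \<and> (\<forall>i<n. w i = 1 / real n)) \<or> M = bmp n \<or> M = log_euclid n"
    and A: "\<And>i. i < n \<Longrightarrow> A i \<in> BH_pos"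
  shows "qle (\<Sum>i<n. w i *\<^sub>R A i) id_blinfun \<Longrightarrow> M w A \<preceq> id_blinfun"
    and "M w A \<preceq> id_blinfun \<Longrightarrow> qle id_blinfun (\<Sum>i<n. w i *\<^sub>R opinv (A i))"
proof -
  have w0: "0 \<le> w i" if "i < n" for i using w that by (auto simp: weights_def less_imp_le)
  have w1: "(\<Sum>i<n. w i) = 1" using w by (simp add: weights_def)
  obtain m where m: "n = Suc (Suc m)" using n by (metis Suc_le_D numeral_2_eq_2 Suc_le_mono)
  have "(qle (\<Sum>i<n. w i *\<^sub>R A i) id_blinfun \<longrightarrow> M w A \<preceq> id_blinfun) \<and>
    (M w A \<preceq> id_blinfun \<longrightarrow> qle id_blinfun (\<Sum>i<n. w i *\<^sub>R opinv (A i)))"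
  proof (cases "M = log_euclid n")
    case True
    define X where "X = (\<Sum>i<n. w i *\<^sub>R fcalc ln (A i))"
    have X: "X \<in> BH_sa" unfolding X_def using fcalc_ln_bounds(1)[OF A] by (intro BH_sa_intros(5,6)) auto
    have up: "qle X (\<Sum>i<n. w i *\<^sub>R (A i - id_blinfun))"
      unfolding X_def using w0 fcalc_ln_bounds(2)[OF A] by (intro qle_sum qle_scaleR) auto
    have low: "qle (\<Sum>i<n. w i *\<^sub>R (id_blinfun - opinv (A i))) X"
      unfolding X_def using w0 fcalc_ln_bounds(3)[OF A] by (intro qle_sum qle_scaleR) auto
    have s: "(\<Sum>i<n. w i *\<^sub>R (A i - id_blinfun)) = (\<Sum>i<n. w i *\<^sub>R A i) - id_blinfun"
      "(\<Sum>i<n. w i *\<^sub>R (id_blinfun - opinv (A i))) = id_blinfun - (\<Sum>i<n. w i *\<^sub>R opinv (A i))"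
      by (simp_all add: scaleR_diff_right sum_subtractf scaleR_sum_left[symmetric] w1)
    have "M w A \<preceq> id_blinfun \<longleftrightarrow> qle X 0"
      using fcalc_exp_le_id_iff(2)[OF X] by (simp add: True log_euclid_def X_def)
    moreover have "qle X 0" if "qle (\<Sum>i<n. w i *\<^sub>R A i) id_blinfun"
    proof (rule qle_trans[OF up])
      show "qle (\<Sum>i<n. w i *\<^sub>R (A i - id_blinfun)) 0"
        using that unfolding s by (simp add: qle_def blinfun.diff_left inner_diff_right)
    qed
    moreover have "qle id_blinfun (\<Sum>i<n. w i *\<^sub>R opinv (A i))" if "qle X 0"
      using qle_trans[OF low that] unfolding s by (simp add: qle_def blinfun.diff_left inner_diff_right)
    ultimately show ?thesis by blast
  next
    case False
    have "is_mean n w (M w)"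
    proof (cases "M = bmp n")
      case True
      then show ?thesis using is_mean_bmp[OF nz] w m by simp
    next
      case False
      then have "M = (\<lambda>_. alm n)" "\<And>i. i < n \<Longrightarrow> w i = 1 / real n" using M \<open>M \<noteq> log_euclid n\<close> by auto
      moreover have "is_mean n (\<lambda>_. 1 / real n) (alm n :: (nat \<Rightarrow> 'h oper) \<Rightarrow> _)"
        unfolding m by (rule is_mean_alm[OF nz])
      ultimately show ?thesis using is_mean_cong[of n w "\<lambda>_. 1 / real n"] by blast
    qed
    note D = is_meanD[where A = A, OF this A]
    have "qle (M w A) id_blinfun" if "qle (\<Sum>i<n. w i *\<^sub>R A i) id_blinfun" using D(2) that by (rule qle_trans)
    moreover have "qle id_blinfun (\<Sum>i<n. w i *\<^sub>R opinv (A i))" if "qle (M w A) id_blinfun"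
    proof -
      have "opinv id_blinfun = (id_blinfun :: 'h oper)" by (intro opinv_eqI invertsI) auto
      then have "qle id_blinfun (opinv (M w A))" using opinv_mono[OF D(1) BH_pos_id that] by simp
      then show ?thesis using D(3) by (rule qle_trans)
    qed
    ultimately show ?thesis using ole_iff[OF BH_pos_sa[OF D(1)] BH_sa_intros(2)] by blast
  qed
  then show "qle (\<Sum>i<n. w i *\<^sub>R A i) id_blinfun \<Longrightarrow> M w A \<preceq> id_blinfun"
    and "M w A \<preceq> id_blinfun \<Longrightarrow> qle id_blinfun (\<Sum>i<n. w i *\<^sub>R opinv (A i))" by blast+
qed

text \<open>Splitting \<open>x = V v + z\<close> with \<open>z\<close> orthogonal to the range of \<open>V\<close>, the mixed terms are absorbed by AM-GM.\<close>

lemma diag_le_rank: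
  fixes B :: "nat \<Rightarrow> 'h::complex_hilbert oper"
  assumes B: "\<And>i. i < n \<Longrightarrow> sadj (B i)" "\<And>i. i < n \<Longrightarrow> norm (B i) \<le> b" and u: "(\<Sum>i<n. (u i)\<^sup>2) = 1"
    and le: "qle (\<Sum>i<n. (u i)\<^sup>2 *\<^sub>R B i) (t *\<^sub>R id_blinfun)" and e: "0 < e"
  shows "(\<Sum>i<n. inner (x i) (B i (x i))) \<le>
    (b + b\<^sup>2 / e) * (\<Sum>i<n. inner (x i) (x i)) + (t + e - (b + b\<^sup>2 / e)) * inner (vadj n u x) (vadj n u x)"
proof -
  \<comment> \<open>\<open>b\<close> bounds the form on \<open>z\<close>;
    \<open>b\<^sup>2 / e\<close> pays for the mixed terms, whose remaining part costs
    \<open>e\<close> in the direction of \<open>v\<close>.\<close>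
  define v \<mu> where "v = vadj n u x" and "\<mu> = b + b\<^sup>2 / e"
  define z where "z i = x i - u i *\<^sub>R v" for i
  have zz: "(\<Sum>i<n. inner (z i) (z i)) = (\<Sum>i<n. inner (x i) (x i)) - inner v v"
  proof -
    have "(\<Sum>i<n. inner (z i) (z i)) = (\<Sum>i<n. inner (x i) (x i) - 2 * inner v (u i *\<^sub>R x i) + (u i)\<^sup>2 * inner v v)"
      by (intro sum.cong) (auto simp: z_def inner_simps inner_commute power2_eq_square algebra_simps)
    also have "\<dots> = (\<Sum>i<n. inner (x i) (x i)) - 2 * inner v (\<Sum>i<n. u i *\<^sub>R x i) + inner v v"
      by (simp only: sum.distrib sum_subtractf sum_distrib_left[symmetric] sum_distrib_right[symmetric]
          inner_sum_right[symmetric] u mult_1)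
    finally show ?thesis by (simp add: v_def vadj_def)
  qed
  have pointwise: "inner (x i) (B i (x i)) \<le> (u i)\<^sup>2 * inner v (B i v) + e * (u i)\<^sup>2 * inner v v + \<mu> * inner (z i) (z i)"
    if i: "i < n" for i
  proof -
    have xi: "x i = u i *\<^sub>R v + z i" by (simp add: z_def)
    have "inner (x i) (B i (x i)) = (u i)\<^sup>2 * inner v (B i v) + 2 * u i * inner (z i) (B i v) + inner (z i) (B i (z i))"
      using sadjD[OF B(1)[OF i], of v "z i"]
      by (simp add: xi blinfun.bilinear_simps inner_simps inner_commute power2_eq_square algebra_simps)
    moreover have "inner (z i) (B i (z i)) \<le> b * inner (z i) (z i)"
    proof -
      have "inner (z i) (B i (z i)) \<le> norm (B i) * inner (z i) (z i)"
        using qle_norm(1)[of "B i"] by (simp add: qle_def blinfun.bilinear_simps)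
      also have "\<dots> \<le> b * inner (z i) (z i)" using B(2)[OF i] by (intro mult_right_mono) auto
      finally show ?thesis .
    qed
    moreover have "2 * u i * inner (z i) (B i v) \<le> e * (u i)\<^sup>2 * inner v v + b\<^sup>2 / e * inner (z i) (z i)"
    proof -
      define g where "g = (sqrt e * \<bar>u i\<bar>) * norm v"
      define k where "k = (b / sqrt e) * norm (z i)"
      have b0: "0 \<le> b" using B(2)[OF i] norm_ge_zero order_trans by blast
      have "norm (B i v) \<le> b * norm v"
        using norm_blinfun[of "B i" v] mult_right_mono[OF B(2)[OF i], of "norm v"] by simp
      then have "\<bar>inner (z i) (B i v)\<bar> \<le> norm (z i) * (b * norm v)"
        using Cauchy_Schwarz_ineq2[of "z i" "B i v"] mult_left_mono[of "norm (B i v)" "b * norm v" "norm (z i)"] by simp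
      then have "\<bar>u i\<bar> * \<bar>inner (z i) (B i v)\<bar> \<le> \<bar>u i\<bar> * (norm (z i) * (b * norm v))"
        by (intro mult_left_mono) auto
      moreover have "u i * inner (z i) (B i v) \<le> \<bar>u i\<bar> * \<bar>inner (z i) (B i v)\<bar>"
        unfolding abs_mult[symmetric] by (rule abs_ge_self)
      moreover have "\<bar>u i\<bar> * (norm (z i) * (b * norm v)) = g * k" using e by (simp add: g_def k_def)
      moreover have "2 * g * k \<le> g\<^sup>2 + k\<^sup>2" by (rule sum_squares_bound)
      moreover have "g\<^sup>2 = e * (u i)\<^sup>2 * inner v v" "k\<^sup>2 = b\<^sup>2 / e * inner (z i) (z i)"
        using e by (simp_all add: g_def k_def power_mult_distrib power_divide power2_norm_eq_inner)
      ultimately show ?thesis by linarith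
    qed
    ultimately show ?thesis by (simp add: \<mu>_def distrib_right)
  qed
  have "(\<Sum>i<n. inner (x i) (B i (x i))) \<le>
      (\<Sum>i<n. (u i)\<^sup>2 * inner v (B i v) + e * (u i)\<^sup>2 * inner v v + \<mu> * inner (z i) (z i))"
    using pointwise by (intro sum_mono) auto
  also have "\<dots> = (\<Sum>i<n. (u i)\<^sup>2 * inner v (B i v)) + e * inner v v + \<mu> * (\<Sum>i<n. inner (z i) (z i))"
    by (simp only: sum.distrib sum_distrib_left[symmetric] sum_distrib_right[symmetric] u mult_1_right)
  also have "(\<Sum>i<n. (u i)\<^sup>2 * inner v (B i v)) \<le> t * inner v v"
    using le by (simp add: qle_def blinfun.sum_left blinfun.bilinear_simps inner_sum_right)
  finally show ?thesis unfolding zz v_def[symmetric] \<mu>_def[symmetric] by (simp add: algebra_simps)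
qed

text \<open>The condition on \<open>l * K\<close> confines every spectrum to [1/2, 3/2], so the
  interval of approximation and the norm bound do not depend on \<open>l\<close>.\<close>

lemma scaled_perturbation:
  fixes T :: "'h::complex_hilbert oper"
  assumes T: "T \<in> BH_sa" and l: "0 \<le> l" "norm T \<le> K" "l * K \<le> 1 / 2"
  shows "l *\<^sub>R T + id_blinfun \<in> BH_pos" "rspec (l *\<^sub>R T + id_blinfun) \<subseteq> {1 - l * K..1 + l * K}"
    "norm (l *\<^sub>R T + id_blinfun) \<le> 3 / 2"
proof -
  let ?B = "l *\<^sub>R T + id_blinfun"
  have sa: "?B \<in> BH_sa" using T by (intro BH_sa_intros(2,3,5))
  then have sB: "sadj ?B" by (simp add: BH_sa_iff)
  have Tx: "\<bar>l * inner x (T x)\<bar> \<le> l * K * inner x x" for x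
  proof -
    have "\<bar>inner x (T x)\<bar> \<le> norm T * inner x x"
      using qle_norm[of T] by (auto simp: qle_def blinfun.bilinear_simps abs_le_iff minus_le_iff)
    also have "\<dots> \<le> K * inner x x" using l by (intro mult_right_mono) auto
    finally show ?thesis using l by (simp add: abs_mult mult.assoc mult_left_mono)
  qed
  have b: "qle ((1 - l * K) *\<^sub>R id_blinfun) ?B" "qle ?B ((1 + l * K) *\<^sub>R id_blinfun)"
    using abs_le_D1[OF Tx] abs_le_D2[OF Tx]
    by (simp_all add: qle_def blinfun.bilinear_simps inner_simps left_diff_distrib distrib_right minus_le_iff)
  show "?B \<in> BH_pos" unfolding BH_pos_iff using sa b(1) l by (intro conjI exI[of _ "1 - l * K"]) auto
  show "rspec ?B \<subseteq> {1 - l * K..1 + l * K}" by (rule rspec_bounds[OF sB b])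
  have "norm ?B \<le> norm (l *\<^sub>R T) + norm (id_blinfun :: 'h oper)" by (rule norm_triangle_ineq)
  also have "\<dots> \<le> l * K + 1" using l norm_blinfun_id_le by (intro add_mono) (auto intro: mult_left_mono)
  finally show "norm ?B \<le> 3 / 2" using l by simp
qed

theorem corollary6:
  fixes n :: nat and f :: "real \<Rightarrow> real" and w :: "nat \<Rightarrow> real"
    and T :: "nat \<Rightarrow> 'h::complex_hilbert \<Rightarrow>\<^sub>L 'h"
    and M :: "(nat \<Rightarrow> real) \<Rightarrow> (nat \<Rightarrow> 'h \<Rightarrow>\<^sub>L 'h) \<Rightarrow> 'h \<Rightarrow>\<^sub>L 'h"
  assumes "\<exists>x :: 'h. x \<noteq> 0"
    and "n \<ge> 2"
    and "f \<in> OM1 TYPE(nat \<Rightarrow> 'h)"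
    and "\<not> f constant_on {0<..}"
    and "\<forall>i<n. T i \<in> BH_sa"
    and "w \<in> weights n"
    and "(M = (\<lambda>_. alm n) \<and> (\<forall>i<n. w i = 1 / real n)) \<or> M = bmp n \<or> M = log_euclid n"
  shows "(\<Sum>i<n. w i *\<^sub>R T i) \<preceq> 0 \<longleftrightarrow>
    (\<exists>\<delta>>0. \<forall>l\<in>{0..\<delta>}.
       (\<forall>i<n. spec (l *\<^sub>R T i + id_blinfun) \<subseteq> of_real ` {0<..}) \<and>
       M w (\<lambda>i. fcalc f (l *\<^sub>R T i + id_blinfun)) \<preceq> id_blinfun)"
proof -
  note nz = assms(1)
  have om: "operator_monotone_on TYPE(nat \<Rightarrow> 'h) {0<..} f" and pos: "\<And>t. 0 < t \<Longrightarrow> 0 < f t" and f1: "f 1 = 1"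
    using assms(3) by (auto simp: OM1_def)
  have rot: "rot_monotone f" by (rule operator_monotone_rot[OF nz om])
  have cont: "continuous_on {0<..} f" by (rule rot_monotone_continuous[OF rot pos])
  have w0: "0 \<le> w i" if "i < n" for i using assms(6) that by (auto simp: weights_def less_imp_le)
  have w1: "(\<Sum>i<n. w i) = 1" using assms(6) by (simp add: weights_def)
  have T: "T i \<in> BH_sa" if "i < n" for i using assms(5) that by blast
  define K where "K = (\<Sum>i<n. norm (T i)) + 1"
  have K: "0 < K" by (simp add: K_def add_nonneg_pos sum_nonneg)
  have TK: "norm (T i) \<le> K" if "i < n" for i
    using member_le_sum[of i "{..<n}" "\<lambda>i. norm (T i)"] that by (simp add: K_def)
  define B where "B l i = l *\<^sub>R T i + id_blinfun" for l i
  have B: "B l i \<in> BH_pos" "rspec (B l i) \<subseteq> {1 - l * K..1 + l * K}" "norm (B l i) \<le> 3 / 2"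
    if "0 \<le> l" "l * K \<le> 1 / 2" "i < n" for l i
    unfolding B_def using scaled_perturbation[OF T[OF that(3)] that(1) TK[OF that(3)] that(2)] by blast+
  define F where "F l i = fcalc f (B l i)" for l i
  have Fpos: "F l i \<in> BH_pos" and Finv: "opinv (F l i) = fcalc (\<lambda>t. 1 / f t) (B l i)"
    if "0 \<le> l" "l * K \<le> 1 / 2" "i < n" for l i
    unfolding F_def using fcalc_pos[OF B(1)[OF that] cont pos] by blast+
  define W where "W = (\<Sum>i<n. w i *\<^sub>R T i)"
  have "W \<in> BH_sa" unfolding W_def using T by (intro BH_sa_intros(5,6)) auto
  then have W: "W \<preceq> 0 \<longleftrightarrow> qle W 0" by (rule ole_iff[OF _ BH_sa_intros(1)])
  show ?thesis
    unfolding W_def[symmetric] W B_def[symmetric] F_def[symmetric]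
  proof
    assume W0: "qle W 0"
    have "(\<forall>i<n. spec (B l i) \<subseteq> of_real ` {0<..}) \<and> M w (F l) \<preceq> id_blinfun" if l: "l \<in> {0..1 / (2 * K)}" for l
    proof
      have lK: "0 \<le> l" "l * K \<le> 1 / 2" using l K by (simp_all add: field_simps)
      note B = B[OF lK]
      \<comment> \<open>One interval for all blocks, on which a single polynomial sequence
        approximates \<open>f\<close>, as the diagonal operator requires.\<close>
      define S where "S = {1 / 2..3 / 2 :: real}"
      have BS: "rspec (B l i) \<subseteq> S" if "i < n" for i using B(2)[OF that] lK by (auto simp: S_def)
      show "\<forall>i<n. spec (B l i) \<subseteq> of_real ` {0<..}"
      proof (intro allI impI)
        fix i assume i: "i < n"
        have "rspec (B l i) \<subseteq> {0<..}" using BS[OF i] by (auto simp: S_def)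
        then show "spec (B l i) \<subseteq> of_real ` {0<..}" by (rule spec_subset[OF BH_pos_sa[OF B(1)[OF i]]])
      qed
      have "continuous_on S f" using cont by (rule continuous_on_subset) (auto simp: S_def)
      then obtain p where p: "uniform_limit S (\<lambda>m. poly (p m)) f sequentially"
        unfolding S_def by (rule Weierstrass_poly)
      have limF: "(\<lambda>m. bpoly (p m) (B l i)) \<longlonglongrightarrow> F l i" if i: "i < n" for i
      proof -
        note sB = BH_pos_sadj[OF B(1)[OF i]]
        obtain X where X: "(\<lambda>m. bpoly (p m) (B l i)) \<longlonglongrightarrow> X" "fc f (B l i) X"
          by (rule bpoly_convergent[OF sB uniform_limit_on_subset[OF p BS[OF i]]])
        then show ?thesis using fcalc_eqI[OF BH_pos_sa[OF B(1)[OF i]] X(2)] by (simp add: F_def)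
      qed
      define u where "u i = sqrt (w i)" for i
      have u: "(u i)\<^sup>2 = w i" if "i < n" for i using w0[OF that] by (simp add: u_def)
      have u1: "(\<Sum>i<n. (u i)\<^sup>2) = 1" using u w1 by simp
      have sumB: "(\<Sum>i<n. (u i)\<^sup>2 *\<^sub>R B l i) = l *\<^sub>R W + id_blinfun"
        using u w1 by (simp add: B_def W_def scaleR_add_right sum.distrib scaleR_sum_right
            scaleR_sum_left[symmetric] mult.commute)
      have "qle (l *\<^sub>R W) (l *\<^sub>R 0)" using lK(1) W0 by (rule qle_scaleR)
      then have le1: "qle (\<Sum>i<n. (u i)\<^sup>2 *\<^sub>R B l i) (1 *\<^sub>R id_blinfun)"
        unfolding sumB by (simp add: qle_def blinfun.bilinear_simps inner_simps)
      \<comment> \<open>On vectors in the range of V, which \<open>vadj\<close> maps back to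
        \<open>v\<close>, the terms with \<open>f \<mu>\<close> cancel and only
        \<open>f (1 + e)\<close> is left.\<close>
      have bound: "inner v ((\<Sum>i<n. w i *\<^sub>R F l i) v) \<le> f (1 + e) * inner v v" if e: "0 < e" for v :: 'h and e
      proof -
        define \<mu> where "\<mu> = 3 / 2 + (3 / 2)\<^sup>2 / e"
        have \<mu>: "0 < \<mu>" using e by (simp add: \<mu>_def add_pos_pos)
        have "(\<Sum>i<n. inner (u i *\<^sub>R v) (F l i (u i *\<^sub>R v))) \<le>
            f \<mu> * (\<Sum>i<n. inner (u i *\<^sub>R v) (u i *\<^sub>R v)) +
            (f (1 + e) - f \<mu>) * inner (vadj n u (\<lambda>i. u i *\<^sub>R v)) (vadj n u (\<lambda>i. u i *\<^sub>R v))"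
        proof (rule operator_monotone_dominate[OF om _ BS _ p limF u1 _ \<mu>])
          show "B l i \<in> BH_sa" if "i < n" for i by (rule BH_pos_sa[OF B(1)[OF that]])
          show "S \<subseteq> {0<..}" by (auto simp: S_def)
          show "(\<Sum>i<n. inner (x i) (B l i (x i))) \<le>
              \<mu> * (\<Sum>i<n. inner (x i) (x i)) + (1 + e - \<mu>) * inner (vadj n u x) (vadj n u x)" for x
            unfolding \<mu>_def by (rule diag_le_rank[OF BH_pos_sadj[OF B(1)] B(3) u1 le1 e])
        qed (use e in simp_all)
        moreover have "(\<Sum>i<n. inner (u i *\<^sub>R v) (u i *\<^sub>R v)) = inner v v"
          using u1 by (simp add: sum_distrib_right[symmetric] power2_eq_square mult.assoc[symmetric])
        moreover have "(\<Sum>i<n. inner (u i *\<^sub>R v) (F l i (u i *\<^sub>R v))) = inner v ((\<Sum>i<n. w i *\<^sub>R F l i) v)"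
          using u by (simp add: blinfun.sum_left blinfun.bilinear_simps inner_sum_right power2_eq_square
              mult.assoc[symmetric])
        ultimately show ?thesis by (simp add: vadj_const[OF u1] algebra_simps)
      qed
      have "qle (\<Sum>i<n. w i *\<^sub>R F l i) id_blinfun"
        unfolding qle_def
      proof
        fix v :: 'h
        have "isCont f 1" using cont by (simp add: continuous_on_eq_continuous_at)
        moreover have "(\<lambda>k. 1 + 1 / real (Suc k)) \<longlonglongrightarrow> 1 + 0"
          by (intro tendsto_intros LIMSEQ_Suc lim_1_over_n)
        ultimately have "(\<lambda>k. f (1 + 1 / real (Suc k))) \<longlonglongrightarrow> f 1"
          using isCont_tendsto_compose[of 1 f "\<lambda>k. 1 + 1 / real (Suc k)"] by (simp del: of_nat_Suc)
        then have "(\<lambda>k. f (1 + 1 / real (Suc k)) * inner v v) \<longlonglongrightarrow> f 1 * inner v v" by (rule tendsto_mult_right)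
        moreover have "inner v ((\<Sum>i<n. w i *\<^sub>R F l i) v) \<le> f (1 + 1 / real (Suc k)) * inner v v" for k
          by (rule bound) simp
        ultimately have "inner v ((\<Sum>i<n. w i *\<^sub>R F l i) v) \<le> f 1 * inner v v" by (auto intro: LIMSEQ_le_const)
        then show "inner v ((\<Sum>i<n. w i *\<^sub>R F l i) v) \<le> inner v (id_blinfun v)" by (simp add: f1)
      qed
      then show "M w (F l) \<preceq> id_blinfun"
        using mean_le_id(1)[of n w M "F l", OF nz assms(2,6,7) Fpos[OF lK]] by blast
    qed
    then show "\<exists>\<delta>>0. \<forall>l\<in>{0..\<delta>}. (\<forall>i<n. spec (B l i) \<subseteq> of_real ` {0<..}) \<and> M w (F l) \<preceq> id_blinfun"
      using K by (intro exI[of _ "1 / (2 * K)"]) auto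
  next
    assume "\<exists>\<delta>>0. \<forall>l\<in>{0..\<delta>}. (\<forall>i<n. spec (B l i) \<subseteq> of_real ` {0<..}) \<and> M w (F l) \<preceq> id_blinfun"
    then obtain \<delta> where \<delta>: "0 < \<delta>" "\<And>l. 0 \<le> l \<Longrightarrow> l \<le> \<delta> \<Longrightarrow> M w (F l) \<preceq> id_blinfun" by auto
    obtain c where c: "0 < c"
      and up: "\<And>e. 0 < e \<Longrightarrow> \<exists>d>0. \<forall>s. \<bar>s\<bar> \<le> d \<longrightarrow> 1 / f (1 + s) \<le> 1 - c * s + e * \<bar>s\<bar>"
      using rot_monotone_inverse_upper[OF rot pos f1 assms(4)] by blast
    have bound: "c * inner v (W v) \<le> e * (K * inner v v)" if e: "0 < e" for v :: 'h and e
    proof -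
      obtain d where d: "0 < d" "\<And>s. \<bar>s\<bar> \<le> d \<Longrightarrow> 1 / f (1 + s) \<le> 1 - c * s + e * \<bar>s\<bar>" using up[OF e] by blast
      \<comment> \<open>Small enough for the hypothesis, for positivity of the \<open>B l i\<close>,
        and for keeping their spectra within \<open>d\<close> of 1.\<close>
      define l where "l = min \<delta> (min (1 / (2 * K)) (d / K))"
      have "l \<le> 1 / 2 / K" "l \<le> d / K" by (simp_all add: l_def)
      then have lK: "l * K \<le> 1 / 2" "l * K \<le> d" unfolding pos_le_divide_eq[OF K] .
      have "0 < l" "l \<le> \<delta>" using \<delta>(1) d(1) K by (auto simp: l_def)
      note l = this lK
      have l0: "0 \<le> l" using l by simp
      note Fp = Fpos[OF l0 l(3)]
      \<comment> \<open>On the spectrum \<open>e * \<bar>t - 1\<bar>\<close> is at most the constant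
        \<open>e * (l * K)\<close>, so \<open>1 / f\<close> has an affine majorant of slope
        \<open>- c\<close>, that is, a polynomial in \<open>B l i\<close>.\<close>
      have Fle: "qle (opinv (F l i)) (bpoly [:1 + c + e * (l * K), - c:] (B l i))" if i: "i < n" for i
        unfolding Finv[OF l0 l(3) i]
      proof (rule fc_mono[OF BH_pos_sadj[OF B(1)[OF l0 l(3) i]] fcalc_pos_domain(1)[OF B(1)[OF l0 l(3) i]] fc_poly])
        show "continuous_on {0<..} (\<lambda>t. 1 / f t)" using cont pos by (intro continuous_intros) force+
        fix t assume "t \<in> rspec (B l i)"
        then have t: "\<bar>t - 1\<bar> \<le> l * K" using B(2)[OF l0 l(3) i] by (auto simp: abs_le_iff)
        have "1 / f t \<le> 1 - c * (t - 1) + e * \<bar>t - 1\<bar>" using d(2)[of "t - 1"] t l(4) by simp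
        also have "\<dots> \<le> 1 - c * (t - 1) + e * (l * K)" using t e by simp
        finally show "1 / f t \<le> poly [:1 + c + e * (l * K), - c:] t" by (simp add: algebra_simps)
      qed
      have poly_eq: "bpoly [:1 + c + e * (l * K), - c:] (B l i) = (1 + e * (l * K)) *\<^sub>R id_blinfun - (c * l) *\<^sub>R T i" for i
        by (intro blinfun_eqI) (simp add: B_def blinfun.bilinear_simps algebra_simps)
      have "qle id_blinfun (\<Sum>i<n. w i *\<^sub>R opinv (F l i))"
        using mean_le_id(2)[of n w M "F l", OF nz assms(2,6,7) Fp] \<delta>(2)[OF l0 l(2)] by blast
      moreover have "qle (\<Sum>i<n. w i *\<^sub>R opinv (F l i)) (\<Sum>i<n. w i *\<^sub>R bpoly [:1 + c + e * (l * K), - c:] (B l i))"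
        using w0 Fle by (intro qle_sum qle_scaleR) auto
      ultimately have "qle id_blinfun (\<Sum>i<n. w i *\<^sub>R ((1 + e * (l * K)) *\<^sub>R id_blinfun - (c * l) *\<^sub>R T i))"
        unfolding poly_eq by (rule qle_trans)
      also have "(\<Sum>i<n. w i *\<^sub>R ((1 + e * (l * K)) *\<^sub>R id_blinfun - (c * l) *\<^sub>R T i)) =
          (1 + e * (l * K)) *\<^sub>R id_blinfun - (c * l) *\<^sub>R W"
      proof -
        have "(\<Sum>i<n. w i *\<^sub>R ((1 + e * (l * K)) *\<^sub>R id_blinfun - (c * l) *\<^sub>R T i)) =
            (\<Sum>i<n. w i *\<^sub>R ((1 + e * (l * K)) *\<^sub>R id_blinfun)) - (\<Sum>i<n. (c * l) *\<^sub>R (w i *\<^sub>R T i))"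
          by (simp only: scaleR_diff_right sum_subtractf scaleR_left_commute)
        then show ?thesis
          unfolding W_def scaleR_sum_left[symmetric] scaleR_sum_right[symmetric] w1 scaleR_one .
      qed
      finally have "inner v v \<le> (1 + e * (l * K)) * inner v v - c * l * inner v (W v)"
        by (simp add: qle_def blinfun.bilinear_simps inner_simps)
      \<comment> \<open>The zeroth-order terms cancel and the rest is proportional to
        \<open>l\<close>; dividing by it leaves an error that vanishes with
        \<open>e\<close>.\<close>
      then have "l * (c * inner v (W v)) \<le> l * (e * (K * inner v v))" by (simp add: algebra_simps)
      then show ?thesis using l(1) by simp
    qed
    show "qle W 0"
      unfolding qle_def
    proof
      fix v :: 'h
      have "c * inner v (W v) \<le> 0"
      proof (rule field_le_epsilon)
        fix e :: real assume e: "0 < e"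
        define e' where "e' = e / (K * inner v v + 1)"
        have k: "0 < K * inner v v + 1" using K by (simp add: add_nonneg_pos)
        have "c * inner v (W v) \<le> e' * (K * inner v v)" using e k by (intro bound) (simp add: e'_def)
        also have "\<dots> \<le> e' * (K * inner v v + 1)" using e k by (intro mult_left_mono) (simp_all add: e'_def)
        also have "\<dots> = e" using k by (simp add: e'_def)
        finally show "c * inner v (W v) \<le> 0 + e" by simp
      qed
      then show "inner v (W v) \<le> inner v ((0 :: 'h oper) v)" using c by (simp add: mult_le_0_iff)
    qed
  qed
qed

end
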